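(* Let $F$ be Thompson's group $F$, let $S$ be a finite generating set for $F$, and let $\mathrm{CLF}\colon\mathbb{N}\to\mathbb{N}$ be the conjugator length function of $F$ with respect to $S$. Then there exist constants $0<a<b$ such that \[ an^2\le \mathrm{CLF}(n)\le bn^2 \] for all sufficiently large $n$.
   Context: Thompson's group $F$ is the group with presentation $\langle x_0,x_1,x_2,\ldots \mid x_nx_k=x_kx_{n+1}\text{ for }n>k\rangle$; it is generated by $\{x_0,x_1\}$. Let $G$ be a group with finite generating set $S$ and let $\ell\colon G\to\mathbb{N}$ be the word length with respect to $S$ (and inverses). For conjugate $g,h\in G$, the conjugator distance is $\mathrm{cd}(g,h)=\min\{\ell(k)\mid k\in G\text{ and }h=k^{-1}gk\}$. The conjugator length function of $G$ with respect to $S$ is \[ \mathrm{CLF}(n)=\max\{\mathrm{cd}(g,h)\mid g,h\in G\text{ are conjugate and }\ell(g)+\ell(h)\le n\}. \] *)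

theory Defs
  imports Complex_Main "HOL-Algebra.Generated_Groups"
begin

section \<open>Groups given by presentations\<close>

text \<open>
  A letter \<^term>\<open>(x, True)\<close> stands for the generator \<open>x\<close> and \<^term>\<open>(x, False)\<close> for its
  formal inverse.  A relation \<open>l = r\<close> is the pair \<^term>\<open>(l, r)\<close>.
\<close>

type_synonym 'a word = "('a \<times> bool) list"

inductive pres_eq :: "('a word \<times> 'a word) set \<Rightarrow> 'a word \<Rightarrow> 'a word \<Rightarrow> bool"
  for R :: "('a word \<times> 'a word) set"
where
  refl: "pres_eq R u u"
| sym: "pres_eq R u v \<Longrightarrow> pres_eq R v u"
| trans: "pres_eq R u v \<Longrightarrow> pres_eq R v w \<Longrightarrow> pres_eq R u w"
| cancel: "pres_eq R (u @ [(x, b), (x, \<not> b)] @ v) (u @ v)"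
| rel: "(l, r) \<in> R \<Longrightarrow> pres_eq R (u @ l @ v) (u @ r @ v)"

definition pres_class :: "('a word \<times> 'a word) set \<Rightarrow> 'a word \<Rightarrow> 'a word set" where
  "pres_class R u = {v. pres_eq R u v}"

text \<open>The generators are all elements of the type \<open>'a\<close>.\<close>

definition presented_group :: "('a word \<times> 'a word) set \<Rightarrow> 'a word set monoid" where
  "presented_group R =
     \<lparr> carrier = range (pres_class R),
       mult = (\<lambda>A B. \<Union>u\<in>A. \<Union>v\<in>B. pres_class R (u @ v)),
       one = pres_class R [] \<rparr>"

lemma pres_eq_append:
  assumes "pres_eq R u u'" and "pres_eq R v v'"
  shows "pres_eq R (u @ v) (u' @ v')"
proof -
  have left: "pres_eq R (w @ p) (w @ q)" if "pres_eq R p q" for w p q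
    using that
  proof (induction rule: pres_eq.induct)
    case (cancel u x b v)
    then show ?case using pres_eq.cancel[of R "w @ u" x b v] by simp
  next
    case (rel l r u v)
    then show ?case using pres_eq.rel[of l r R "w @ u" v] by simp
  qed (auto intro: pres_eq.intros)
  have right: "pres_eq R (p @ w) (q @ w)" if "pres_eq R p q" for w p q
    using that
  proof (induction rule: pres_eq.induct)
    case (cancel u x b v)
    then show ?case using pres_eq.cancel[of R u x b "v @ w"] by simp
  next
    case (rel l r u v)
    then show ?case using pres_eq.rel[of l r R u "v @ w"] by simp
  qed (auto intro: pres_eq.intros)
  show ?thesis
    using right[OF assms(1)] left[OF assms(2)] by (rule pres_eq.trans)
qed

lemma pres_class_eq_iff: "pres_class R u = pres_class R v \<longleftrightarrow> pres_eq R u v"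
  unfolding pres_class_def by (auto intro: pres_eq.intros)

lemma presented_group_simps:
  "carrier (presented_group R) = range (pres_class R)"
  "\<one>\<^bsub>presented_group R\<^esub> = pres_class R []"
  "pres_class R u \<otimes>\<^bsub>presented_group R\<^esub> pres_class R v = pres_class R (u @ v)"
proof -
  have "pres_class R (u' @ v') = pres_class R (u @ v)"
    if "u' \<in> pres_class R u" "v' \<in> pres_class R v" for u' v'
  proof -
    have "pres_eq R (u @ v) (u' @ v')"
      using that by (intro pres_eq_append) (simp_all add: pres_class_def)
    then show ?thesis
      unfolding pres_class_eq_iff by (rule pres_eq.sym)
  qed
  moreover have "u \<in> pres_class R u" "v \<in> pres_class R v"
    by (auto simp: pres_class_def intro: pres_eq.refl)
  ultimately have "(\<Union>u'\<in>pres_class R u. \<Union>v'\<in>pres_class R v. pres_class R (u' @ v'))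
      = pres_class R (u @ v)"
    by blast
  then show
    "pres_class R u \<otimes>\<^bsub>presented_group R\<^esub> pres_class R v = pres_class R (u @ v)"
    by (simp add: presented_group_def)
qed (simp_all add: presented_group_def)

lemma group_presented_group: "group (presented_group R)"
proof (rule groupI)
  fix A assume "A \<in> carrier (presented_group R)"
  then obtain u where A: "A = pres_class R u"
    by (auto simp: presented_group_simps)
  define inv_word where "inv_word = (\<lambda>w :: 'a word. rev (map (\<lambda>(x, b). (x, \<not> b)) w))"
  have "pres_eq R (inv_word u @ u) []"
  proof (induction u)
    case Nil
    then show ?case by (simp add: inv_word_def pres_eq.refl)
  next
    case (Cons a u)
    obtain x b where a: "a = (x, b)" by force
    have "pres_eq R (inv_word (a # u) @ a # u) (inv_word u @ u)"
      using pres_eq.cancel[of R "inv_word u" x "\<not> b" u] by (simp add: inv_word_def a)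
    then show ?case using Cons.IH by (rule pres_eq.trans)
  qed
  then show "\<exists>B\<in>carrier (presented_group R).
      B \<otimes>\<^bsub>presented_group R\<^esub> A = \<one>\<^bsub>presented_group R\<^esub>"
    unfolding A by (auto simp: presented_group_simps pres_class_eq_iff)
qed (auto simp: presented_group_simps)

section \<open>Thompson's group F\<close>

definition thompson_relations :: "(nat word \<times> nat word) set" where
  "thompson_relations =
     {([(n, True), (k, True)], [(k, True), (Suc n, True)]) | n k. n > k}"

definition thompson_F :: "nat word set monoid" where
  "thompson_F = presented_group thompson_relations"

section \<open>Word length and the conjugator length function\<close>

definition word_length :: "('a, 'b) monoid_scheme \<Rightarrow> 'a set \<Rightarrow> 'a \<Rightarrow> nat" where
  "word_length G S g =
     (LEAST n. \<exists>ws. length ws = n \<and> set ws \<subseteq> S \<union> m_inv G ` S \<and>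
                    foldr (mult G) ws \<one>\<^bsub>G\<^esub> = g)"

definition conjugate :: "('a, 'b) monoid_scheme \<Rightarrow> 'a \<Rightarrow> 'a \<Rightarrow> bool" where
  "conjugate G g h \<longleftrightarrow>
     (\<exists>k\<in>carrier G. h = inv\<^bsub>G\<^esub> k \<otimes>\<^bsub>G\<^esub> g \<otimes>\<^bsub>G\<^esub> k)"

definition conjugator_distance ::
  "('a, 'b) monoid_scheme \<Rightarrow> 'a set \<Rightarrow> 'a \<Rightarrow> 'a \<Rightarrow> nat" where
  "conjugator_distance G S g h =
     (LEAST m. \<exists>k\<in>carrier G. h = inv\<^bsub>G\<^esub> k \<otimes>\<^bsub>G\<^esub> g \<otimes>\<^bsub>G\<^esub> k \<and> m = word_length G S k)"

text \<open>
  The maximum is over a finite nonempty set whenever \<open>S\<close> is a finite generating set of the group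
  \<open>G\<close>, since then there are only finitely many elements of bounded word length.
\<close>

definition conjugator_length_function ::
  "('a, 'b) monoid_scheme \<Rightarrow> 'a set \<Rightarrow> nat \<Rightarrow> nat" where
  "conjugator_length_function G S n =
     Max {conjugator_distance G S g h | g h.
            g \<in> carrier G \<and> h \<in> carrier G \<and> conjugate G g h \<and>
            word_length G S g + word_length G S h \<le> n}"

end

theory Submission
  imports Defs "HOL-Library.Stream" "HOL-Library.Sublist" "HOL-Library.Infinite_Set"
begin

text \<open>Thompson's group acts faithfully on the infinite binary sequences.  An element acts as an
  order-preserving bijection which replaces the prefix \<open>w\<close> by another word, for all but finitely many
  words \<open>w\<close>.  The number of these exceptional words, the breaks, is comparable to the word length.

  Upper bound: let \<open>h\<close> conjugate \<open>f\<close> to \<open>g\<close>, where \<open>f\<close> and \<open>g\<close> have at most \<open>N\<close> breaks.  If \<open>w\<close> is a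
  break of \<open>h\<close> but not of \<open>f\<close>, then the image of \<open>w\<close> under \<open>f\<close> is a break of \<open>h\<close> too, unless it gives
  rise to a break of the inverse of \<open>g\<close>.  So the breaks of \<open>h\<close> where \<open>f\<close> is not the identity form \<open>O(N)\<close>
  segments of orbits of \<open>f\<close>, and it remains to bound the length of the segments.  An orbit leaves a
  cone around a repelling fixed point, makes \<open>O(N)\<close> steps in transit, and enters a cone around an
  attracting fixed point.  There a segment ends once the image of the orbit under \<open>h\<close> has entered the
  corresponding cone of \<open>g\<close>.  The delay is, up to one, the same for all orbits with the same limit, and
  between neighbouring fixed points it changes by at most the transit times, which add up to \<open>O(N)\<close>.
  Only at a fixed point which is an end of a cone does this comparison fail, but from there on \<open>h\<close> may be
  composed with a power of \<open>f\<close> so that the delay vanishes.  Hence a suitable \<open>h\<close> has \<open>O(N\<^sup>2)\<close> breaks; on the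
  intervals where \<open>f\<close> is the identity, it can be replaced by a map with few breaks.

  Lower bound: take \<open>f\<close> and \<open>g\<close> which act like the translation of a line by two units, except
  that in the course of time they apply \<open>x_0\<^sup>n\<close> once to the odd and once to the even unit intervals.  If
  they do so at once and with a time lag of \<open>n\<close>, respectively, then no conjugator can match both
  events, and it has to apply \<open>x_0\<^sup>n\<close> or its inverse to at least \<open>n\<close> intervals.\<close>

text \<open>An arbitrary conjugator may be far too long, because composing it with a power of
  \<open>f\<close> shifts every delay. Adjusting the delay at one fixed point, independently of what
  lies to its left, requires a cut that creates only finitely many breaks, that is, a cut at the
  left end of a cone. A fixed point inside a cone ties its two sides together, since there is a
  single delay for both; so delays have to be compared along orbits, from left to right. Sequences
  help here: a dyadic number is represented by two of them, which separates its two sides from the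
  start. The running bound for a delay is the number of leaves of \<open>f\<close> and
  \<open>g\<close> further left. From one fixed point to the next it grows by at least the transit
  times plus the rounding error, so the errors do not pile up. Breaks are subadditive under
  composition and therefore bound the word length from below at once; the reverse estimate uses tree
  pairs and sorted positive words. Since F is given by a presentation, faithfulness has to be proved
  as well: rotations of deep trees turn a trivial action into a consequence of the
  relations.\<close>

text \<open>The notation \<open>inv\<close> is taken by the group inverse of HOL-Algebra.\<close>

abbreviation finv :: "('a \<Rightarrow> 'b) \<Rightarrow> 'b \<Rightarrow> 'a" where
  "finv \<equiv> inv_into UNIV"

section \<open>The lexicographic order on infinite sequences\<close>

instantiation stream :: (linorder) linorder
begin

definition less_stream :: "'a stream \<Rightarrow> 'a stream \<Rightarrow> bool" where
  "less_stream x y \<longleftrightarrow> (\<exists>n. (\<forall>i<n. x !! i = y !! i) \<and> x !! n < y !! n)"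

definition less_eq_stream :: "'a stream \<Rightarrow> 'a stream \<Rightarrow> bool" where
  "less_eq_stream x y \<longleftrightarrow> x = y \<or> x < y"

instance
proof
  have asym: "\<not> y < x" if "x < y" for x y :: "'a stream"
  proof
    assume "y < x"
    from that obtain n where n: "\<forall>i<n. x !! i = y !! i" "x !! n < y !! n"
      by (auto simp: less_stream_def)
    from \<open>y < x\<close> obtain m where m: "\<forall>i<m. y !! i = x !! i" "y !! m < x !! m"
      by (auto simp: less_stream_def)
    consider "n < m" | "n = m" | "m < n" by linarith
    then show False using n m by cases auto
  qed
  have irrefl: "\<not> x < x" for x :: "'a stream"
    by (simp add: less_stream_def)
  have trans: "x < z" if "x < y" "y < z" for x y z :: "'a stream"
  proof -
    from that(1) obtain n where n: "\<forall>i<n. x !! i = y !! i" "x !! n < y !! n"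
      by (auto simp: less_stream_def)
    from that(2) obtain m where m: "\<forall>i<m. y !! i = z !! i" "y !! m < z !! m"
      by (auto simp: less_stream_def)
    have "(\<forall>i<min n m. x !! i = z !! i) \<and> x !! min n m < z !! min n m"
      using n m by (cases n m rule: linorder_cases) (auto simp: min_def)
    then show ?thesis unfolding less_stream_def by blast
  qed
  have total: "x < y \<or> x = y \<or> y < x" for x y :: "'a stream"
  proof (rule ccontr)
    assume a: "\<not> (x < y \<or> x = y \<or> y < x)"
    then have "\<exists>n. x !! n \<noteq> y !! n"
      by (metis smap_alt stream.map_ident)
    define n where "n = (LEAST n. x !! n \<noteq> y !! n)"
    have "x !! n \<noteq> y !! n"
      unfolding n_def using \<open>\<exists>n. x !! n \<noteq> y !! n\<close> by (rule LeastI_ex)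
    moreover have "\<forall>i<n. x !! i = y !! i"
      unfolding n_def using not_less_Least by blast
    ultimately show False
      using a unfolding less_stream_def by (metis linorder_less_linear)
  qed
  fix x y z :: "'a stream"
  show "(x < y) = (x \<le> y \<and> \<not> y \<le> x)"
    using asym irrefl by (auto simp: less_eq_stream_def)
  show "x \<le> x" by (simp add: less_eq_stream_def)
  show "x \<le> y \<Longrightarrow> y \<le> z \<Longrightarrow> x \<le> z" using trans by (auto simp: less_eq_stream_def)
  show "x \<le> y \<Longrightarrow> y \<le> x \<Longrightarrow> x = y" using asym by (auto simp: less_eq_stream_def)
  show "x \<le> y \<or> y \<le> x" using total by (auto simp: less_eq_stream_def)
qed

end

lemma stream_eq_snthI: "(\<And>n. x !! n = y !! n) \<Longrightarrow> x = y"
  by (metis smap_alt stream.map_ident)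

lemma shift_less_iff [simp]: "w @- x < w @- y \<longleftrightarrow> x < y"
  for x y :: "'a :: linorder stream"
proof
  assume "w @- x < w @- y"
  then obtain n where n: "\<forall>i<n. (w @- x) !! i = (w @- y) !! i" "(w @- x) !! n < (w @- y) !! n"
    by (auto simp: less_stream_def)
  have "n \<ge> length w"
    using n(2) by (metis less_irrefl not_le shift_snth_less)
  moreover have "x !! i = y !! i" if "i < n - length w" for i
    using n(1)[rule_format, of "i + length w"] that by simp
  ultimately show "x < y"
    unfolding less_stream_def using n(2) by (intro exI[of _ "n - length w"]) auto
next
  assume "x < y"
  then obtain n where n: "\<forall>i<n. x !! i = y !! i" "x !! n < y !! n"
    by (auto simp: less_stream_def)
  then show "w @- x < w @- y"
    unfolding less_stream_def by (intro exI[of _ "n + length w"]) (auto simp: shift_snth)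
qed

lemma shift_le_iff [simp]: "w @- x \<le> w @- y \<longleftrightarrow> x \<le> y"
  for x y :: "'a :: linorder stream"
  by (simp add: less_eq_stream_def)

lemma SCons_less_iff [simp]:
  "a ## x < b ## y \<longleftrightarrow> a < b \<or> a = b \<and> x < y" for x y :: "'a :: linorder stream"
proof -
  have "a ## x < a ## y \<longleftrightarrow> x < y"
    using shift_less_iff[of "[a]" x y] by simp
  moreover have "a ## x < b ## y" if "a < b"
    using that unfolding less_stream_def by (intro exI[of _ 0]) auto
  moreover have "\<not> a ## x < b ## y" if "b < a"
  proof -
    have "b ## y < a ## x"
      using that unfolding less_stream_def by (intro exI[of _ 0]) auto
    then show ?thesis by simp
  qed
  ultimately show ?thesis by (metis linorder_less_linear)
qed

lemma sconst_False_le: "sconst False \<le> x"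
proof (rule ccontr)
  assume "\<not> sconst False \<le> x"
  then have "x < sconst False" by simp
  then show False by (auto simp: less_stream_def id_funpow)
qed

section \<open>Cones\<close>

definition cone :: "bool list \<Rightarrow> bool stream set" where
  "cone w = range (\<lambda>s. w @- s)"

lemma shift_in_cone [simp]: "w @- s \<in> cone w"
  by (simp add: cone_def)

lemma in_coneE: assumes "x \<in> cone w" obtains s where "x = w @- s"
  using assms by (auto simp: cone_def)

lemma in_cone_iff: "x \<in> cone w \<longleftrightarrow> stake (length w) x = w"
proof
  assume "stake (length w) x = w"
  then have "x = w @- sdrop (length w) x" by (metis stake_sdrop)
  then show "x \<in> cone w" by (metis shift_in_cone)
qed (auto simp: cone_def stake_shift)

lemma cone_append_subset: "cone (v @ w) \<subseteq> cone v"
  by (auto simp: cone_def)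

lemma cone_mono: "prefix v w \<Longrightarrow> cone w \<subseteq> cone v"
  by (auto simp: prefix_def cone_def)

lemma shift_in_cone_append_iff [simp]: "v @- s \<in> cone (v @ w) \<longleftrightarrow> s \<in> cone w"
  by (auto simp: cone_def)

lemma cone_nested:
  assumes "x \<in> cone v" "x \<in> cone w"
  shows "prefix v w \<or> prefix w v"
proof -
  have "v = stake (length v) x" "w = stake (length w) x"
    using assms by (simp_all add: in_cone_iff)
  then show ?thesis
    by (metis le_cases min.absorb1 take_is_prefix take_stake)
qed

lemma cone_nested_length:
  assumes "x \<in> cone v" "x \<in> cone w" "length v \<le> length w"
  shows "prefix v w"
  using cone_nested[OF assms(1,2)] assms(3)
  by (metis le_antisym not_equal_is_parallel parallelE prefix_length_le prefix_order.refl)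

lemma cone_convex:
  assumes "x \<in> cone w" "z \<in> cone w" "x \<le> y" "y \<le> z"
  shows "y \<in> cone w"
proof (rule ccontr)
  assume "y \<notin> cone w"
  obtain s t where s: "x = w @- s" and t: "z = w @- t"
    using assms by (auto simp: cone_def)
  have ex: "\<exists>n<length w. y !! n \<noteq> w ! n"
  proof (rule ccontr)
    assume "\<not> ?thesis"
    then have "stake (length w) y = w" by (intro nth_equalityI) auto
    with \<open>y \<notin> cone w\<close> show False by (simp add: in_cone_iff)
  qed
  define n where "n = (LEAST n. n < length w \<and> y !! n \<noteq> w ! n)"
  have n: "n < length w \<and> y !! n \<noteq> w ! n"
    unfolding n_def by (rule LeastI_ex) (use ex in blast)
  have lt: "y !! i = w ! i" if "i < n" for i
    using that n not_less_Least[of i "\<lambda>n. n < length w \<and> y !! n \<noteq> w ! n"]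
    unfolding n_def by auto
  have "y < x \<or> z < y"
  proof (cases "y !! n < w ! n")
    case True
    then have "y < x"
      unfolding less_stream_def s using n lt by (intro exI[of _ n]) auto
    then show ?thesis ..
  next
    case False
    then have "w ! n < y !! n" using n by simp
    then have "z < y"
      unfolding less_stream_def t using n lt by (intro exI[of _ n]) auto
    then show ?thesis ..
  qed
  then show False using assms by auto
qed

text \<open>A single tail would not suffice, since a periodic one can absorb the difference. If
  \<open>w = v @ u\<close> with \<open>u\<close> nonempty, the constant tail of the letter opposite
  to the first letter of \<open>u\<close> separates the two words. Hence the target word in
  \<open>lin\<close> is unique.\<close>

lemma shift_eq_all_imp_eq:
  fixes v w :: "bool list"
  assumes "\<And>s. v @- s = w @- s"
  shows "v = w"
proof -
  have *: "v = w" if "length v \<le> length w" "\<And>s. v @- s = w @- s" for v w :: "bool list"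
  proof -
    have "prefix v w"
      using cone_nested_length[of "v @- sconst True" v w] that by (metis shift_in_cone)
    then obtain u where u: "w = v @ u" by (auto simp: prefix_def)
    have "u = []"
    proof (rule ccontr)
      assume "u \<noteq> []"
      then obtain b u' where u': "u = b # u'" by (cases u) auto
      have "v @- sconst (\<not> b) = v @- (u @- sconst (\<not> b))"
        using that(2)[of "sconst (\<not> b)"] by (simp add: u)
      then have "sconst (\<not> b) = b ## (u' @- sconst (\<not> b))" by (simp add: u')
      then have "shd (sconst (\<not> b)) = b" by (metis stream.sel(1))
      then show False by simp
    qed
    then show ?thesis by (simp add: u)
  qed
  show ?thesis
    using *[of v w] *[of w v] assms by (metis linear)
qed

lemma finite_cone_prefixes: "finite {v. prefix v w}"
  by (rule finite_subset[of _ "set (prefixes w)"]) auto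

lemma cone_shrink:
  assumes "\<And>n. \<exists>w. length w \<ge> n \<and> x \<in> cone w \<and> y \<in> cone w"
  shows "x = y"
proof (rule stream_eq_snthI)
  fix n
  obtain w where "length w \<ge> Suc n" "x \<in> cone w" "y \<in> cone w"
    using assms by blast
  then show "x !! n = y !! n"
    by (auto simp: cone_def shift_snth)
qed

section \<open>Dyadic homeomorphisms of the Cantor set\<close>

type_synonym selfmap = "bool stream \<Rightarrow> bool stream"

definition lin :: "selfmap \<Rightarrow> bool list \<Rightarrow> bool list \<Rightarrow> bool" where
  "lin f v w \<longleftrightarrow> (\<forall>s. f (v @- s) = w @- s)"

text \<open>These words are closed under prefixes (\<open>brk_prefix\<close>). For a dyadic map they
  are the inner nodes of the domain tree of its reduced tree pair, and \<open>leaf\<close> below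
  collects the leaves of that tree.\<close>

definition brk :: "selfmap \<Rightarrow> bool list set" where
  "brk f = {v. \<nexists>w. lin f v w}"

definition dyadic :: "selfmap \<Rightarrow> bool" where
  "dyadic f \<longleftrightarrow> strict_mono f \<and> surj f \<and> finite (brk f)"

lemma lin_append: "lin f v w \<Longrightarrow> lin f (v @ u) (w @ u)"
  by (simp add: lin_def)

lemma lin_unique: "lin f v w \<Longrightarrow> lin f v w' \<Longrightarrow> w = w'"
  by (rule shift_eq_all_imp_eq) (simp add: lin_def)

lemma lin_inj: "inj f \<Longrightarrow> lin f v w \<Longrightarrow> lin f v' w \<Longrightarrow> v = v'"
  by (rule shift_eq_all_imp_eq) (metis injD lin_def)

lemma lin_comp: "lin f v w \<Longrightarrow> lin g w u \<Longrightarrow> lin (g \<circ> f) v u"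
  by (simp add: lin_def)

lemma lin_id [simp]: "lin id v w \<longleftrightarrow> v = w"
  using shift_eq_all_imp_eq by (auto simp: lin_def)

lemma lin_inv: "bij f \<Longrightarrow> lin f v w \<Longrightarrow> lin (finv f) w v"
  by (metis bij_inv_eq_iff lin_def)

lemma lin_inv_iff: "bij f \<Longrightarrow> lin (finv f) w v \<longleftrightarrow> lin f v w"
  by (metis bij_imp_bij_inv inv_inv_eq lin_inv)

lemma lin_image_cone: "lin f v w \<Longrightarrow> f ` cone v = cone w"
  by (auto simp: lin_def cone_def image_image)

lemma lin_in_cone: "lin f v w \<Longrightarrow> x \<in> cone v \<Longrightarrow> f x \<in> cone w"
  by (auto simp: lin_def cone_def)

lemma lin_in_cone_iff: "inj f \<Longrightarrow> lin f v w \<Longrightarrow> f x \<in> cone w \<longleftrightarrow> x \<in> cone v"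
  by (metis inj_image_mem_iff lin_image_cone)

lemma lin_funpow:
  "lin f v (v @ u) \<Longrightarrow> lin (f ^^ n) (v @ w) (v @ concat (replicate n u) @ w)"
proof (induction n)
  case (Suc n)
  from lin_comp[OF Suc.IH[OF Suc.prems] lin_append[OF Suc.prems, of "concat (replicate n u) @ w"]]
  show ?case by (simp add: comp_def)
qed (simp add: lin_def)

lemma not_brkE: assumes "v \<notin> brk f" obtains w where "lin f v w"
  using assms by (auto simp: brk_def)

lemma not_brkI: "lin f v w \<Longrightarrow> v \<notin> brk f"
  by (auto simp: brk_def)

lemma not_brk_append: "v \<notin> brk f \<Longrightarrow> v @ u \<notin> brk f"
  by (meson lin_append not_brkE not_brkI)

lemma brk_prefix: "w \<in> brk f \<Longrightarrow> prefix v w \<Longrightarrow> v \<in> brk f"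
  by (metis not_brk_append prefix_def)

lemma brk_comp_subset:
  "brk (g \<circ> f) \<subseteq> brk f \<union> {v. \<exists>w\<in>brk g. lin f v w}"
  by (auto simp: brk_def) (metis lin_comp)

lemma card_lin_preimage:
  assumes "inj f" "finite B"
  shows "finite {v. \<exists>w\<in>B. lin f v w}" "card {v. \<exists>w\<in>B. lin f v w} \<le> card B"
proof -
  define F where "F = (\<lambda>v. THE w. lin f v w)"
  have F: "F v = w" if "lin f v w" for v w
    unfolding F_def using that lin_unique by blast
  have i: "inj_on F {v. \<exists>w\<in>B. lin f v w}"
    using F lin_inj[OF assms(1)] by (fastforce simp: inj_on_def)
  have s: "F ` {v. \<exists>w\<in>B. lin f v w} \<subseteq> B"
    using F by auto
  show "finite {v. \<exists>w\<in>B. lin f v w}" "card {v. \<exists>w\<in>B. lin f v w} \<le> card B"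
    using inj_on_finite[OF i s assms(2)] card_inj_on_le[OF i s assms(2)] by simp_all
qed

text \<open>A break of the composition is a break of \<open>f\<close>, or \<open>f\<close> carries
  it linearly to a break of \<open>g\<close>; by injectivity the latter kind is determined by its
  image. This subadditivity later bounds breaks by word length.\<close>

lemma card_brk_comp:
  assumes "inj f" "finite (brk f)" "finite (brk g)"
  shows "finite (brk (g \<circ> f))" "card (brk (g \<circ> f)) \<le> card (brk f) + card (brk g)"
proof -
  note p = card_lin_preimage[OF assms(1,3)]
  show "finite (brk (g \<circ> f))"
    using brk_comp_subset p(1) assms(2) by (metis (no_types, lifting) finite_UnI finite_subset)
  have "card (brk (g \<circ> f)) \<le> card (brk f \<union> {v. \<exists>w\<in>brk g. lin f v w})"
    using brk_comp_subset p(1) assms(2) by (intro card_mono) auto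
  also have "\<dots> \<le> card (brk f) + card {v. \<exists>w\<in>brk g. lin f v w}"
    by (rule card_Un_le)
  finally show "card (brk (g \<circ> f)) \<le> card (brk f) + card (brk g)"
    using p(2) by simp
qed

lemma dyadic_bij: "dyadic f \<Longrightarrow> bij f"
  by (simp add: dyadic_def bij_def strict_mono_imp_inj_on)

lemma dyadic_inj: "dyadic f \<Longrightarrow> inj f"
  by (simp add: dyadic_bij bij_is_inj)

lemma dyadic_finite: "dyadic f \<Longrightarrow> finite (brk f)"
  by (simp add: dyadic_def)

lemma dyadic_less_iff: "dyadic f \<Longrightarrow> f x < f y \<longleftrightarrow> x < y"
  by (simp add: dyadic_def strict_mono_less)

lemma dyadic_le_iff: "dyadic f \<Longrightarrow> f x \<le> f y \<longleftrightarrow> x \<le> y"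
  by (simp add: dyadic_def strict_mono_less_eq)

lemma brk_id [simp]: "brk id = {}"
  by (simp add: brk_def)

lemma dyadic_id: "dyadic id"
  by (simp add: dyadic_def strict_mono_def)

lemma dyadic_comp: "dyadic f \<Longrightarrow> dyadic g \<Longrightarrow> dyadic (g \<circ> f)"
  using card_brk_comp(1)[of f g] dyadic_inj[of f] comp_surj[of f g]
  by (simp add: dyadic_def strict_mono_def)

lemma dyadic_funpow: "dyadic f \<Longrightarrow> dyadic (f ^^ n)"
  by (induction n) (auto simp: dyadic_comp dyadic_id simp flip: id_def)

definition leaf :: "selfmap \<Rightarrow> bool list set" where
  "leaf f = {v. v \<notin> brk f \<and> (v = [] \<or> butlast v \<in> brk f)}"

lemma leaf_exists:
  assumes "finite (brk f)"
  shows "\<exists>v\<in>leaf f. x \<in> cone v"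
proof -
  have "infinite (range (\<lambda>n. stake n x))"
    using finite_imageD[of "\<lambda>n. stake n x" UNIV] by (metis infinite_UNIV_nat inj_def length_stake)
  then obtain n where "stake n x \<notin> brk f"
    using assms by (metis (no_types, lifting) finite_subset imageE subsetI)
  define m where "m = (LEAST n. stake n x \<notin> brk f)"
  have m: "stake m x \<notin> brk f"
    unfolding m_def using \<open>stake n x \<notin> brk f\<close> by (rule LeastI)
  have "stake m x = [] \<or> butlast (stake m x) \<in> brk f"
  proof (cases m)
    case (Suc k)
    then have "stake k x \<in> brk f"
      unfolding m_def using not_less_Least[of k "\<lambda>n. stake n x \<notin> brk f"] by simp
    then show ?thesis by (metis Suc butlast_snoc stake_Suc)
  qed simp
  then show ?thesis
    using m by (intro bexI[of _ "stake m x"]) (auto simp: leaf_def in_cone_iff)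
qed

lemma leaf_prefix_eq:
  assumes "v \<in> leaf f" "w \<in> leaf f" "prefix v w"
  shows "v = w"
proof (rule ccontr)
  assume "v \<noteq> w"
  then have "strict_prefix v w" using assms(3) by simp
  then have "w \<noteq> []" "prefix v (butlast w)"
    by (auto elim!: strict_prefixE' simp: butlast_append)
  then have "v \<in> brk f"
    using assms(2) brk_prefix by (auto simp: leaf_def)
  then show False using assms(1) by (simp add: leaf_def)
qed

lemma leaf_unique:
  assumes "v \<in> leaf f" "w \<in> leaf f" "x \<in> cone v" "x \<in> cone w"
  shows "v = w"
  using cone_nested[OF assms(3,4)] leaf_prefix_eq assms(1,2) by metis

lemma leaf_prefix_exists:
  assumes "finite (brk f)" "w \<notin> brk f"
  shows "\<exists>v\<in>leaf f. prefix v w"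
proof -
  obtain v where v: "v \<in> leaf f" "w @- sconst False \<in> cone v"
    using leaf_exists[OF assms(1)] by blast
  show ?thesis
  proof (cases "prefix v w")
    case False
    then have "strict_prefix w v"
      using cone_nested[OF v(2) shift_in_cone] by (auto simp: strict_prefix_def)
    then have "v \<noteq> []" "prefix w (butlast v)"
      by (auto elim!: strict_prefixE' simp: butlast_append)
    then have "w \<in> brk f"
      using v(1) brk_prefix by (auto simp: leaf_def)
    with assms(2) show ?thesis by simp
  qed (use v in blast)
qed

text \<open>A nonempty leaf is a child of a break. The exact number is
  \<open>card (brk f) + 1\<close>, but the factor two is harmless.\<close>

lemma card_leaf:
  assumes "finite (brk f)"
  shows "finite (leaf f)" "card (leaf f) \<le> 2 * card (brk f) + 1"
proof -
  let ?B = "insert [] ((\<lambda>(v, b). v @ [b]) ` (brk f \<times> UNIV))"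
  have sub: "leaf f \<subseteq> ?B"
  proof
    fix v assume "v \<in> leaf f"
    then show "v \<in> ?B"
      by (cases v rule: rev_cases) (auto simp: leaf_def image_iff)
  qed
  have fin: "finite ?B" using assms by simp
  show "finite (leaf f)" using sub fin by (rule finite_subset)
  have "card (leaf f) \<le> card ?B" using sub fin by (intro card_mono)
  also have "\<dots> \<le> Suc (card ((\<lambda>(v, b). v @ [b]) ` (brk f \<times> (UNIV :: bool set))))"
    by (rule card_insert_le_m1) auto
  also have "\<dots> \<le> Suc (card (brk f \<times> (UNIV :: bool set)))"
    using assms by (intro Suc_le_mono[THEN iffD2] card_image_le) simp
  also have "\<dots> = 2 * card (brk f) + 1"
    by (simp add: card_cartesian_product)
  finally show "card (leaf f) \<le> 2 * card (brk f) + 1" .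
qed

text \<open>The images of the leaves of \<open>f\<close> are words on which the inverse is linear.
  Their cones cover everything, so a break of the inverse must be a prefix of one of them.\<close>

lemma brk_finv_finite:
  assumes "bij f" "finite (brk f)"
  shows "finite (brk (finv f))"
proof -
  define F where "F = (\<lambda>v. THE w. lin f v w)"
  have F: "F v = w" if "lin f v w" for v w
    unfolding F_def using that lin_unique by blast
  have "brk (finv f) \<subseteq> (\<Union>v\<in>leaf f. {w. prefix w (F v)})"
  proof
    fix w assume w: "w \<in> brk (finv f)"
    obtain v where v: "v \<in> leaf f" "finv f (w @- sconst False) \<in> cone v"
      using leaf_exists[OF assms(2)] by blast
    obtain u where u: "lin f v u"
      using v(1) by (auto simp: leaf_def elim: not_brkE)
    have "w @- sconst False \<in> cone u"
      using lin_in_cone[OF u v(2)] assms(1) by (simp add: bij_is_surj surj_f_inv_f)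
    moreover have "u \<notin> brk (finv f)"
      using u assms(1) lin_inv not_brkI by blast
    ultimately have "prefix w u"
      using cone_nested[OF _ shift_in_cone, of w "sconst False" u] w brk_prefix by blast
    then show "w \<in> (\<Union>v\<in>leaf f. {w. prefix w (F v)})"
      using v(1) F[OF u] by auto
  qed
  moreover have "finite (\<Union>v\<in>leaf f. {w. prefix w (F v)})"
    using card_leaf(1)[OF assms(2)] finite_cone_prefixes by blast
  ultimately show ?thesis by (rule finite_subset)
qed

lemma dyadic_inv: "dyadic f \<Longrightarrow> dyadic (finv f)"
proof -
  assume f: "dyadic f"
  note b = dyadic_bij[OF f]
  have "finv f x < finv f y" if "x < y" for x y
    using that dyadic_less_iff[OF f, of "finv f x" "finv f y"] b
    by (simp add: bij_is_surj surj_f_inv_f)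
  then show ?thesis
    using brk_finv_finite[OF b dyadic_finite[OF f]] b
    by (simp add: dyadic_def strict_mono_def bij_is_surj bij_imp_bij_inv)
qed

section \<open>Integer iterates\<close>

definition zpow :: "('a \<Rightarrow> 'a) \<Rightarrow> int \<Rightarrow> 'a \<Rightarrow> 'a" where
  "zpow f i = (if 0 \<le> i then f ^^ nat i else finv f ^^ nat (- i))"

lemma zpow_0 [simp]: "zpow f 0 x = x"
  by (simp add: zpow_def)

lemma zpow_nat [simp]: "zpow f (int n) = f ^^ n"
  by (simp add: zpow_def)

lemma zpow_Suc: assumes "bij f" shows "zpow f (i + 1) x = f (zpow f i x)"
proof (cases "0 \<le> i")
  case True
  then show ?thesis by (simp add: zpow_def nat_add_distrib)
next
  case False
  show ?thesis
  proof (cases "i = -1")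
    case True
    then show ?thesis using assms by (simp add: zpow_def bij_is_surj surj_f_inv_f)
  next
    case neq: False
    then have "nat (- i) = Suc (nat (- (i + 1)))" using False by linarith
    then show ?thesis
      using False neq assms by (simp add: zpow_def bij_is_surj surj_f_inv_f)
  qed
qed

lemma zpow_1 [simp]: "zpow f 1 x = f x"
  by (simp add: zpow_def)

lemma zpow_pred: assumes "bij f" shows "f (zpow f (i - 1) x) = zpow f i x"
  using zpow_Suc[OF assms, of "i - 1" x] by simp

lemma zpow_add: assumes "bij f" shows "zpow f (i + j) x = zpow f i (zpow f j x)"
proof (induction i rule: int_induct[where k = 0])
  case (step1 i)
  have "zpow f (i + 1 + j) x = zpow f (i + j + 1) x" by (simp add: algebra_simps)
  then show ?case using step1 by (simp add: zpow_Suc[OF assms])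
next
  case (step2 i)
  have "f (zpow f (i - 1 + j) x) = zpow f (i + j) x"
    using zpow_pred[OF assms, of "i + j" x] by (simp add: algebra_simps)
  also have "\<dots> = f (zpow f (i - 1) (zpow f j x))"
    using step2 by (simp add: zpow_pred[OF assms])
  finally show ?case using assms by (simp add: bij_is_inj inj_eq)
qed simp

lemma zpow_Suc_right: assumes "bij f" shows "zpow f (i + 1) x = zpow f i (f x)"
  using zpow_add[OF assms, of i 1 x] by simp

lemma zpow_finv: assumes "bij f" shows "zpow (finv f) i = zpow f (- i)"
  using assms by (auto simp: zpow_def inv_inv_eq)

lemma dyadic_zpow: "dyadic f \<Longrightarrow> dyadic (zpow f i)"
  by (simp add: zpow_def dyadic_funpow dyadic_inv)

lemma zpow_intertwines: assumes "bij f" "bij g" "\<And>x. h (f x) = g (h x)"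
  shows "h (zpow f i x) = zpow g i (h x)"
proof (induction i rule: int_induct[where k = 0])
  case (step1 i)
  then show ?case by (simp add: zpow_Suc assms)
next
  case (step2 i)
  have "g (h (zpow f (i - 1) x)) = g (zpow g (i - 1) (h x))"
    using step2 by (simp add: zpow_pred assms flip: assms(3))
  then show ?case using assms(2) by (simp add: bij_is_inj inj_eq)
qed simp

lemma zpow_fix: assumes "bij f" "f x = x" shows "zpow f i x = x"
proof (induction i rule: int_induct[where k = 0])
  case (step2 i)
  have "f (zpow f (i - 1) x) = f x"
    using step2 assms zpow_pred[OF assms(1), of i x] by simp
  then show ?case using assms(1) by (simp add: bij_is_inj inj_eq)
qed (simp_all add: zpow_Suc assms)

lemma zpow_fix_iff: assumes "bij f" shows "f (zpow f i x) = zpow f i x \<longleftrightarrow> f x = x"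
proof
  assume "f (zpow f i x) = zpow f i x"
  then have "zpow f i (f x) = zpow f i x"
    using zpow_Suc[OF assms] zpow_Suc_right[OF assms] by metis
  then have "zpow f (- i) (zpow f i (f x)) = zpow f (- i) (zpow f i x)" by simp
  then show "f x = x" by (simp add: zpow_add[OF assms, symmetric])
qed (simp add: zpow_fix assms)

lemma zpow_less:
  assumes "dyadic f" "x < f x" "i < j"
  shows "zpow f i x < zpow f j x"
  using assms(3)
proof (induction j rule: int_gr_induct)
  case base
  show ?case
    using dyadic_less_iff[OF dyadic_zpow[OF assms(1)], of i x "f x"] assms(2)
    by (simp add: zpow_Suc_right[OF dyadic_bij[OF assms(1)]])
next
  case (step j)
  have "zpow f j x < zpow f (j + 1) x"
    using dyadic_less_iff[OF dyadic_zpow[OF assms(1)], of j x "f x"] assms(2)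
    by (simp add: zpow_Suc_right[OF dyadic_bij[OF assms(1)]])
  then show ?case using step by simp
qed

lemma zpow_greater:
  assumes "dyadic f" "f x < x" "i < j"
  shows "zpow f j x < zpow f i x"
  using assms(3)
proof (induction j rule: int_gr_induct)
  case base
  show ?case
    using dyadic_less_iff[OF dyadic_zpow[OF assms(1)], of i "f x" x] assms(2)
    by (simp add: zpow_Suc_right[OF dyadic_bij[OF assms(1)]])
next
  case (step j)
  have "zpow f (j + 1) x < zpow f j x"
    using dyadic_less_iff[OF dyadic_zpow[OF assms(1)], of j "f x" x] assms(2)
    by (simp add: zpow_Suc_right[OF dyadic_bij[OF assms(1)]])
  then show ?case using step by simp
qed

text \<open>Orbits of an increasing map are monotone and cones are convex, so the times spent in a
  cone are consecutive.\<close>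

lemma zpow_orbit_convex:
  assumes "dyadic f" "zpow f i x \<in> cone v" "zpow f j x \<in> cone v" "i \<le> k" "k \<le> j"
  shows "zpow f k x \<in> cone v"
proof (cases "i = k \<or> k = j \<or> f x = x")
  case True
  then show ?thesis using assms zpow_fix[OF dyadic_bij[OF assms(1)]] by auto
next
  case False
  then have ik: "i < k" "k < j" "x < f x \<or> f x < x" using assms by auto
  then show ?thesis
    using cone_convex[OF assms(2,3), of "zpow f k x"] cone_convex[OF assms(3,2), of "zpow f k x"]
      zpow_less[OF assms(1)] zpow_greater[OF assms(1)] by (metis less_imp_le)
qed

lemma zpow_less_fix:
  assumes "dyadic f" "f p = p"
  shows "zpow f i x < p \<longleftrightarrow> x < p" "p < zpow f i x \<longleftrightarrow> p < x"
  using dyadic_less_iff[OF dyadic_zpow[OF assms(1)], of i] zpow_fix[OF dyadic_bij[OF assms(1)] assms(2), of i]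
  by metis+

lemma finv_fix_iff: "bij f \<Longrightarrow> finv f x = x \<longleftrightarrow> f x = x"
  by (metis bij_inv_eq_iff)

section \<open>Attracting leaves\<close>

text \<open>The cone is mapped onto a proper subcone, and its iterates shrink to the fixed point
  \<open>v u u u ...\<close>. Repelling points are described by \<open>attr (finv f)\<close>, hence
  by cones whose words are leaves of the inverse.\<close>

definition attr :: "selfmap \<Rightarrow> bool list \<Rightarrow> bool" where
  "attr f v \<longleftrightarrow> v \<in> leaf f \<and> (\<exists>u. u \<noteq> [] \<and> lin f v (v @ u))"

lemma leaf_lin: assumes "v \<in> leaf f" obtains w where "lin f v w"
  using assms by (auto simp: leaf_def elim: not_brkE)

text \<open>If the inverse were linear on the parent of the image \<open>w\<close>, its value there
  would be the parent of \<open>v\<close>, and \<open>f\<close> would be linear on a break.\<close>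

lemma leaf_finv:
  assumes "bij f" "v \<in> leaf f" "lin f v w"
  shows "w \<in> leaf (finv f)"
proof -
  have "butlast w \<in> brk (finv f)" if "w \<noteq> []"
  proof (rule ccontr)
    assume "butlast w \<notin> brk (finv f)"
    then obtain z where z: "lin (finv f) (butlast w) z" by (rule not_brkE)
    have "lin (finv f) w (z @ [last w])"
      using lin_append[OF z, of "[last w]"] that by simp
    then have v: "v = z @ [last w]"
      using lin_unique lin_inv[OF assms(1,3)] by blast
    then have "z \<in> brk f" using assms(2) by (simp add: leaf_def)
    moreover have "lin f z (butlast w)"
      using z assms(1) by (simp add: lin_inv_iff)
    ultimately show False by (simp add: not_brkI)
  qed
  then show ?thesis
    using not_brkI[OF lin_inv[OF assms(1,3)]] by (auto simp: leaf_def)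
qed

lemma attr_leaf: "attr f v \<Longrightarrow> v \<in> leaf f"
  by (simp add: attr_def)

lemma attr_step: "attr f v \<Longrightarrow> x \<in> cone v \<Longrightarrow> f x \<in> cone v"
  unfolding attr_def by (meson cone_append_subset lin_in_cone subsetD)

lemma attr_zpow:
  assumes "dyadic f" "attr f v" "zpow f i x \<in> cone v" "i \<le> j"
  shows "zpow f j x \<in> cone v"
  using assms(4)
proof (induction j rule: int_ge_induct)
  case (step j)
  then show ?case using attr_step[OF assms(2)] by (simp add: zpow_Suc[OF dyadic_bij[OF assms(1)]])
qed (use assms in simp)

text \<open>The \<open>n\<close>-th image of \<open>cone v\<close> belongs to \<open>v\<close>
  followed by \<open>n\<close> copies of \<open>u\<close>, so two points lying in all these images
  agree to every depth.\<close>

lemma attr_shrink: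
  assumes "attr f v"
    and "\<And>n. \<exists>x'\<in>cone v. (f ^^ n) x' = x" and "\<And>n. \<exists>y'\<in>cone v. (f ^^ n) y' = y"
  shows "x = y"
proof (rule cone_shrink)
  fix n
  obtain u where u: "u \<noteq> []" "lin f v (v @ u)" using assms(1) by (auto simp: attr_def)
  have l: "lin (f ^^ n) v (v @ concat (replicate n u))"
    using lin_funpow[OF u(2), of n "[]"] by simp
  have "length (concat (replicate n u)) = n * length u" by (simp add: length_concat sum_list_replicate)
  moreover have "n \<le> n * length u" using u(1) by (cases u) auto
  ultimately have "n \<le> length (v @ concat (replicate n u))" unfolding length_append by linarith
  then show "\<exists>w. n \<le> length w \<and> x \<in> cone w \<and> y \<in> cone w"
    using lin_in_cone[OF l] assms(2)[of n] assms(3)[of n] by blast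
qed

text \<open>If the whole past of the orbit lies in the contracting cone, then its
  \<open>k\<close>-th point lies in all forward images of the cone and equals the fixed point. So a
  nontrivial orbit must have entered the cone from outside.\<close>

lemma attr_shrink_zpow:
  assumes "dyadic f" "attr f v" "p \<in> cone v" "f p = p" "\<And>i. i \<le> k \<Longrightarrow> zpow f i x \<in> cone v"
  shows "f x = x"
proof -
  note b = dyadic_bij[OF assms(1)]
  have "zpow f k x = p"
  proof (rule attr_shrink[OF assms(2)])
    fix n
    have "(f ^^ n) (zpow f (k - int n) x) = zpow f k x"
      using zpow_add[OF b, of "int n" "k - int n" x] by simp
    then show "\<exists>x'\<in>cone v. (f ^^ n) x' = zpow f k x"
      using assms(5)[of "k - int n"] by auto
    show "\<exists>y'\<in>cone v. (f ^^ n) y' = p"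
      using zpow_fix[OF b assms(4), of "int n"] assms(3) by auto
  qed
  then show ?thesis
    using zpow_fix_iff[OF b, of k x] assms(4) by simp
qed

lemma attr_fix_unique:
  assumes "attr f v" "p \<in> cone v" "f p = p" "q \<in> cone v" "f q = q"
  shows "p = q"
proof (rule attr_shrink[OF assms(1)])
  have "(f ^^ n) p = p" "(f ^^ n) q = q" for n
    using assms(3,5) by (induction n) auto
  then show "\<exists>x'\<in>cone v. (f ^^ n) x' = p" "\<exists>x'\<in>cone v. (f ^^ n) x' = q" for n
    using assms(2,4) by auto
qed

lemma attr_fix_exists:
  assumes "attr f v" shows "\<exists>p\<in>cone v. f p = p"
proof -
  obtain u where u: "u \<noteq> []" "lin f v (v @ u)" using assms by (auto simp: attr_def)
  have "f (v @- cycle u) = v @- cycle u"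
    using u(2) cycle_decomp[OF u(1)] by (simp add: lin_def)
  then show ?thesis by (metis shift_in_cone)
qed

text \<open>The cone of a repelling point is a leaf of the inverse; the corresponding leaf of
  \<open>f\<close> is its preimage \<open>w0\<close>, a smaller cone. An orbit therefore leaves
  \<open>w0\<close> one step before it leaves \<open>w\<close>.\<close>

lemma attr_finv_leaf:
  assumes "bij f" "attr (finv f) w"
  obtains w0 where "w0 \<in> leaf f" "\<And>x. x \<in> cone w0 \<longleftrightarrow> f x \<in> cone w" "strict_prefix w w0"
proof -
  obtain u where u: "u \<noteq> []" "lin (finv f) w (w @ u)" using assms(2) by (auto simp: attr_def)
  have "w @ u \<in> leaf (finv (finv f))"
    using leaf_finv[OF bij_imp_bij_inv[OF assms(1)] attr_leaf[OF assms(2)] u(2)] .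
  moreover have l: "lin f (w @ u) w" using u(2) assms(1) by (simp add: lin_inv_iff)
  ultimately show thesis
    using that[of "w @ u"] u(1) assms(1) lin_in_cone_iff[OF bij_is_inj[OF assms(1)] l]
    by (simp add: inv_inv_eq strict_prefix_def)
qed

text \<open>The leaf and its image share the point \<open>f x\<close>, so they are nested, and
  equality would make \<open>f\<close> the identity there. Thus a leaf occupied twice in succession
  by an orbit is contracting or expanding; the counting of transit times and of breaks rests on
  this.\<close>

lemma leaf_cases:
  assumes f: "dyadic f" and v: "v \<in> leaf f" "x \<in> cone v" "f x \<in> cone v" and nf: "f x \<noteq> x"
  obtains "attr f v" | w where "attr (finv f) w" "\<And>x. x \<in> cone v \<longleftrightarrow> f x \<in> cone w" "cone v \<subseteq> cone w"
proof -
  note b = dyadic_bij[OF f]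
  obtain w where w: "lin f v w" using leaf_lin v(1) by blast
  have nw: "v \<noteq> w" using nf w v(2) by (auto simp: lin_def cone_def)
  have "f x \<in> cone w" using lin_in_cone[OF w v(2)] .
  then consider "prefix v w" | "prefix w v" using cone_nested v(3) by blast
  then show thesis
  proof cases
    case 1
    then have "attr f v" using v(1) w nw by (auto simp: attr_def prefix_def)
    then show thesis by (rule that(1))
  next
    case 2
    then obtain u where u: "v = w @ u" "u \<noteq> []" using nw by (auto simp: prefix_def)
    have "attr (finv f) w"
      using leaf_finv[OF b v(1) w] lin_inv[OF b w] u by (auto simp: attr_def)
    then show thesis
      using that(2)[of w] lin_in_cone_iff[OF bij_is_inj[OF b] w] cone_mono[OF 2] by blast
  qed
qed

text \<open>There are finitely many leaves, so one of them contains the orbit from some time on, and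
  it must be contracting. A fixed point between \<open>x\<close> and \<open>p\<close> would stay
  between the orbit and \<open>p\<close>, and so be a second fixed point in the same cone.\<close>

lemma forward_limit:
  assumes f: "dyadic f" and nf: "f x \<noteq> x"
  shows "\<exists>v p i. attr f v \<and> p \<in> cone v \<and> f p = p \<and> zpow f i x \<in> cone v \<and>
    (x < f x \<longrightarrow> x < p) \<and> (f x < x \<longrightarrow> p < x) \<and>
    (\<forall>z. f z = z \<longrightarrow> \<not> (x < z \<and> z < p) \<and> \<not> (p < z \<and> z < x))"
proof -
  note b = dyadic_bij[OF f]
  define F where "F n = (SOME v. v \<in> leaf f \<and> zpow f (int n) x \<in> cone v)" for n
  have F: "F n \<in> leaf f \<and> zpow f (int n) x \<in> cone (F n)" for n
    unfolding F_def by (rule someI_ex) (use leaf_exists[OF dyadic_finite[OF f]] in blast)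
  have "finite (range F)"
    using F card_leaf(1)[OF dyadic_finite[OF f]] by (metis finite_subset image_subset_iff)
  then obtain n0 where n0: "infinite {n. F n = F n0}"
    using pigeonhole_infinite[of UNIV F] by auto
  define v where "v = F n0"
  have v: "v \<in> leaf f" using F by (simp add: v_def)
  have orb: "zpow f k x \<in> cone v" if "int n0 \<le> k" for k
  proof -
    obtain m where m: "F m = F n0" "nat k < m"
      using n0 by (metis (mono_tags, lifting) infinite_nat_iff_unbounded mem_Collect_eq)
    show ?thesis
      by (rule zpow_orbit_convex[OF f, of "int n0" x v "int m"])
         (use F[of n0] F[of m] m that in \<open>auto simp: v_def simp del: zpow_nat\<close>)
  qed
  define y where "y = zpow f (int n0) x"
  have y: "y \<in> cone v" "f y \<in> cone v"
    using orb[of "int n0"] orb[of "int n0 + 1"] by (simp_all add: y_def zpow_Suc[OF b] del: zpow_nat)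
  have nfy: "f y \<noteq> y" using nf zpow_fix_iff[OF b] unfolding y_def by blast
  have at: "attr f v"
    using f v y nfy
  proof (cases rule: leaf_cases)
    \<comment> \<open>For the inverse, the future of the orbit is a past that lies in a contracting
      cone, which only a fixed point can have.\<close>
    case (2 w)
    obtain q where q: "q \<in> cone w" "finv f q = q" using attr_fix_exists[OF 2(1)] by blast
    have "finv f x = x"
    proof (rule attr_shrink_zpow[OF dyadic_inv[OF f] 2(1) q])
      show "zpow (finv f) i x \<in> cone w" if "i \<le> - int n0" for i
        using orb[of "- i"] that 2(3) by (auto simp: zpow_finv[OF b])
    qed
    then show ?thesis using nf by (simp add: finv_fix_iff[OF b])
  qed
  obtain p where p: "p \<in> cone v" "f p = p" using attr_fix_exists[OF at] by blast
  have px: "p \<noteq> x" using p nf by auto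
  obtain m where m: "m \<le> int n0" "zpow f m x \<notin> cone v"
    using attr_shrink_zpow[OF f at p, of "int n0" x] nf by blast
  then have m': "m < int n0" using orb[of "int n0"] by (cases "m = int n0") (auto simp del: zpow_nat)
  have o1: "x < p" if "x < f x"
  proof (rule ccontr)
    assume "\<not> x < p"
    then have "p < x" using px by simp
    then have "p < zpow f m x" by (simp add: zpow_less_fix[OF f p(2)])
    then show False
      using zpow_less[OF f that m'] cone_convex[OF p(1) y(1)] m(2) unfolding y_def by (meson less_imp_le)
  qed
  have o2: "p < x" if "f x < x"
  proof (rule ccontr)
    assume "\<not> p < x"
    then have "x < p" using px by simp
    then have "zpow f m x < p" by (simp add: zpow_less_fix[OF f p(2)])
    then show False
      using zpow_greater[OF f that m'] cone_convex[OF y(1) p(1)] m(2) unfolding y_def by (meson less_imp_le)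
  qed
  have nofix: "\<not> (x < z \<and> z < p)" "\<not> (p < z \<and> z < x)" if z: "f z = z" for z
  proof -
    show "\<not> (x < z \<and> z < p)"
    proof
      assume a: "x < z \<and> z < p"
      then have "y < z" unfolding y_def by (simp add: zpow_less_fix[OF f z] del: zpow_nat)
      then have "z \<in> cone v" using cone_convex[OF y(1) p(1)] a by (meson less_imp_le)
      then show False using attr_fix_unique[OF at p _ z] a by blast
    qed
    show "\<not> (p < z \<and> z < x)"
    proof
      assume a: "p < z \<and> z < x"
      then have "z < y" unfolding y_def by (simp add: zpow_less_fix[OF f z] del: zpow_nat)
      then have "z \<in> cone v" using cone_convex[OF p(1) y(1)] a by (meson less_imp_le)
      then show False using attr_fix_unique[OF at p _ z] a by blast
    qed
  qed
  show ?thesis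
    using at p y(1) o1 o2 nofix unfolding y_def by blast
qed

section \<open>Transit times\<close>

definition between :: "selfmap \<Rightarrow> bool stream \<Rightarrow> bool stream \<Rightarrow> bool list set" where
  "between f p q = {u \<in> leaf f. \<forall>y\<in>cone u. min p q < y \<and> y < max p q}"

lemma between_sym: "between f p q = between f q p"
  by (simp add: between_def min.commute max.commute)

lemma between_finite: "dyadic f \<Longrightarrow> finite (between f p q)"
  unfolding between_def using card_leaf(1)[OF dyadic_finite] by simp

lemma int_threshold:
  fixes P :: "int \<Rightarrow> bool"
  assumes i: "P i" and m: "\<not> P m" and up: "\<forall>i j. P i \<longrightarrow> i \<le> j \<longrightarrow> P j"
  shows "\<exists>a. \<forall>i. P i \<longleftrightarrow> a \<le> i"
proof -
  define n where "n = (LEAST n. P (m + int n))"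
  have above: "m < j" if "P j" for j using up that m by (meson not_le)
  have "P (m + int (nat (i - m)))" using i above[OF i] by simp
  then have n: "P (m + int n)" unfolding n_def by (rule LeastI)
  have "m + int n \<le> j" if "P j" for j
  proof -
    have "P (m + int (nat (j - m)))" using that above[OF that] by simp
    then have "n \<le> nat (j - m)" unfolding n_def by (rule Least_le)
    then show ?thesis using above[OF that] by linarith
  qed
  then show ?thesis using up n by blast
qed

text \<open>Between the last visit to \<open>w\<close> and the first visit to \<open>v\<close> the
  orbit meets pairwise distinct leaves, because a leaf met twice is contracting or expanding, hence
  \<open>v\<close> or \<open>w0\<close>. These leaves contain neither \<open>p\<close> nor
  \<open>q\<close>, so convexity puts them strictly between the two.\<close>

lemma transit_count:
  assumes f: "dyadic f"
    and v: "attr f v" "p \<in> cone v" "f p = p"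
    and w: "attr (finv f) w" "q \<in> cone w" "f q = q"
    and nf: "f x \<noteq> x" and xv: "zpow f iv x \<in> cone v" and xw: "zpow f iw x \<in> cone w" and pq: "p \<noteq> q"
  shows "\<exists>a b :: int. (\<forall>i. zpow f i x \<in> cone v \<longleftrightarrow> a \<le> i) \<and> (\<forall>i. zpow f i x \<in> cone w \<longleftrightarrow> i \<le> b) \<and>
    b \<le> a \<and> a - b \<le> int (card (between f p q))"
proof -
  note b = dyadic_bij[OF f]
  have up: "zpow f j x \<in> cone v" if "zpow f i x \<in> cone v" "i \<le> j" for i j
    using attr_zpow[OF f v(1) that] .
  have down: "zpow f j x \<in> cone w" if "zpow f i x \<in> cone w" "j \<le> i" for i j
    using attr_zpow[OF dyadic_inv[OF f] w(1), of "- i" x "- j"] that by (simp add: zpow_finv[OF b])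
  obtain m where m: "m \<le> iv" "zpow f m x \<notin> cone v"
    using attr_shrink_zpow[OF f v, of iv x] nf by blast
  obtain k where k: "iw \<le> k" "zpow f k x \<notin> cone w"
  proof -
    have q: "finv f q = q" using w(3) by (simp add: finv_fix_iff[OF b])
    obtain l where "l \<le> - iw" "zpow (finv f) l x \<notin> cone w"
      using attr_shrink_zpow[OF dyadic_inv[OF f] w(1,2) q, of "- iw" x] nf
      by (auto simp: finv_fix_iff[OF b])
    then show thesis using that[of "- l"] by (auto simp: zpow_finv[OF b])
  qed
  obtain a where a: "\<And>i. zpow f i x \<in> cone v \<longleftrightarrow> a \<le> i"
    using int_threshold[of "\<lambda>i. zpow f i x \<in> cone v" iv m] xv m(2) up by blast
  obtain c' where "\<And>i. zpow f i x \<notin> cone w \<longleftrightarrow> c' \<le> i"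
    using int_threshold[of "\<lambda>i. zpow f i x \<notin> cone w" k iw] k(2) xw down by blast
  then have c: "zpow f i x \<in> cone w \<longleftrightarrow> i \<le> c' - 1" for i
    by (metis linorder_not_le zle_diff1_eq)
  define c where "c = c' - 1"
  note c = c[folded c_def]
  obtain w0 where w0: "w0 \<in> leaf f" "\<And>x. x \<in> cone w0 \<longleftrightarrow> f x \<in> cone w" "strict_prefix w w0"
    using attr_finv_leaf[OF b w(1)] by blast
  \<comment> \<open>At the last time \<open>c\<close> in \<open>w\<close> the orbit has already left
    the leaf \<open>w0\<close>, so the time \<open>c\<close> itself belongs to the transit.\<close>
  have c0: "zpow f i x \<in> cone w0 \<longleftrightarrow> i < c" for i
    using c[of "i + 1"] by (auto simp: w0(2) zpow_Suc[OF b])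
  have qw0: "q \<in> cone w0" using w0(2) w(2,3) by simp
  have w0w: "cone w0 \<subseteq> cone w" using w0(3) by (intro cone_mono) simp
  have pw: "p \<notin> cone w"
    using attr_fix_unique[OF w(1), of p q] w v(3) pq by (auto simp: finv_fix_iff[OF b])
  have qv: "q \<notin> cone v"
    using attr_fix_unique[OF v, of q] w(3) pq by auto
  have vw0: "v \<noteq> w0" using qw0 qv by blast
  have "c \<le> a"
  proof (rule ccontr)
    assume "\<not> c \<le> a"
    then have "zpow f a x \<in> cone v" "zpow f a x \<in> cone w0" using a c0 by auto
    then show False using leaf_unique[OF attr_leaf[OF v(1)] w0(1)] vw0 by blast
  qed
  moreover have "a - c \<le> int (card (between f p q))"
  proof -
    define L where "L i = (SOME u. u \<in> leaf f \<and> zpow f i x \<in> cone u)" for i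
    have L: "L i \<in> leaf f \<and> zpow f i x \<in> cone (L i)" for i
      unfolding L_def by (rule someI_ex) (use leaf_exists[OF dyadic_finite[OF f]] in blast)
    have betw: "L i \<in> between f p q" if i: "c \<le> i" "i < a" for i
    proof -
      have nv: "L i \<noteq> v" using a[of i] L[of i] i by auto
      have nw: "L i \<noteq> w0" using c0[of i] L[of i] i by auto
      have pL: "p \<notin> cone (L i)" using leaf_unique[OF attr_leaf[OF v(1)], of "L i" p] L nv v(2) by blast
      have qL: "q \<notin> cone (L i)" using leaf_unique[OF w0(1), of "L i" q] L nw qw0 by blast
      have xp: "zpow f j x < p \<longleftrightarrow> x < p" "p < zpow f j x \<longleftrightarrow> p < x"
        "zpow f j x < q \<longleftrightarrow> x < q" "q < zpow f j x \<longleftrightarrow> q < x" for j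
        using zpow_less_fix[OF f v(3)] zpow_less_fix[OF f w(3)] by auto
      \<comment> \<open>Otherwise one of the two fixed points would lie between the orbit and the
        other one, and by convexity in the cone of the other one.\<close>
      have inner: "min p q < x \<and> x < max p q"
      proof (rule ccontr)
        assume n: "\<not> ?thesis"
        have ne: "x \<noteq> p" "x \<noteq> q" using v(3) w(3) nf by auto
        have cw: "zpow f c x \<in> cone w" and cv: "zpow f a x \<in> cone v" using c a by auto
        consider "x < p" "p < q" | "x < q" "q < p" | "p < x" "q < p" | "q < x" "p < q"
          using n ne pq by (metis less_imp_le linorder_neqE max.absorb1 max.absorb2 min.absorb1 min.absorb2)
        then show False
        proof cases
          case 1 then show False
            using cone_convex[OF cw w(2), of p] xp pw by (meson less_imp_le)
        next
          case 2 then show False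
            using cone_convex[OF cv v(2), of q] xp qv by (meson less_imp_le)
        next
          case 3 then show False
            using cone_convex[OF w(2) cw, of p] xp pw by (meson less_imp_le)
        next
          case 4 then show False
            using cone_convex[OF v(2) cv, of q] xp qv by (meson less_imp_le)
        qed
      qed
      have mm: "min p q \<notin> cone (L i)" "max p q \<notin> cone (L i)"
        using pL qL by (auto simp: min_def max_def)
      have inner': "min p q < zpow f i x" "zpow f i x < max p q"
        using inner xp[of i] by (auto simp: min_def max_def split: if_splits)
      have "min p q < y \<and> y < max p q" if y: "y \<in> cone (L i)" for y
      proof (rule ccontr)
        assume "\<not> ?thesis"
        then have "y \<le> min p q \<or> max p q \<le> y" by (auto simp: not_less)
        then show False
          using cone_convex[OF y _ , of "zpow f i x" "min p q"] cone_convex[OF _ y, of "zpow f i x" "max p q"]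
            L[of i] inner' mm by (meson less_imp_le)
      qed
      then show ?thesis using L by (simp add: between_def)
    qed
    have inj: "inj_on L {c..<a}"
    proof -
      have "False" if ij: "c \<le> i" "i < j" "j < a" "L i = L j" for i j
      proof -
        let ?y = "zpow f i x"
        have u: "L i \<in> leaf f" "?y \<in> cone (L i)" using L by auto
        have "zpow f (i + 1) x \<in> cone (L i)"
          using zpow_orbit_convex[OF f, of i x "L i" j "i + 1"] L[of i] L[of j] ij by auto
        then have fy: "f ?y \<in> cone (L i)" by (simp add: zpow_Suc[OF b])
        have nfy: "f ?y \<noteq> ?y" using nf by (simp add: zpow_fix_iff[OF b])
        show False
          using f u fy nfy
        proof (cases rule: leaf_cases)
          case 1
          have "zpow f a x \<in> cone (L i)" using attr_zpow[OF f 1 u(2), of a] ij by auto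
          then have "L i = v" using leaf_unique[OF u(1) attr_leaf[OF v(1)]] a by auto
          then show False using u(2) a ij by auto
        next
          case (2 w')
          have "zpow f i x \<in> cone w'" using 2(3) u(2) by blast
          then have "zpow f c x \<in> cone w'"
            using attr_zpow[OF dyadic_inv[OF f] 2(1), of "- i" x "- c"] ij by (simp add: zpow_finv[OF b])
          then have "zpow f (c - 1) x \<in> cone (L i)" using 2(2) by (simp add: zpow_pred[OF b])
          then have "L i = w0" using leaf_unique[OF u(1) w0(1)] c0[of "c - 1"] by auto
          then show False using u(2) c0 ij by auto
        qed
      qed
      then show ?thesis by (auto simp: inj_on_def) (metis linorder_neqE)
    qed
    have "card {c..<a} \<le> card (between f p q)"
      using betw inj between_finite[OF f] by (intro card_inj_on_le[of L]) auto
    then show ?thesis by simp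
  qed
  ultimately show ?thesis using a c by blast
qed

section \<open>Offsets of a conjugator\<close>

lemma cone_subset_imp_prefix: assumes "cone w \<subseteq> cone v" shows "prefix v w"
proof (rule ccontr)
  assume n: "\<not> prefix v w"
  have "w @- sconst True \<in> cone v" using assms by auto
  then have "strict_prefix w v" using n cone_nested[OF _ shift_in_cone] by (auto simp: strict_prefix_def)
  then obtain b u where v: "v = w @ b # u" by (auto elim!: strict_prefixE')
  have "w @- sconst (\<not> b) \<in> cone v" using assms by auto
  then have "sconst (\<not> b) \<in> cone (b # u)" by (simp add: v)
  then obtain s where "sconst (\<not> b) = (b # u) @- s" by (rule in_coneE)
  then have "shd (sconst (\<not> b)) = b" by (metis shift.simps(2) stream.sel(1))
  then show False by simp
qed

definition intertwines :: "selfmap \<Rightarrow> selfmap \<Rightarrow> selfmap \<Rightarrow> bool" where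
  "intertwines f g h \<longleftrightarrow> dyadic f \<and> dyadic g \<and> dyadic h \<and> (\<forall>x. h (f x) = g (h x))"

lemma intertwines_finv: assumes "intertwines f g h" shows "intertwines (finv f) (finv g) h"
proof -
  have b: "bij f" "bij g" using assms by (auto simp: intertwines_def dyadic_bij)
  have "h (finv f x) = finv g (h x)" for x
  proof -
    have "g (h (finv f x)) = h x"
      using assms b by (metis bij_inv_eq_iff intertwines_def)
    then show ?thesis using b by (metis bij_inv_eq_iff)
  qed
  then show ?thesis using assms by (simp add: intertwines_def dyadic_inv)
qed

text \<open>In terms of sets, \<open>g\<close> to the power \<open>1 - d\<close> maps \<open>cone v'\<close> into \<open>h ` cone v\<close>, which is mapped into
  \<open>cone v'\<close> by \<open>g\<close> to the power \<open>d\<close>.  As these images of \<open>cone v'\<close> are nested, some \<open>d\<close> exists.\<close>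

definition off :: "selfmap \<Rightarrow> selfmap \<Rightarrow>
    bool list \<Rightarrow> bool list \<Rightarrow> int \<Rightarrow> bool" where
  "off g h v v' d \<longleftrightarrow> (\<forall>x. (x \<in> cone v \<longrightarrow> zpow g d (h x) \<in> cone v') \<and>
                        (zpow g (d - 1) (h x) \<in> cone v' \<longrightarrow> x \<in> cone v))"

definition attr_fix :: "selfmap \<Rightarrow> bool stream \<Rightarrow> bool" where
  "attr_fix f p \<longleftrightarrow> f p = p \<and> (\<exists>v. attr f v \<and> p \<in> cone v)"

definition offset :: "selfmap \<Rightarrow> selfmap \<Rightarrow> selfmap \<Rightarrow> bool stream \<Rightarrow> int \<Rightarrow> bool" where
  "offset f g h p d \<longleftrightarrow> (\<exists>v v'. attr f v \<and> attr g v' \<and> p \<in> cone v \<and> h p \<in> cone v' \<and> off g h v v' d)"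

lemma zpow_nat_image_lin:
  assumes "lin f v (v @ u)"
  shows "(f ^^ n) ` cone v = cone (v @ concat (replicate n u))"
  using lin_image_cone[OF lin_funpow[OF assms, of n "[]"]] by simp

text \<open>Deep in \<open>cone v\<close>, at \<open>v\<close> followed by \<open>J\<close> copies
  of \<open>u\<close>, the map \<open>h\<close> is linear with some image \<open>w\<close>.
  Conjugation makes \<open>g\<close> contract \<open>w\<close> to \<open>w @ u\<close>, so the leaf
  \<open>v'\<close> of \<open>g\<close> above \<open>w\<close> is attracting. The cones of
  \<open>?w n\<close> shrink to \<open>h p\<close>, and \<open>cone w\<close> is caught between
  those with index \<open>m\<close> and \<open>Suc m\<close>; then \<open>J - m\<close> is an
  offset.\<close>

lemma offset_exists:
  assumes c: "intertwines f g h" and p: "attr_fix f p"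
  shows "\<exists>d. offset f g h p d"
proof -
  have f: "dyadic f" and g: "dyadic g" and h: "dyadic h" and hfg: "\<And>x. h (f x) = g (h x)"
    using c by (auto simp: intertwines_def)
  note bf = dyadic_bij[OF f] and bg = dyadic_bij[OF g] and bh = dyadic_bij[OF h]
  obtain v where v: "attr f v" "p \<in> cone v" and fp: "f p = p" using p by (auto simp: attr_fix_def)
  obtain u where u: "u \<noteq> []" "lin f v (v @ u)" using v(1) by (auto simp: attr_def)
  let ?v = "\<lambda>n. v @ concat (replicate n u)"
  have hg: "g (h p) = h p" using hfg[of p] fp by simp
  have len: "length (?v n) = length v + n * length u" for n
    by (simp add: length_concat sum_list_replicate)
  have pv: "p \<in> cone (?v n)" for n
  proof -
    have "(f ^^ n) p = p" using fp by (induction n) auto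
    then show ?thesis using zpow_nat_image_lin[OF u(2), of n] v(2) by (metis imageI)
  qed
  have "inj ?v"
    using len u(1) by (intro injI) (metis add_left_imp_eq length_0_conv mult_cancel2)
  then have "infinite (range ?v)" using finite_imageD[of ?v UNIV] by auto
  then obtain J where J: "?v J \<notin> brk h"
    using dyadic_finite[OF h] by (metis (no_types, lifting) finite_subset imageE subsetI)
  then obtain w where w: "lin h (?v J) w" by (rule not_brkE)
  have vu: "?v J @ u = ?v (Suc J)" for J
    by (induction J) auto
  have "lin f (?v J) (?v J @ u)"
    unfolding vu using lin_append[OF u(2), of "concat (replicate J u)"] by simp
  then have gw: "lin g w (w @ u)"
    using lin_append[OF w, of u] w hfg unfolding lin_def by metis
  have hpw: "h p \<in> cone w" using lin_in_cone[OF w pv] .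
  obtain v' where v': "v' \<in> leaf g" "prefix v' w"
    using leaf_prefix_exists[OF dyadic_finite[OF g] not_brkI[OF gw]] by blast
  obtain v'' where v'': "lin g v' v''" using leaf_lin v'(1) by blast
  obtain z where z: "w = v' @ z" using v'(2) by (auto simp: prefix_def)
  have "v'' @ z = w @ u"
    using lin_unique[OF lin_append[OF v'', of z]] gw z by simp
  then have "length (v'' @ z) = length (w @ u)" by (rule arg_cong)
  then have l: "length v'' = length v' + length u" using z by simp
  have hpv': "h p \<in> cone v'" using hpw cone_mono[OF v'(2)] by blast
  then have "h p \<in> cone v''" using lin_in_cone[OF v''] hg by metis
  then have "prefix v' v''" using cone_nested_length[OF hpv'] l by simp
  then obtain u' where v''u': "v'' = v' @ u'" by (auto simp: prefix_def)
  then have u': "v'' = v' @ u'" "u' \<noteq> []" using l u(1) by auto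
  have av': "attr g v'" using v'(1) v'' u' by (auto simp: attr_def)
  have gl: "lin g v' (v' @ u')" using v'' u' by simp
  let ?w = "\<lambda>n. v' @ concat (replicate n u')"
  have len': "length (?w n) = length v' + n * length u'" for n
    by (simp add: length_concat sum_list_replicate)
  have pw: "h p \<in> cone (?w n)" for n
  proof -
    have "(g ^^ n) (h p) = h p" using hg by (induction n) auto
    then show ?thesis using zpow_nat_image_lin[OF gl, of n] hpv' by (metis imageI)
  qed
  obtain m where m: "cone w \<subseteq> cone (?w m)" "cone (?w (Suc m)) \<subseteq> cone w"
  proof -
    have ex: "\<not> prefix (?w n) w" if "n > length w" for n
    proof
      assume "prefix (?w n) w"
      then have "length v' + n * length u' \<le> length w" using prefix_length_le len' by metis
      moreover have "n \<le> n * length u'" using u'(2) by (cases u') auto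
      ultimately show False using that by linarith
    qed
    define n where "n = (LEAST n. \<not> prefix (?w n) w)"
    have n: "\<not> prefix (?w n) w" unfolding n_def by (rule LeastI) (rule ex[OF lessI])
    have "n \<noteq> 0" using n v'(2) by (intro notI) simp
    then obtain m where m: "n = Suc m" by (cases n) auto
    have "prefix (?w m) w" using not_less_Least[of m "\<lambda>n. \<not> prefix (?w n) w"] m n_def by auto
    moreover have "prefix w (?w (Suc m))" using n m cone_nested[OF pw hpw, of "Suc m"] by auto
    ultimately show thesis using that[of m] cone_mono by blast
  qed
  have hJ: "zpow g (int J) (h x) \<in> cone w \<longleftrightarrow> x \<in> cone v" for x
  proof -
    have "zpow g (int J) (h x) = h ((f ^^ J) x)"
      using zpow_intertwines[where h = h, OF bf bg hfg, of "int J" x] by simp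
    then have "zpow g (int J) (h x) \<in> cone w \<longleftrightarrow> (f ^^ J) x \<in> cone (?v J)"
      using lin_in_cone_iff[OF bij_is_inj[OF bh] w] by simp
    also have "\<dots> \<longleftrightarrow> x \<in> cone v"
      using zpow_nat_image_lin[OF u(2), of J] dyadic_inj[OF dyadic_funpow[OF f]] by (metis inj_image_mem_iff)
    finally show ?thesis .
  qed
  have gm: "zpow g (int n) y \<in> cone (?w n) \<longleftrightarrow> y \<in> cone v'" for n y
    using zpow_nat_image_lin[OF gl, of n] dyadic_inj[OF dyadic_funpow[OF g, of n]] by (metis inj_image_mem_iff zpow_nat)
  have "off g h v v' (int J - int m)"
    unfolding off_def
  proof (intro allI conjI impI)
    fix x
    let ?y = "zpow g (int J - int m) (h x)"
    assume "x \<in> cone v"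
    then have "zpow g (int J) (h x) \<in> cone (?w m)" using hJ m by blast
    moreover have "zpow g (int J) (h x) = zpow g (int m) ?y"
      by (simp add: zpow_add[OF bg, symmetric] del: zpow_nat)
    ultimately show "?y \<in> cone v'" using gm by metis
  next
    fix x
    let ?y = "zpow g (int J - int m - 1) (h x)"
    assume "?y \<in> cone v'"
    then have "zpow g (int (Suc m)) ?y \<in> cone (?w (Suc m))" using gm by blast
    moreover have "zpow g (int (Suc m)) ?y = zpow g (int J) (h x)"
      by (simp add: zpow_add[OF bg, symmetric] del: zpow_nat)
    ultimately show "x \<in> cone v" using hJ m by auto
  qed
  then show ?thesis
    using v av' hpv' unfolding offset_def by blast
qed

lemma attr_fix_finv_disjoint:
  assumes f: "dyadic f" and p: "attr_fix f p" "attr_fix (finv f) p" shows False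
proof -
  obtain v where v: "attr f v" "p \<in> cone v" "f p = p" using p by (auto simp: attr_fix_def)
  obtain w where w: "attr (finv f) w" "p \<in> cone w" using p by (auto simp: attr_fix_def)
  obtain w0 where w0: "w0 \<in> leaf f" "\<And>x. x \<in> cone w0 \<longleftrightarrow> f x \<in> cone w" "strict_prefix w w0"
    using attr_finv_leaf[OF dyadic_bij[OF f] w(1)] by blast
  have "p \<in> cone w0" using w0(2) w(2) v(3) by simp
  then have eq: "v = w0" using leaf_unique[OF attr_leaf[OF v(1)] w0(1)] v(2) by blast
  have "cone w \<subseteq> cone w0"
  proof
    fix y assume "y \<in> cone w"
    then have "finv f y \<in> cone w0" using w0(2) f dyadic_bij by (metis bij_inv_eq_iff)
    then have "f (finv f y) \<in> cone w0" using attr_step[OF v(1)] eq by blast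
    then show "y \<in> cone w0" using f dyadic_bij by (metis bij_inv_eq_iff)
  qed
  then have "prefix w0 w" by (rule cone_subset_imp_prefix)
  then show False using w0(3) by (meson prefix_order.leD)
qed

section \<open>Counting the leaves to the left of a fixed point\<close>

definition rank :: "selfmap \<Rightarrow> bool stream \<Rightarrow> nat" where
  "rank f p = card {u \<in> leaf f. \<forall>y\<in>cone u. y < p}"

lemma rank_le: "dyadic f \<Longrightarrow> rank f p \<le> card (leaf f)"
  unfolding rank_def using card_leaf(1)[OF dyadic_finite] by (intro card_mono) auto

text \<open>The summand \<open>1\<close> is the leaf containing \<open>q\<close>. It holds no other
  fixed point, so it misses \<open>p\<close> and lies to the left of \<open>p\<close>, while being
  counted neither left of \<open>q\<close> nor between the two points.\<close>

lemma rank_step: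
  assumes f: "dyadic f" and qp: "q < p" and p: "f p = p" and q: "attr_fix f q \<or> attr_fix (finv f) q"
  shows "rank f q + card (between f p q) + 1 \<le> rank f p"
proof -
  let ?Q = "{u \<in> leaf f. \<forall>y\<in>cone u. y < q}" and ?P = "{u \<in> leaf f. \<forall>y\<in>cone u. y < p}"
  have fin: "finite (leaf f)" using card_leaf(1)[OF dyadic_finite[OF f]] .
  have qf: "f q = q" using q by (auto simp: attr_fix_def finv_fix_iff[OF dyadic_bij[OF f]])
  obtain u where u: "u \<in> leaf f" "q \<in> cone u" "p \<notin> cone u"
  proof (cases "attr_fix f q")
    case True
    then obtain v where v: "attr f v" "q \<in> cone v" by (auto simp: attr_fix_def)
    then show thesis
      using that[of v] attr_fix_unique[OF v(1)] qf p qp attr_leaf by blast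
  next
    case False
    then obtain w where w: "attr (finv f) w" "q \<in> cone w" using q by (auto simp: attr_fix_def)
    obtain w0 where w0: "w0 \<in> leaf f" "\<And>x. x \<in> cone w0 \<longleftrightarrow> f x \<in> cone w"
      using attr_finv_leaf[OF dyadic_bij[OF f] w(1)] by blast
    then show thesis
      using that[of w0] attr_fix_unique[OF w(1), of p q] qf p qp w(2)
      by (auto simp: finv_fix_iff[OF dyadic_bij[OF f]])
  qed
  have uP: "\<forall>y\<in>cone u. y < p"
  proof (rule ballI, rule ccontr)
    fix y assume "y \<in> cone u" "\<not> y < p"
    then show False using cone_convex[OF u(2), of y p] u(3) less_imp_le[OF qp] by (auto simp: not_less)
  qed
  have sub: "?Q \<union> between f p q \<union> {u} \<subseteq> ?P"
    using u(1) uP qp by (auto simp: between_def intro: less_trans)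
  have d1: "?Q \<inter> between f p q = {}"
  proof -
    have "\<not> (\<forall>y\<in>cone w. y < q) \<or> \<not> (\<forall>y\<in>cone w. q < y)" for w
      using shift_in_cone[of w "sconst True"] by (meson less_asym)
    moreover have "\<forall>y\<in>cone w. q < y" if "w \<in> between f p q" for w
      using that qp by (auto simp: between_def)
    ultimately show ?thesis by blast
  qed
  have d2: "u \<notin> ?Q \<union> between f p q" using u(2) qp by (auto simp: between_def min_def)
  have "card (?Q \<union> between f p q \<union> {u}) = card ?Q + card (between f p q) + 1"
    using d1 d2 fin between_finite[OF f] by (simp add: card_Un_disjoint)
  moreover have "card (?Q \<union> between f p q \<union> {u}) \<le> card ?P"
    using sub fin by (intro card_mono) auto
  ultimately show ?thesis by (simp add: rank_def)
qed

lemma offset_attr_fix: "intertwines f g h \<Longrightarrow> f p = p \<Longrightarrow> offset f g h p d \<Longrightarrow> attr_fix g (h p)"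
  unfolding offset_def attr_fix_def intertwines_def by metis

lemma intertwines_attr_fix: "intertwines f g h \<Longrightarrow> attr_fix f p \<Longrightarrow> attr_fix g (h p)"
  using offset_exists offset_attr_fix unfolding attr_fix_def by blast

text \<open>Along an orbit running from the repelling point \<open>q\<close> to the attracting point \<open>p\<close>, the times at
  which the orbit and its image under \<open>h\<close> leave \<open>w\<close> and enter \<open>v\<close> differ by \<open>-e\<close> and \<open>d\<close>
  respectively, up to one.\<close>

lemma offset_comparison:
  assumes c: "intertwines f g h"
    and d: "offset f g h p d" and p: "f p = p" and e: "offset (finv f) (finv g) h q e" and q: "f q = q"
    and nf: "f x \<noteq> x"
    and xv: "\<exists>v i. attr f v \<and> p \<in> cone v \<and> zpow f i x \<in> cone v"
    and xw: "\<exists>w i. attr (finv f) w \<and> q \<in> cone w \<and> zpow f i x \<in> cone w"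
    and pq: "p \<noteq> q"
  shows "\<bar>d + e\<bar> \<le> int (card (between f p q)) + int (card (between g (h p) (h q))) + 2"
proof -
  have f: "dyadic f" and g: "dyadic g" and h: "dyadic h" and hfg: "\<And>x. h (f x) = g (h x)"
    using c by (auto simp: intertwines_def)
  note bf = dyadic_bij[OF f] and bg = dyadic_bij[OF g] and bh = dyadic_bij[OF h]
  obtain v v' where v: "attr f v" "attr g v'" "p \<in> cone v" "h p \<in> cone v'" "off g h v v' d"
    using d by (auto simp: offset_def)
  obtain w w' where w: "attr (finv f) w" "attr (finv g) w'" "q \<in> cone w" "h q \<in> cone w'"
    "off (finv g) h w w' e"
    using e by (auto simp: offset_def)
  obtain iv where iv: "zpow f iv x \<in> cone v"
    using xv leaf_unique[OF attr_leaf attr_leaf[OF v(1)]] v(3) by blast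
  obtain iw where iw: "zpow f iw x \<in> cone w"
    using xw leaf_unique[OF attr_leaf attr_leaf[OF w(1)]] w(3) by blast
  have zc: "h (zpow f i x) = zpow g i (h x)" for i using zpow_intertwines[where h = h, OF bf bg hfg] .
  have o1: "zpow g (i + d) (h x) \<in> cone v'" if "zpow f i x \<in> cone v" for i
    using v(5) that zpow_add[OF bg, of d i "h x"] zc[of i] by (auto simp: off_def add.commute)
  have o2: "zpow f i x \<in> cone v" if "zpow g (i + d - 1) (h x) \<in> cone v'" for i
    using v(5) that zpow_add[OF bg, of "d - 1" i "h x"] zc[of i] by (auto simp: off_def algebra_simps)
  have o3: "zpow g (i - e) (h x) \<in> cone w'" if "zpow f i x \<in> cone w" for i
    using w(5) that zpow_add[OF bg, of "- e" i "h x"] zc[of i]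
    by (auto simp: off_def add.commute zpow_finv[OF bg])
  have o4: "zpow f i x \<in> cone w" if "zpow g (i - e + 1) (h x) \<in> cone w'" for i
    using w(5) that zpow_add[OF bg, of "- (e - 1)" i "h x"] zc[of i]
    by (auto simp: off_def algebra_simps zpow_finv[OF bg])
  obtain a b where a: "\<And>i. zpow f i x \<in> cone v \<longleftrightarrow> a \<le> i" and b: "\<And>i. zpow f i x \<in> cone w \<longleftrightarrow> i \<le> b"
    and ab: "b \<le> a" "a - b \<le> int (card (between f p q))"
    using transit_count[OF f v(1,3) p w(1,3) q nf iv iw pq] by blast
  have hp: "g (h p) = h p" "g (h q) = h q" "h p \<noteq> h q" "g (h x) \<noteq> h x"
    using p q nf pq bij_is_inj[OF bh] by (simp_all add: inj_eq flip: hfg)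
  obtain a' b' where a': "\<And>i. zpow g i (h x) \<in> cone v' \<longleftrightarrow> a' \<le> i"
    and b': "\<And>i. zpow g i (h x) \<in> cone w' \<longleftrightarrow> i \<le> b'"
    and ab': "b' \<le> a'" "a' - b' \<le> int (card (between g (h p) (h q)))"
    using transit_count[OF g v(2,4) hp(1) w(2,4) hp(2,4) o1[OF iv] o3[OF iw] hp(3)] by blast
  \<comment> \<open>So \<open>a'\<close> is \<open>a + d\<close> or one less, and \<open>b'\<close>
    is \<open>b - e\<close> or one more. Taking differences yields \<open>d + e\<close> up to an
    error of two.\<close>
  have "a' \<le> a + d" using o1[of a] a a' by simp
  moreover have "a \<le> a' - d + 1" using o2[of "a' - d + 1"] a a' by simp
  moreover have "b - e \<le> b'" using o3[of b] b b' by simp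
  moreover have "b' + e - 1 \<le> b" using o4[of "b' + e - 1"] b b' by simp
  ultimately show ?thesis using ab ab' by linarith
qed

section \<open>Bounding the offsets\<close>

definition bnd :: "selfmap \<Rightarrow> selfmap \<Rightarrow> selfmap \<Rightarrow> bool stream \<Rightarrow> bool" where
  "bnd f g h p \<longleftrightarrow>
    (attr_fix f p \<longrightarrow> (\<exists>d. offset f g h p d \<and> \<bar>d\<bar> \<le> int (rank f p + rank g (h p)))) \<and>
    (attr_fix (finv f) p \<longrightarrow>
      (\<exists>e. offset (finv f) (finv g) h p e \<and> \<bar>e\<bar> \<le> int (rank f p + rank g (h p))))"

text \<open>The \<open>2\<close> stands for the leaf at \<open>q\<close> and the leaf at
  \<open>h q\<close>. It pays for the error \<open>2\<close> in \<open>offset_comparison\<close>, so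
  that the bound in \<open>bnd\<close> passes to the next fixed point.\<close>

lemma rank_sum_step:
  assumes c: "intertwines f g h" and qp: "q < p" and p: "f p = p" and q: "attr_fix f q \<or> attr_fix (finv f) q"
  shows "rank f q + rank g (h q) + card (between f p q) + card (between g (h p) (h q)) + 2
    \<le> rank f p + rank g (h p)"
proof -
  have f: "dyadic f" and g: "dyadic g" and h: "dyadic h" and hfg: "\<And>x. h (f x) = g (h x)"
    using c by (auto simp: intertwines_def)
  have "rank f q + card (between f p q) + 1 \<le> rank f p"
    by (rule rank_step[OF f qp p q])
  moreover have "rank g (h q) + card (between g (h p) (h q)) + 1 \<le> rank g (h p)"
  proof (rule rank_step[OF g])
    show "h q < h p" using qp by (simp add: dyadic_less_iff[OF h])
    show "g (h p) = h p" using p by (simp flip: hfg)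
    show "attr_fix g (h q) \<or> attr_fix (finv g) (h q)"
      using q intertwines_attr_fix[OF c] intertwines_attr_fix[OF intertwines_finv[OF c]] by blast
  qed
  ultimately show ?thesis by linarith
qed

text \<open>The orbit of \<open>x\<close> joins \<open>p\<close> to a fixed point of the opposite
  type on the left of \<open>x\<close>: if \<open>f\<close> moves \<open>x\<close> to the right,
  \<open>p\<close> attracts and the other point repels, and conversely. The offset at the left point
  is bounded by assumption, and the comparison along this orbit carries the bound over to
  \<open>p\<close>.\<close>

lemma bnd_step:
  assumes c: "intertwines f g h" and p: "attr_fix f p \<or> attr_fix (finv f) p"
    and xp: "x < p" and nofix: "\<And>z. x \<le> z \<Longrightarrow> z < p \<Longrightarrow> f z \<noteq> z"
    and prev: "\<And>q. q < p \<Longrightarrow> attr_fix f q \<or> attr_fix (finv f) q \<Longrightarrow> bnd f g h q"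
  shows "bnd f g h p"
proof -
  have f: "dyadic f" and g: "dyadic g" and h: "dyadic h" and hfg: "\<And>x. h (f x) = g (h x)"
    using c by (auto simp: intertwines_def)
  note bf = dyadic_bij[OF f]
  have fp: "f p = p" using p by (auto simp: attr_fix_def finv_fix_iff[OF bf])
  have nf: "f x \<noteq> x" using nofix[of x] xp by simp
  have nf': "finv f x \<noteq> x" using nf by (simp add: finv_fix_iff[OF bf])
  have disj: "\<not> (attr_fix f p \<and> attr_fix (finv f) p)" using attr_fix_finv_disjoint[OF f] by blast
  obtain v1 p1 i1 where 1: "attr f v1" "p1 \<in> cone v1" "f p1 = p1" "zpow f i1 x \<in> cone v1"
    "x < f x \<Longrightarrow> x < p1" "f x < x \<Longrightarrow> p1 < x" "\<And>z. f z = z \<Longrightarrow> x < z \<Longrightarrow> \<not> z < p1"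
    using forward_limit[OF f nf] by blast
  obtain v2 p2 i2 where 2: "attr (finv f) v2" "p2 \<in> cone v2" "f p2 = p2" "zpow (finv f) i2 x \<in> cone v2"
    "x < finv f x \<Longrightarrow> x < p2" "finv f x < x \<Longrightarrow> p2 < x" "\<And>z. f z = z \<Longrightarrow> x < z \<Longrightarrow> \<not> z < p2"
    using forward_limit[OF dyadic_inv[OF f] nf'] by (auto simp: finv_fix_iff[OF bf])
  have a1: "attr_fix f p1" using 1 by (auto simp: attr_fix_def)
  have a2: "attr_fix (finv f) p2" using 2 by (auto simp: attr_fix_def finv_fix_iff[OF bf])
  have inv_order: "x < f x \<longleftrightarrow> finv f x < x" "f x < x \<longleftrightarrow> x < finv f x"
    using dyadic_less_iff[OF f, of "finv f x" x] dyadic_less_iff[OF f, of x "finv f x"] bf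
    by (simp_all add: bij_is_surj surj_f_inv_f)
  have xv: "\<exists>v i. attr f v \<and> p1 \<in> cone v \<and> zpow f i x \<in> cone v" using 1 by blast
  have xw: "\<exists>w i. attr (finv f) w \<and> p2 \<in> cone w \<and> zpow f i x \<in> cone w"
    using 2 by (auto simp: zpow_finv[OF bf])
  obtain d where d: "offset f g h p1 d" using offset_exists[OF c a1] by blast
  obtain e where e: "offset (finv f) (finv g) h p2 e" using offset_exists[OF intertwines_finv[OF c] a2] by blast
  show ?thesis
  proof (cases "x < f x")
    case True
    then have lt: "p2 < x" "x < p1" using 1 2 inv_order by auto
    have pp: "p1 = p"
      using nofix[of p1] 1(3,7) lt fp xp by (metis less_imp_le linorder_neqE)
    have p2p: "p2 < p" using lt xp by order
    obtain e where e: "offset (finv f) (finv g) h p2 e" "\<bar>e\<bar> \<le> int (rank f p2 + rank g (h p2))"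
      using prev[OF p2p] a2 by (auto simp: bnd_def)
    have "\<bar>d + e\<bar> \<le> int (card (between f p1 p2)) + int (card (between g (h p1) (h p2))) + 2"
      by (rule offset_comparison[OF c d 1(3) e(1) 2(3) nf xv xw]) (use pp p2p in auto)
    then have "\<bar>d\<bar> \<le> int (rank f p + rank g (h p))"
      using rank_sum_step[OF c p2p fp] a2 e(2) pp by auto
    then show ?thesis using d pp disj a1 by (auto simp: bnd_def)
  next
    case False
    then have fx: "f x < x" using nf by auto
    then have lt: "x < p2" "p1 < x" using 1 2 inv_order by auto
    have pp: "p2 = p"
      using nofix[of p2] 2(3,7) lt fp xp by (metis less_imp_le linorder_neqE)
    have p1p: "p1 < p" using lt xp by order
    obtain d where d: "offset f g h p1 d" "\<bar>d\<bar> \<le> int (rank f p1 + rank g (h p1))"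
      using prev[OF p1p] a1 by (auto simp: bnd_def)
    have "\<bar>d + e\<bar> \<le> int (card (between f p1 p2)) + int (card (between g (h p1) (h p2))) + 2"
      by (rule offset_comparison[OF c d(1) 1(3) e 2(3) nf xv xw]) (use pp p1p in auto)
    then have "\<bar>e\<bar> \<le> int (rank f p + rank g (h p))"
      using rank_sum_step[OF c p1p fp] a1 d(2) pp
      by (auto simp: between_sym[of f p] between_sym[of g "h p"])
    then show ?thesis using e pp disj a2 by (auto simp: bnd_def)
  qed
qed

section \<open>Pasting maps, and twisting a conjugator at a fixed point\<close>

text \<open>Across two classes, monotonicity is inherited from \<open>h\<close>, since the classes
  are convex and both maps have the same image on each of them. The classes are two half lines in
  \<open>intertwines_twist\<close> and the components of a fixed region in
  \<open>few_breaks_on_idreg\<close>.\<close>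

lemma dyadic_paste:
  assumes h: "dyadic h" and refl: "\<And>x. x \<in> cls x" and eq: "\<And>x y. y \<in> cls x \<Longrightarrow> cls y = cls x"
    and convex: "\<And>x y z. z \<in> cls x \<Longrightarrow> x \<le> y \<Longrightarrow> y \<le> z \<Longrightarrow> y \<in> cls x"
    and mono: "\<And>x y. y \<in> cls x \<Longrightarrow> x < y \<Longrightarrow> h' x < h' y"
    and image: "\<And>x. h' ` cls x = h ` cls x" and fin: "finite (brk h')"
  shows "dyadic h'"
proof -
  have "h' x < h' y" if xy: "x < y" for x y
  proof (cases "y \<in> cls x")
    case False
    have "h' x \<in> h ` cls x" "h' y \<in> h ` cls y" using image refl by blast+
    then obtain x' y' where x': "x' \<in> cls x" "h' x = h x'" and y': "y' \<in> cls y" "h' y = h y'"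
      by blast
    have "x' < y'"
    proof (rule ccontr)
      assume "\<not> x' < y'"
      then have yx: "y' \<le> x'" by simp
      show False
      proof (cases "y \<le> x'")
        case True
        then show False using convex[OF x'(1), of y] xy False by (simp add: less_imp_le)
      next
        case nle: False
        have "y \<in> cls y'" using eq[OF y'(1)] refl by blast
        then have "x' \<in> cls y'" using convex[of y y' x'] yx nle by simp
        then have "cls x = cls y" using eq x'(1) y'(1) by metis
        then show False using False refl by blast
      qed
    qed
    then show ?thesis using x' y' by (simp add: dyadic_less_iff[OF h])
  qed (use mono that in simp)
  moreover have "surj h'"
  proof -
    have "y \<in> range h'" for y
    proof -
      obtain x where "y = h x" using dyadic_bij[OF h] by (metis bij_is_surj surjD)
      then have "y \<in> h' ` cls x" using image refl by blast
      then show ?thesis by blast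
    qed
    then show ?thesis by blast
  qed
  ultimately show ?thesis using fin by (simp add: dyadic_def strict_mono_def)
qed

text \<open>A conjugator may be composed with a power of \<open>f\<close> to the right of a fixed point, as long as
  this fixed point is the left end of a cone.\<close>

definition twist :: "selfmap \<Rightarrow> selfmap \<Rightarrow> bool stream \<Rightarrow>
    int \<Rightarrow> bool stream \<Rightarrow> bool stream" where
  "twist f h p k y = (if y < p then h y else h (zpow f k y))"

lemma twist_finv: "bij f \<Longrightarrow> twist (finv f) h p (- k) = twist f h p k"
  by (simp add: twist_def fun_eq_iff zpow_finv)

lemma twist_fixed: assumes "bij f" "f z = z" shows "twist f h p k z = h z"
  by (simp add: twist_def zpow_fix[OF assms])

text \<open>A cone that contains \<open>p\<close> and whose word is not a prefix of \<open>v\<close>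
  lies in \<open>cone v\<close>, thus nowhere to the left of \<open>p\<close>. So only prefixes of
  \<open>v\<close> are cut in two, and only these can become breaks besides those of
  \<open>h\<close> and of \<open>h\<close> after the power of \<open>f\<close>.\<close>

lemma intertwines_twist:
  assumes c: "intertwines f g h" and p: "f p = p" "p = v @- sconst False"
  shows "intertwines f g (twist f h p k)"
proof -
  have f: "dyadic f" and g: "dyadic g" and h: "dyadic h" and hfg: "\<And>x. h (f x) = g (h x)"
    using c by (auto simp: intertwines_def)
  note bf = dyadic_bij[OF f]
  let ?h = "twist f h p k"
  have fl: "f x < p \<longleftrightarrow> x < p" for x using dyadic_less_iff[OF f, of x p] p(1) by simp
  have "?h (f x) = g (?h x)" for x
    by (simp add: twist_def fl hfg zpow_Suc_right[OF bf, symmetric] zpow_Suc[OF bf])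
  moreover have "dyadic ?h"
  proof (rule dyadic_paste[OF h, where cls = "\<lambda>x. if x < p then {..<p} else {p..}"])
    fix x
    show "?h ` (if x < p then {..<p} else {p..}) = h ` (if x < p then {..<p} else {p..})"
    proof (cases "x < p")
      case True
      then show ?thesis by (auto simp: twist_def)
    next
      case False
      have "h ` {p..} = (\<lambda>y. h (zpow f k y)) ` {p..}"
      proof
        show "h ` {p..} \<subseteq> (\<lambda>y. h (zpow f k y)) ` {p..}"
        proof
          fix y assume "y \<in> h ` {p..}"
          then obtain x where x: "y = h x" "p \<le> x" by auto
          have "p \<le> zpow f (- k) x" using x(2) zpow_less_fix(1)[OF f p(1)] by (simp add: not_less[symmetric])
          moreover have "y = h (zpow f k (zpow f (- k) x))" using x(1) by (simp flip: zpow_add[OF bf])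
          ultimately show "y \<in> (\<lambda>y. h (zpow f k y)) ` {p..}" by auto
        qed
        show "(\<lambda>y. h (zpow f k y)) ` {p..} \<subseteq> h ` {p..}"
          using zpow_less_fix(1)[OF f p(1)] by (auto simp: not_less[symmetric])
      qed
      moreover have "?h ` {p..} = (\<lambda>y. h (zpow f k y)) ` {p..}"
        by (rule image_cong) (auto simp: twist_def)
      ultimately show ?thesis using False by simp
    qed
    have "brk ?h \<subseteq> brk h \<union> brk (h \<circ> zpow f k) \<union> {w. prefix w v}"
    proof
      fix w assume w: "w \<in> brk ?h"
      show "w \<in> brk h \<union> brk (h \<circ> zpow f k) \<union> {w. prefix w v}"
      proof (rule ccontr)
        assume n: "\<not> ?thesis"
        have "(\<forall>y\<in>cone w. y < p) \<or> (\<forall>y\<in>cone w. p \<le> y)"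
        proof (cases "p \<in> cone w")
          case True
          then have "prefix v w" using cone_nested[of p w v] n p(2) by auto
          then have "y \<in> cone v" if "y \<in> cone w" for y using that cone_mono by blast
          then have "p \<le> y" if "y \<in> cone w" for y
            using that sconst_False_le by (fastforce simp: p(2) cone_def)
          then show ?thesis by blast
        next
          case False
          then show ?thesis using cone_convex[of _ w _ p] by (meson linear not_le)
        qed
        then consider "\<And>s. ?h (w @- s) = h (w @- s)" | "\<And>s. ?h (w @- s) = (h \<circ> zpow f k) (w @- s)"
          using shift_in_cone by (auto simp: twist_def not_less[symmetric])
        then show False using w n by cases (auto simp: brk_def lin_def)
      qed
    qed
    moreover have "finite (brk (h \<circ> zpow f k))" using dyadic_comp[OF dyadic_zpow[OF f] h] by (rule dyadic_finite)
    ultimately show "finite (brk ?h)"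
      using dyadic_finite[OF h] finite_cone_prefixes[of v] by (auto elim!: finite_subset)
  qed (auto simp: twist_def dyadic_less_iff[OF h] dyadic_less_iff[OF dyadic_zpow[OF f]] split: if_splits)
  ultimately show ?thesis using f g by (simp add: intertwines_def)
qed

text \<open>The contracting cone of \<open>z\<close> has no second fixed point, so it does not reach
  \<open>p\<close>, and likewise on the side of \<open>g\<close>. Hence both conditions in
  \<open>off\<close> concern points where the twist changes nothing.\<close>

lemma offset_twist_left:
  assumes c: "intertwines f g h" and p: "f p = p" and z: "f z = z" "z < p" and o: "offset f g h z d"
  shows "offset f g (twist f h p k) z d"
proof -
  have f: "dyadic f" and g: "dyadic g" and h: "dyadic h" and hfg: "\<And>x. h (f x) = g (h x)"
    using c by (auto simp: intertwines_def)
  obtain v v' where v: "attr f v" "attr g v'" "z \<in> cone v" "h z \<in> cone v'" "off g h v v' d"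
    using o by (auto simp: offset_def)
  let ?h = "twist f h p k"
  have ghp: "g (h p) = h p" "g (h z) = h z" using p z by (simp_all flip: hfg)
  have hzp: "h z < h p" using z(2) by (simp add: dyadic_less_iff[OF h])
  have "off g ?h v v' d"
    unfolding off_def
  proof (intro allI conjI impI)
    fix x assume x: "x \<in> cone v"
    have "x < p"
    proof (rule ccontr)
      assume "\<not> x < p"
      then have "p \<in> cone v" using cone_convex[OF v(3) x, of p] z(2) by auto
      then show False using attr_fix_unique[OF v(1,3) z(1) _ p] z(2) by auto
    qed
    then show "zpow g d (?h x) \<in> cone v'" using v(5) x by (simp add: off_def twist_def)
  next
    fix x assume x: "zpow g (d - 1) (?h x) \<in> cone v'"
    have "x < p"
    proof (rule ccontr)
      assume n: "\<not> x < p"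
      then have "\<not> zpow f k x < p" by (simp add: zpow_less_fix[OF f p])
      then have "\<not> ?h x < h p" using n by (simp add: twist_def dyadic_less_iff[OF h])
      then have "h p \<le> zpow g (d - 1) (?h x)" by (simp add: zpow_less_fix[OF g ghp(1)] not_less[symmetric])
      then have "h p \<in> cone v'" using cone_convex[OF v(4) x] hzp by auto
      then show False using attr_fix_unique[OF v(2,4) ghp(2) _ ghp(1)] hzp by auto
    qed
    then show "x \<in> cone v" using v(5) x by (simp add: off_def twist_def)
  qed
  then show ?thesis
    using v twist_fixed[OF dyadic_bij[OF f] z(1)] unfolding offset_def by metis
qed

text \<open>As \<open>p\<close> is the left end of \<open>cone v\<close>, this whole cone belongs to
  the twisted part. There \<open>h\<close> is followed by the \<open>k\<close>-th power of
  \<open>g\<close>, which lowers the offset by \<open>k\<close>.\<close>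

lemma offset_twist_at:
  assumes c: "intertwines f g h" and p: "f p = p" "p = v @- sconst False" and v: "attr f v"
    and o: "offset f g h p d"
  shows "offset f g (twist f h p k) p (d - k)"
proof -
  have f: "dyadic f" and g: "dyadic g" and h: "dyadic h" and hfg: "\<And>x. h (f x) = g (h x)"
    using c by (auto simp: intertwines_def)
  note bf = dyadic_bij[OF f] and bg = dyadic_bij[OF g]
  obtain v0 v' where v0: "attr f v0" "attr g v'" "p \<in> cone v0" "h p \<in> cone v'" "off g h v0 v' d"
    using o by (auto simp: offset_def)
  have "v0 = v" using leaf_unique[OF attr_leaf[OF v0(1)] attr_leaf[OF v]] v0(3) p(2) by auto
  note v0 = v0[unfolded this]
  let ?h = "twist f h p k"
  have ghp: "g (h p) = h p" using p by (simp flip: hfg)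
  have min: "p \<le> y" if "y \<in> cone v" for y
    using that sconst_False_le by (auto simp: p(2) cone_def)
  have hk: "zpow g i (h (zpow f k x)) = zpow g (i + k) (h x)" for i x
    using zpow_intertwines[where h = h, OF bf bg hfg, of k x] by (simp add: zpow_add[OF bg])
  have "off g ?h v v' (d - k)"
    unfolding off_def
  proof (intro allI conjI impI)
    fix x assume x: "x \<in> cone v"
    then show "zpow g (d - k) (?h x) \<in> cone v'"
      using v0(5) min[OF x] hk[of "d - k" x] by (auto simp: off_def twist_def not_less[symmetric])
  next
    fix x assume x: "zpow g (d - k - 1) (?h x) \<in> cone v'"
    \<comment> \<open>A point of \<open>cone v'\<close> to the left of \<open>h p\<close> would, by
      the second half of \<open>off\<close>, come from a point of \<open>cone v\<close>, none of
      which is to the left of \<open>p\<close>.\<close>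
    have "p \<le> x"
    proof (rule ccontr)
      assume "\<not> p \<le> x"
      then have "x < p" by simp
      define y where "y = zpow g (d - k - 1) (?h x)"
      have "y < h p" using \<open>x < p\<close>
        by (simp add: y_def zpow_less_fix[OF g ghp] twist_def dyadic_less_iff[OF h])
      obtain x' where x': "h x' = zpow g (1 - d) y" using dyadic_bij[OF h] by (metis bij_is_surj surjD)
      have "zpow g (d - 1) (h x') = y" by (simp add: x' flip: zpow_add[OF bg])
      then have "x' \<in> cone v" using v0(5) x unfolding off_def y_def by metis
      then have "\<not> h x' < h p" using min by (simp add: dyadic_less_iff[OF h] not_less)
      then show False using \<open>y < h p\<close> by (simp add: x' zpow_less_fix[OF g ghp])
    qed
    then show "x \<in> cone v"
      using v0(5) x hk[of "d - k - 1" x] by (auto simp: off_def twist_def not_less[symmetric] algebra_simps)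
  qed
  then show ?thesis
    using v0 twist_fixed[OF bf p(1)] unfolding offset_def by metis
qed

lemma bnd_twist_left:
  assumes c: "intertwines f g h" and p: "f p = p" and z: "f z = z" "z < p" and b: "bnd f g h z"
  shows "bnd f g (twist f h p k) z"
proof -
  have bf: "bij f" using c by (simp add: intertwines_def dyadic_bij)
  have "offset f g (twist f h p k) z d" if "offset f g h z d" for d
    by (rule offset_twist_left[OF c p z that])
  moreover have "offset (finv f) (finv g) (twist f h p k) z e" if "offset (finv f) (finv g) h z e" for e
    using offset_twist_left[OF intertwines_finv[OF c] _ _ z(2) that, of "- k"] p z(1)
    by (simp add: finv_fix_iff[OF bf] twist_finv[OF bf])
  ultimately show ?thesis
    using b unfolding bnd_def by (simp add: twist_fixed[OF bf z(1)]) blast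
qed

text \<open>By \<open>nofree\<close> every interval \<open>[x, p)\<close> contains a fixed point,
  whereas the cone around \<open>p\<close> has no second one. So \<open>p\<close> is the left end of
  this cone, where twisting is allowed, and a twist by the offset itself makes the offset
  vanish.\<close>

lemma bnd_twist_exists:
  assumes c: "intertwines f g h" and p: "attr_fix f p \<or> attr_fix (finv f) p"
    and nofree: "\<And>x. x < p \<Longrightarrow> \<exists>z. x \<le> z \<and> z < p \<and> f z = z"
  shows "\<exists>k. intertwines f g (twist f h p k) \<and> bnd f g (twist f h p k) p"
proof -
  have f: "dyadic f" using c by (simp add: intertwines_def)
  note bf = dyadic_bij[OF f]
  have fp: "f p = p" using p by (auto simp: attr_fix_def finv_fix_iff[OF bf])
  have disj: "\<not> (attr_fix f p \<and> attr_fix (finv f) p)" using attr_fix_finv_disjoint[OF f] by blast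
  have left: "p = v @- sconst False"
    if F: "\<And>z. F z = z \<longleftrightarrow> f z = z" and v: "attr F v" "p \<in> cone v" for F v
  proof (rule ccontr)
    assume n: "p \<noteq> v @- sconst False"
    have "v @- sconst False \<le> p" using v(2) sconst_False_le by (auto simp: cone_def)
    then have "v @- sconst False < p" using n by simp
    then obtain z where z: "v @- sconst False \<le> z" "z < p" "f z = z" using nofree by blast
    then have "z \<in> cone v" using cone_convex[OF shift_in_cone v(2)] by auto
    then show False using attr_fix_unique[OF v _ _ , of z] F fp z by auto
  qed
  show ?thesis
  proof (cases "attr_fix f p")
    case True
    then obtain v where v: "attr f v" "p \<in> cone v" by (auto simp: attr_fix_def)
    have pv: "p = v @- sconst False" by (rule left[OF _ v]) simp
    obtain d where d: "offset f g h p d" using offset_exists[OF c True] by blast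
    have "offset f g (twist f h p d) p 0"
      using offset_twist_at[OF c fp pv v(1) d, of d] by simp
    then have "bnd f g (twist f h p d) p"
      using disj True by (auto simp: bnd_def)
    then show ?thesis using intertwines_twist[OF c fp pv] by blast
  next
    case False
    then have a: "attr_fix (finv f) p" using p by simp
    then obtain v where v: "attr (finv f) v" "p \<in> cone v" by (auto simp: attr_fix_def)
    have pv: "p = v @- sconst False" by (rule left[OF _ v]) (simp add: finv_fix_iff[OF bf])
    obtain d where d: "offset (finv f) (finv g) h p d"
      using offset_exists[OF intertwines_finv[OF c] a] by blast
    have "finv f p = p" using fp by (simp add: finv_fix_iff[OF bf])
    from offset_twist_at[OF intertwines_finv[OF c] this pv v(1) d, of d]
    have "offset (finv f) (finv g) (twist f h p (- d)) p 0"
      using twist_finv[OF bf, of h p "- d"] by simp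
    then have "bnd f g (twist f h p (- d)) p"
      using disj a by (auto simp: bnd_def)
    then show ?thesis using intertwines_twist[OF c fp pv] by blast
  qed
qed

text \<open>By \<open>rank_step\<close>, ranks increase strictly along these fixed points, so each
  rank occurs at most once and the induction treats the points from left to right. If an interval
  without fixed points ends at \<open>p\<close>, the offset is controlled by the preceding point;
  otherwise a twist at \<open>p\<close> is possible, and it does not affect the points already
  treated.\<close>

lemma bounded_offsets_upto:
  assumes c: "intertwines f g h"
  shows "\<exists>h'. intertwines f g h' \<and>
    (\<forall>p. attr_fix f p \<or> attr_fix (finv f) p \<longrightarrow> rank f p < n \<longrightarrow> bnd f g h' p)"
proof (induction n)
  case (Suc n)
  then obtain h where c: "intertwines f g h"
    and IH: "\<And>p. attr_fix f p \<or> attr_fix (finv f) p \<Longrightarrow> rank f p < n \<Longrightarrow> bnd f g h p" by blast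
  have f: "dyadic f" using c by (simp add: intertwines_def)
  note bf = dyadic_bij[OF f]
  have fx: "f z = z" if "attr_fix f z \<or> attr_fix (finv f) z" for z
    using that by (auto simp: attr_fix_def finv_fix_iff[OF bf])
  have rk: "rank f q < rank f p"
    if "q < p" "attr_fix f q \<or> attr_fix (finv f) q" "attr_fix f p \<or> attr_fix (finv f) p" for p q
    using rank_step[OF f that(1) fx[OF that(3)] that(2)] by simp
  show ?case
  proof (cases "\<exists>p. (attr_fix f p \<or> attr_fix (finv f) p) \<and> rank f p = n")
    case True
    then obtain p where p: "attr_fix f p \<or> attr_fix (finv f) p" "rank f p = n" by blast
    have prev: "q < p" if "attr_fix f q \<or> attr_fix (finv f) q" "rank f q < n" for q
      using rk[of p q] that p by (metis less_asym less_irrefl linorder_neqE)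
    have only: "q = p" if "attr_fix f q \<or> attr_fix (finv f) q" "rank f q = n" for q
      using rk[of p q] rk[of q p] that p by (metis less_irrefl linorder_neqE)
    show ?thesis
    proof (cases "\<exists>x<p. \<forall>z. x \<le> z \<longrightarrow> z < p \<longrightarrow> f z \<noteq> z")
      case True
      then obtain x where x: "x < p" "\<And>z. x \<le> z \<Longrightarrow> z < p \<Longrightarrow> f z \<noteq> z" by blast
      have "bnd f g h p"
        by (rule bnd_step[OF c p(1) x]) (use IH rk p in auto)
      then show ?thesis
        using c IH only by (intro exI[of _ h]) (auto simp: less_Suc_eq)
    next
      case False
      then have nofree: "\<And>x. x < p \<Longrightarrow> \<exists>z. x \<le> z \<and> z < p \<and> f z = z" by blast
      obtain k where k: "intertwines f g (twist f h p k)" "bnd f g (twist f h p k) p"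
        using bnd_twist_exists[OF c p(1) nofree] by blast
      have "bnd f g (twist f h p k) q" if "attr_fix f q \<or> attr_fix (finv f) q" "rank f q < n" for q
        using bnd_twist_left[OF c fx[OF p(1)] fx[OF that(1)] prev[OF that] IH[OF that]] .
      then show ?thesis
        using k only by (intro exI[of _ "twist f h p k"]) (auto simp: less_Suc_eq)
    qed
  qed (use c IH in \<open>auto simp: less_Suc_eq\<close>)
qed (use c in auto)

text \<open>A contracting cone is mapped into itself, so once a point has entered it at some time
  \<open>d\<close> with \<open>d \<le> K\<close>, it is there at time \<open>K\<close> as
  well.\<close>

lemma bounded_entry_times:
  assumes c: "intertwines f g h" and K: "int (card (leaf f) + card (leaf g)) \<le> K"
  shows "\<exists>h'. intertwines f g h' \<and>
    (\<forall>v. attr f v \<longrightarrow> (\<exists>v'. attr g v' \<and> (\<forall>x\<in>cone v. zpow g K (h' x) \<in> cone v'))) \<and>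
    (\<forall>v. attr (finv f) v \<longrightarrow> (\<exists>v'. attr (finv g) v' \<and> (\<forall>x\<in>cone v. zpow (finv g) K (h' x) \<in> cone v')))"
proof -
  obtain h' where c': "intertwines f g h'"
    and b: "\<And>p. attr_fix f p \<or> attr_fix (finv f) p \<Longrightarrow> rank f p < Suc (card (leaf f)) \<Longrightarrow> bnd f g h' p"
    using bounded_offsets_upto[OF c, of "Suc (card (leaf f))"] by blast
  have f: "dyadic f" and g: "dyadic g" using c by (auto simp: intertwines_def)
  have R: "int (rank f p + rank g q) \<le> K" for p q
    using rank_le[OF f, of p] rank_le[OF g, of q] K by linarith
  have bn: "bnd f g h' p" if "attr_fix f p \<or> attr_fix (finv f) p" for p
    using b[OF that] rank_le[OF f, of p] by simp
  have *: "\<exists>v'. attr G v' \<and> (\<forall>x\<in>cone v. zpow G K (h' x) \<in> cone v')"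
    if G: "dyadic G" and v: "attr F v"
      and o: "\<And>p. attr_fix F p \<Longrightarrow> \<exists>d. offset F G h' p d \<and> \<bar>d\<bar> \<le> K" for F G v
  proof -
    obtain p where p: "p \<in> cone v" "F p = p" using attr_fix_exists[OF v] by blast
    then obtain d where d: "offset F G h' p d" "\<bar>d\<bar> \<le> K" using o[of p] v by (auto simp: attr_fix_def)
    then obtain v0 v' where v0: "attr F v0" "attr G v'" "p \<in> cone v0" "off G h' v0 v' d"
      by (auto simp: offset_def)
    have "v0 = v" using leaf_unique[OF attr_leaf[OF v0(1)] attr_leaf[OF v]] v0(3) p(1) by blast
    then have "zpow G d (h' x) \<in> cone v'" if "x \<in> cone v" for x using v0(4) that by (auto simp: off_def)
    then show ?thesis using attr_zpow[OF G v0(2)] d(2) v0(2) by (intro exI[of _ v']) (auto simp: abs_le_iff)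
  qed
  have "\<exists>d. offset f g h' p d \<and> \<bar>d\<bar> \<le> K" if "attr_fix f p" for p
    using bn[of p] that R[of p "h' p"] unfolding bnd_def by (meson order_trans)
  moreover have "\<exists>d. offset (finv f) (finv g) h' p d \<and> \<bar>d\<bar> \<le> K" if "attr_fix (finv f) p" for p
    using bn[of p] that R[of p "h' p"] unfolding bnd_def by (meson order_trans)
  ultimately show ?thesis
    using c' *[OF g] *[OF dyadic_inv[OF g]] by blast
qed

section \<open>The region where the map is the identity\<close>

lemma cone_disjoint_less:
  assumes "cone v \<inter> cone w = {}" "v @- sconst False \<le> w @- sconst False" "x \<in> cone v" "y \<in> cone w"
  shows "x < y"
proof (rule ccontr)
  assume "\<not> x < y"
  then have "y \<le> x" by simp
  have "w @- sconst False \<le> y" using assms(4) sconst_False_le by (auto simp: cone_def)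
  then have "w @- sconst False \<in> cone v"
    using cone_convex[OF shift_in_cone assms(3)] assms(2) \<open>y \<le> x\<close> by (meson order_trans)
  then show False using assms(1) by auto
qed

lemma piecewise_step:
  assumes "strict_mono_on B \<phi>" "\<phi> ` B = C" "\<forall>x\<in>cone v. \<forall>y\<in>B. x < y" "\<forall>x\<in>cone w. \<forall>y\<in>C. x < y"
  shows "\<exists>\<psi>. strict_mono_on (cone v \<union> B) \<psi> \<and> \<psi> ` (cone v \<union> B) = cone w \<union> C \<and> lin \<psi> v w \<and>
    (\<forall>x\<in>B. \<psi> x = \<phi> x)"
proof -
  define \<psi> where "\<psi> x = (if x \<in> cone v then w @- sdrop (length v) x else \<phi> x)" for x
  have l: "lin \<psi> v w" by (simp add: lin_def \<psi>_def sdrop_shift)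
  have B: "\<psi> x = \<phi> x" if "x \<in> B" for x
    using assms(3) that by (auto simp: \<psi>_def)
  have "strict_mono_on (cone v \<union> B) \<psi>"
  proof (rule strict_mono_onI)
    fix x y assume xy: "x \<in> cone v \<union> B" "y \<in> cone v \<union> B" "x < y"
    consider "x \<in> cone v" "y \<in> cone v" | "x \<in> cone v" "y \<in> B" | "x \<in> B" "y \<in> B"
      using xy assms(3) by (auto dest: less_asym)
    then show "\<psi> x < \<psi> y"
    proof cases
      case 1
      then show ?thesis using xy(3) l by (auto simp: lin_def cone_def)
    next
      case 2
      then show ?thesis using lin_in_cone[OF l] assms(2,4) B by auto
    next
      case 3
      then show ?thesis using strict_mono_onD[OF assms(1)] xy(3) B by auto
    qed
  qed
  moreover have "\<psi> ` (cone v \<union> B) = cone w \<union> C"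
    using lin_image_cone[OF l] B assms(2) by (simp add: image_Un cong: image_cong)
  ultimately show ?thesis using l B by blast
qed

lemma cone_split: "cone w = cone (w @ [False]) \<union> cone (w @ [True])"
proof
  show "cone w \<subseteq> cone (w @ [False]) \<union> cone (w @ [True])"
  proof
    fix x assume "x \<in> cone w"
    then obtain s where "x = w @- s" by (rule in_coneE)
    then have "x = (w @ [shd s]) @- stl s" by simp
    then show "x \<in> cone (w @ [False]) \<union> cone (w @ [True])"
      by (metis (full_types) UnI1 UnI2 shift_in_cone)
  qed
qed (use cone_append_subset in blast)

definition first_cone :: "bool list set \<Rightarrow> bool list \<Rightarrow> bool list set \<Rightarrow> bool" where
  "first_cone V v V' \<longleftrightarrow> \<Union>(cone ` V) = cone v \<union> \<Union>(cone ` V') \<and>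
    (\<forall>x\<in>cone v. \<forall>y\<in>\<Union>(cone ` V'). x < y)"

lemma first_cone_exists:
  assumes "finite V" "V \<noteq> {}" and disj: "\<forall>v\<in>V. \<forall>w\<in>V. v \<noteq> w \<longrightarrow> cone v \<inter> cone w = {}"
  shows "\<exists>p\<in>V. first_cone V p (V - {p})"
proof -
  let ?k = "\<lambda>v. v @- sconst False"
  have "Min (?k ` V) \<in> ?k ` V" using assms by (intro Min_in) auto
  then obtain p where p: "p \<in> V" "?k p = Min (?k ` V)" by auto
  have "x < y" if "x \<in> cone p" "w \<in> V - {p}" "y \<in> cone w" for x y w
  proof (rule cone_disjoint_less[OF _ _ that(1,3)])
    show "cone p \<inter> cone w = {}" using disj p that by blast
    show "?k p \<le> ?k w" using p that assms(1) by (auto intro: Min_le)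
  qed
  then show ?thesis using p(1) unfolding first_cone_def by blast
qed

lemma first_cone_halves: "first_cone {p} (p @ [False]) {p @ [True]}"
  unfolding first_cone_def using cone_split[of p] by (auto simp: cone_def)

text \<open>Proceeding from left to right, one cone is mapped onto one cone, until on one side a single cone
  is left, from which halves are split off.  Only the nodes so split in the domain are breaks.\<close>

lemma few_breaks:
  assumes "finite V" "finite W" "V = {} \<longleftrightarrow> W = {}"
    and "\<forall>v\<in>V. \<forall>w\<in>V. v \<noteq> w \<longrightarrow> cone v \<inter> cone w = {}"
    and "\<forall>v\<in>W. \<forall>w\<in>W. v \<noteq> w \<longrightarrow> cone v \<inter> cone w = {}"
  shows "\<exists>\<phi>. strict_mono_on (\<Union>(cone ` V)) \<phi> \<and> \<phi> ` \<Union>(cone ` V) = \<Union>(cone ` W) \<and>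
    finite {b \<in> brk \<phi>. \<exists>v\<in>V. prefix v b} \<and> card {b \<in> brk \<phi>. \<exists>v\<in>V. prefix v b} \<le> card W"
  using assms
proof (induction "card V + card W" arbitrary: V W rule: less_induct)
  case less
  show ?case
  proof (cases "V = {}")
    case True
    then show ?thesis using less.prems(3) by (intro exI[of _ id]) (auto simp: monotone_on_def)
  next
    case False
    obtain p where p: "p \<in> V" "first_cone V p (V - {p})"
      using first_cone_exists[OF less.prems(1) False less.prems(4)] by blast
    obtain q where q: "q \<in> W" "first_cone W q (W - {q})"
      using first_cone_exists[OF less.prems(2) _ less.prems(5)] less.prems(3) False by blast
    \<comment> \<open>If one cone is left in the domain but several in the range, the domain cone is
      halved. Its word is the only new break, charged to the range cone that is removed in the same
      round. Halving in the range creates no break.\<close>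
    let ?A = "V = {p} \<and> W \<noteq> {q}" and ?B = "W = {q} \<and> V \<noteq> {p}"
    define v V' where "v = (if ?A then p @ [False] else p)" and "V' = (if ?A then {p @ [True]} else V - {p})"
    define w W' where "w = (if ?B then q @ [False] else q)" and "W' = (if ?B then {q @ [True]} else W - {q})"
    have V: "first_cone V v V'" using p(2) first_cone_halves[of p] by (auto simp: v_def V'_def)
    have W: "first_cone W w W'" using q(2) first_cone_halves[of q] by (auto simp: w_def W'_def)
    have lt: "card (V - {p}) < card V" "card (W - {q}) < card W"
      by (rule card_Diff1_less[OF less.prems(1) p(1)], rule card_Diff1_less[OF less.prems(2) q(1)])
    have cards: "card V' + card W' < card V + card W" "(if ?A then 1 else 0) + card W' \<le> card W"
      using lt by (auto simp: V'_def W'_def)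
    have ne: "V' = {} \<longleftrightarrow> W' = {}" using p(1) q(1) by (auto simp: V'_def W'_def)
    have fin': "finite V'" "finite W'" using less.prems by (auto simp: V'_def W'_def)
    have dV: "\<forall>v\<in>V'. \<forall>w\<in>V'. v \<noteq> w \<longrightarrow> cone v \<inter> cone w = {}"
      using less.prems(4) by (auto simp: V'_def)
    have dW: "\<forall>v\<in>W'. \<forall>w\<in>W'. v \<noteq> w \<longrightarrow> cone v \<inter> cone w = {}"
      using less.prems(5) by (auto simp: W'_def)
    obtain \<phi> where \<phi>: "strict_mono_on (\<Union>(cone ` V')) \<phi>" "\<phi> ` \<Union>(cone ` V') = \<Union>(cone ` W')"
      "finite {b \<in> brk \<phi>. \<exists>v\<in>V'. prefix v b}" "card {b \<in> brk \<phi>. \<exists>v\<in>V'. prefix v b} \<le> card W'"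
      using less.hyps[OF cards(1) fin' ne dV dW] by (elim exE conjE) (rule that; assumption)
    obtain \<psi> where \<psi>: "strict_mono_on (cone v \<union> \<Union>(cone ` V')) \<psi>"
      "\<psi> ` (cone v \<union> \<Union>(cone ` V')) = cone w \<union> \<Union>(cone ` W')"
      "lin \<psi> v w" "\<forall>x\<in>\<Union>(cone ` V'). \<psi> x = \<phi> x"
      using piecewise_step[OF \<phi>(1,2) V[unfolded first_cone_def, THEN conjunct2]
          W[unfolded first_cone_def, THEN conjunct2]] by (elim conjE exE) (rule that; assumption)
    have sub: "{b \<in> brk \<psi>. \<exists>v\<in>V. prefix v b} \<subseteq> (if ?A then {p} else {}) \<union> {b \<in> brk \<phi>. \<exists>v\<in>V'. prefix v b}"
    proof
      fix b assume "b \<in> {b \<in> brk \<psi>. \<exists>v\<in>V. prefix v b}"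
      then obtain a where b: "b \<in> brk \<psi>" "prefix a b" "a \<in> V" by blast
      have "?A \<and> b = p \<or> prefix v b \<or> (\<exists>v'\<in>V'. prefix v' b)"
      proof (cases ?A)
        case True
        obtain z where z: "b = p @ z" using b(2,3) True by (auto simp: prefix_def)
        have "z = [] \<or> (\<exists>z'. z = False # z') \<or> (\<exists>z'. z = True # z')"
          by (metis (full_types) neq_Nil_conv)
        then show ?thesis using True by (auto simp: v_def V'_def z)
      next
        case False
        then have "v = p" "V' = V - {p}" by (simp_all only: v_def V'_def if_False)
        then show ?thesis using b(2,3) by blast
      qed
      moreover have "\<not> prefix v b" using b(1) \<psi>(3) not_brkI brk_prefix by blast
      moreover have "b \<in> brk \<phi>" if v': "v' \<in> V'" "prefix v' b" for v'
      proof -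
        have "\<psi> (b @- s) = \<phi> (b @- s)" for s
          using \<psi>(4) v'(1) cone_mono[OF v'(2)] shift_in_cone[of b s] by blast
        then show ?thesis using b(1) by (simp add: brk_def lin_def)
      qed
      ultimately show "b \<in> (if ?A then {p} else {}) \<union> {b \<in> brk \<phi>. \<exists>v\<in>V'. prefix v b}" by auto
    qed
    have fin: "finite ((if ?A then {p} else {}) \<union> {b \<in> brk \<phi>. \<exists>v\<in>V'. prefix v b})" using \<phi>(3) by simp
    have "card {b \<in> brk \<psi>. \<exists>v\<in>V. prefix v b} \<le> (if ?A then 1 else 0) + card {b \<in> brk \<phi>. \<exists>v\<in>V'. prefix v b}"
      using card_mono[OF fin sub] card_Un_le[of "if ?A then {p} else {}" "{b \<in> brk \<phi>. \<exists>v\<in>V'. prefix v b}"]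
      by (cases ?A) simp_all
    then have "card {b \<in> brk \<psi>. \<exists>v\<in>V. prefix v b} \<le> card W" using \<phi>(4) cards(2) by linarith
    moreover have "finite {b \<in> brk \<psi>. \<exists>v\<in>V. prefix v b}" using finite_subset[OF sub fin] .
    moreover have "\<Union>(cone ` V) = cone v \<union> \<Union>(cone ` V')" "\<Union>(cone ` W) = cone w \<union> \<Union>(cone ` W')"
      using V W by (simp_all only: first_cone_def)
    ultimately show ?thesis using \<psi>(1,2) by (intro exI[of _ \<psi>]) (simp only: simp_thms)
  qed
qed

section \<open>The interior of the fixed point set and its components\<close>

definition idreg :: "selfmap \<Rightarrow> bool stream set" where
  "idreg f = {x. \<exists>v. x \<in> cone v \<and> lin f v v}"

lemma idreg_leaf:
  assumes "finite (brk f)" "x \<in> idreg f"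
  shows "\<exists>v\<in>leaf f. lin f v v \<and> x \<in> cone v"
proof -
  obtain w where w: "x \<in> cone w" "lin f w w" using assms by (auto simp: idreg_def)
  obtain v where v: "v \<in> leaf f" "prefix v w"
    using leaf_prefix_exists[OF assms(1) not_brkI[OF w(2)]] by blast
  obtain z where z: "w = v @ z" using v(2) by (auto simp: prefix_def)
  obtain v' where v': "lin f v v'" using leaf_lin v(1) by blast
  have "v' @ z = v @ z" using lin_unique[OF lin_append[OF v', of z]] w(2) unfolding z .
  then have "v' = v" by simp
  then show ?thesis using v v' cone_mono[OF v(2)] w(1) by blast
qed

lemma idreg_leaf_iff:
  assumes "finite (brk f)" "v \<in> leaf f" "x \<in> cone v"
  shows "x \<in> idreg f \<longleftrightarrow> lin f v v"
  using idreg_leaf[OF assms(1)] leaf_unique[OF assms(2) _ assms(3)] assms(3) by (auto simp: idreg_def)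

lemma idreg_fixed: "x \<in> idreg f \<Longrightarrow> f x = x"
  by (auto simp: idreg_def lin_def cone_def)

lemma idreg_finv: "bij f \<Longrightarrow> idreg (finv f) = idreg f"
  by (simp add: idreg_def lin_inv_iff)

lemma stake_not_brk:
  assumes "finite (brk f)" shows "\<exists>m\<ge>n. stake m x \<notin> brk f"
proof (rule ccontr)
  assume "\<not> ?thesis"
  then have "(\<lambda>m. stake m x) ` {n..} \<subseteq> brk f" by auto
  moreover have "inj_on (\<lambda>m. stake m x) {n..}" by (rule inj_onI) (metis length_stake)
  ultimately show False using assms infinite_Ici by (meson finite_imageD finite_subset)
qed

lemma idreg_intertwines_imp:
  assumes c: "intertwines f g h" and x: "x \<in> idreg f" shows "h x \<in> idreg g"
proof -
  have h: "dyadic h" and hfg: "\<And>x. h (f x) = g (h x)" using c by (auto simp: intertwines_def)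
  obtain v where v: "x \<in> cone v" "lin f v v" using x by (auto simp: idreg_def)
  obtain m where m: "m \<ge> length v" "stake m x \<notin> brk h"
    using stake_not_brk[OF dyadic_finite[OF h]] by blast
  have "x \<in> cone (stake m x)" by (simp add: in_cone_iff)
  then have "prefix v (stake m x)" using cone_nested_length[OF v(1)] m(1) by simp
  then have l: "lin f (stake m x) (stake m x)" using lin_append[OF v(2)] by (auto simp: prefix_def)
  obtain w where w: "lin h (stake m x) w" using m(2) by (rule not_brkE)
  have "lin g w w" using l w hfg unfolding lin_def by metis
  then show ?thesis using lin_in_cone[OF w \<open>x \<in> cone (stake m x)\<close>] by (auto simp: idreg_def)
qed

lemma intertwines_sym: assumes "intertwines f g h" shows "intertwines g f (finv h)"
proof -
  have b: "bij h" and hfg: "\<And>x. h (f x) = g (h x)" using assms by (auto simp: intertwines_def dyadic_bij)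
  have "finv h (g x) = f (finv h x)" for x
    using hfg[of "finv h x"] b by (metis bij_inv_eq_iff)
  then show ?thesis using assms by (simp add: intertwines_def dyadic_inv)
qed

lemma idreg_intertwines: assumes c: "intertwines f g h" shows "h x \<in> idreg g \<longleftrightarrow> x \<in> idreg f"
proof -
  have b: "bij h" using c by (simp add: intertwines_def dyadic_bij)
  then have "finv h (h x) = x" by (simp add: bij_is_inj)
  then show ?thesis using idreg_intertwines_imp[OF c, of x] idreg_intertwines_imp[OF intertwines_sym[OF c], of "h x"] by auto
qed

text \<open>Outside the region the class is a singleton, so that the classes partition all sequences
  into convex sets, as \<open>dyadic_paste\<close> requires.\<close>

definition idcomp :: "selfmap \<Rightarrow> bool stream \<Rightarrow> bool stream set" where
  "idcomp f x = (if x \<in> idreg f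
    then {y. \<forall>z. min x y \<le> z \<and> z \<le> max x y \<longrightarrow> z \<in> idreg f} else {x})"

lemma idcomp_refl: "x \<in> idcomp f x"
  by (auto simp: idcomp_def)

lemma idcomp_subset: "x \<in> idreg f \<Longrightarrow> idcomp f x \<subseteq> idreg f"
  by (auto simp: idcomp_def)

lemma between_trans:
  fixes x y z w :: "'a :: linorder"
  assumes "min x z \<le> w" "w \<le> max x z"
  shows "min x y \<le> w \<and> w \<le> max x y \<or> min y z \<le> w \<and> w \<le> max y z"
  using assms by (auto simp: min_def max_def split: if_splits)

lemma idcomp_sym: "y \<in> idcomp f x \<Longrightarrow> x \<in> idcomp f y"
  by (auto simp: idcomp_def min.commute max.commute split: if_splits)

lemma idcomp_trans: "y \<in> idcomp f x \<Longrightarrow> z \<in> idcomp f y \<Longrightarrow> z \<in> idcomp f x"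
  using between_trans[of x z _ y] by (auto simp: idcomp_def split: if_splits)

lemma idcomp_eq: "y \<in> idcomp f x \<Longrightarrow> idcomp f y = idcomp f x"
  using idcomp_sym idcomp_trans by blast

lemma idcomp_convex: "z \<in> idcomp f x \<Longrightarrow> x \<le> y \<Longrightarrow> y \<le> z \<Longrightarrow> y \<in> idcomp f x"
  by (auto simp: idcomp_def min_def max_def split: if_splits)

lemma idcomp_intertwines_subset: assumes c: "intertwines f g h" shows "h ` idcomp f x \<subseteq> idcomp g (h x)"
proof
  have h: "dyadic h" using c by (auto simp: intertwines_def)
  have mm: "min (h x) (h y) = h (min x y)" "max (h x) (h y) = h (max x y)" for y
    using dyadic_le_iff[OF h] by (auto simp: min_def max_def)
  fix y' assume "y' \<in> h ` idcomp f x"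
  then obtain y where y: "y \<in> idcomp f x" "y' = h y" by blast
  show "y' \<in> idcomp g (h x)"
  proof (cases "x \<in> idreg f")
    case True
    have "z \<in> idreg g" if "min (h x) (h y) \<le> z" "z \<le> max (h x) (h y)" for z
    proof -
      obtain z' where z': "z = h z'" using dyadic_bij[OF h] by (metis bij_is_surj surjD)
      have "z' \<in> idreg f" using that y(1) True by (auto simp: idcomp_def z' mm dyadic_le_iff[OF h])
      then show ?thesis using idreg_intertwines[OF c] z' by simp
    qed
    then show ?thesis using True y(2) idreg_intertwines[OF c] by (simp add: idcomp_def)
  next
    case False
    then show ?thesis using y idreg_intertwines[OF c] by (simp add: idcomp_def)
  qed
qed

lemma idcomp_intertwines: assumes c: "intertwines f g h" shows "h ` idcomp f x = idcomp g (h x)"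
proof
  have b: "bij h" using c by (simp add: intertwines_def dyadic_bij)
  have "finv h ` idcomp g (h x) \<subseteq> idcomp f x"
    using idcomp_intertwines_subset[OF intertwines_sym[OF c], of "h x"] b by (simp add: bij_is_inj)
  then have "h ` finv h ` idcomp g (h x) \<subseteq> h ` idcomp f x" by blast
  then show "idcomp g (h x) \<subseteq> h ` idcomp f x"
    using b by (simp add: image_image bij_is_surj surj_f_inv_f)
qed (rule idcomp_intertwines_subset[OF c])

lemma idcomp_leaves:
  assumes fin: "finite (brk f)" and x: "x \<in> idreg f"
  shows "idcomp f x = \<Union>(cone ` {v \<in> leaf f. cone v \<subseteq> idcomp f x})"
proof -
  have "\<exists>v\<in>leaf f. cone v \<subseteq> idcomp f x \<and> y \<in> cone v" if y: "y \<in> idcomp f x" for y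
  proof -
    have "y \<in> idreg f" using y idcomp_subset[OF x] by blast
    then obtain v where v: "v \<in> leaf f" "lin f v v" "y \<in> cone v" using idreg_leaf[OF fin] by blast
    have "w \<in> idcomp f y" if w: "w \<in> cone v" for w
    proof -
      have "z \<in> cone v" if "min y w \<le> z" "z \<le> max y w" for z
        using that cone_convex[OF v(3) w, of z] cone_convex[OF w v(3), of z]
        by (auto simp: min_def max_def split: if_splits)
      then show ?thesis using v(2) \<open>y \<in> idreg f\<close> by (auto simp: idcomp_def idreg_def)
    qed
    then have "cone v \<subseteq> idcomp f x" using idcomp_eq[OF y] by blast
    then show ?thesis using v by blast
  qed
  then show ?thesis by blast
qed

text \<open>On corresponding components \<open>f\<close> and \<open>g\<close> are the identity, so
  any increasing bijection between them intertwines the two, in particular the one from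
  \<open>few_breaks\<close>. Components are unions of leaves of \<open>f\<close>; summing over
  leaves accounts for all of them.\<close>

lemma few_breaks_on_idreg:
  assumes c: "intertwines f g h"
  shows "\<exists>h'. intertwines f g h' \<and> (\<forall>x. x \<notin> idreg f \<longrightarrow> h' x = h x) \<and>
    card {w \<in> brk h'. lin f w w} \<le> card (leaf f) * card (leaf g)"
proof -
  have f: "dyadic f" and g: "dyadic g" and h: "dyadic h" and hfg: "\<And>x. h (f x) = g (h x)"
    using c by (auto simp: intertwines_def)
  note finf = dyadic_finite[OF f] and fing = dyadic_finite[OF g]
  note lf = card_leaf(1)[OF finf] and lg = card_leaf(1)[OF fing]
  let ?V = "\<lambda>C. {v \<in> leaf f. cone v \<subseteq> C}"
  let ?B = "\<lambda>\<phi> C. {b \<in> brk \<phi>. \<exists>v\<in>?V C. prefix v b}"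
  let ?good = "\<lambda>C \<phi>. strict_mono_on C \<phi> \<and> \<phi> ` C = h ` C \<and> finite (?B \<phi> C) \<and> card (?B \<phi> C) \<le> card (leaf g)"
  have ex: "\<exists>\<phi>. ?good (idcomp f x) \<phi>" if x: "x \<in> idreg f" for x
  proof -
    let ?W = "{w \<in> leaf g. cone w \<subseteq> idcomp g (h x)}"
    have hx: "h x \<in> idreg g" using x idreg_intertwines[OF c] by simp
    have disj: "cone v \<inter> cone w = {}" if "v \<in> leaf F" "w \<in> leaf F" "v \<noteq> w" for v w F
      using leaf_unique[OF that(1,2)] that(3) by blast
    have V: "idcomp f x = \<Union>(cone ` ?V (idcomp f x))" by (rule idcomp_leaves[OF finf x])
    have W: "idcomp g (h x) = \<Union>(cone ` ?W)" by (rule idcomp_leaves[OF fing hx])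
    have ne: "?V (idcomp f x) \<noteq> {}" "?W \<noteq> {}"
      using V W idcomp_refl by (metis (no_types, lifting) Union_empty empty_iff image_empty)+
    have fin': "finite (?V (idcomp f x))" "finite ?W" using lf lg by auto
    have dV: "\<forall>v\<in>?V (idcomp f x). \<forall>w\<in>?V (idcomp f x). v \<noteq> w \<longrightarrow> cone v \<inter> cone w = {}"
      and dW: "\<forall>v\<in>?W. \<forall>w\<in>?W. v \<noteq> w \<longrightarrow> cone v \<inter> cone w = {}"
      using disj by blast+
    have iff: "?V (idcomp f x) = {} \<longleftrightarrow> ?W = {}" using ne by (simp only:)
    obtain \<phi> where "strict_mono_on (\<Union>(cone ` ?V (idcomp f x))) \<phi>"
      "\<phi> ` \<Union>(cone ` ?V (idcomp f x)) = \<Union>(cone ` ?W)"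
      "finite (?B \<phi> (idcomp f x))" "card (?B \<phi> (idcomp f x)) \<le> card ?W"
      using few_breaks[OF fin' iff dV dW] by (elim exE conjE) (rule that; assumption)
    moreover have "card ?W \<le> card (leaf g)" using lg by (intro card_mono) auto
    ultimately show ?thesis
      unfolding idcomp_intertwines[OF c] W[symmetric] V[symmetric] by (intro exI[of _ \<phi>]) auto
  qed
  \<comment> \<open>The choice depends on the component and not on the point, so \<open>h'\<close>
    is a single one of these maps on each component.\<close>
  define \<Phi> where "\<Phi> C = (SOME \<phi>. ?good C \<phi>)" for C
  have \<Phi>: "?good (idcomp f x) (\<Phi> (idcomp f x))" if "x \<in> idreg f" for x
    unfolding \<Phi>_def by (rule someI_ex[OF ex[OF that]])
  define h' where "h' x = (if x \<in> idreg f then \<Phi> (idcomp f x) x else h x)" for x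
  have h'_comp: "h' y = \<Phi> (idcomp f x) y" if "x \<in> idreg f" "y \<in> idcomp f x" for x y
    using that idcomp_eq[OF that(2)] idcomp_subset[OF that(1)] by (auto simp: h'_def)
  have img: "h' ` idcomp f x = h ` idcomp f x" for x
  proof (cases "x \<in> idreg f")
    case True
    then have "h' ` idcomp f x = \<Phi> (idcomp f x) ` idcomp f x"
      using h'_comp by (intro image_cong) auto
    then show ?thesis using \<Phi>[OF True] by simp
  next
    case False
    then show ?thesis by (simp add: idcomp_def h'_def)
  qed
  let ?I = "{v \<in> leaf f. lin f v v}"
  let ?C = "\<lambda>v. idcomp f (v @- sconst False)"
  let ?U = "\<Union>v\<in>?I. ?B (\<Phi> (?C v)) (?C v)"
  have I: "v @- sconst False \<in> idreg f" "cone v \<subseteq> ?C v" if "v \<in> ?I" for v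
  proof -
    show x: "v @- sconst False \<in> idreg f" using that shift_in_cone unfolding idreg_def by blast
    obtain u where "u \<in> leaf f" "cone u \<subseteq> ?C v" "v @- sconst False \<in> cone u"
      using idcomp_leaves[OF finf x] idcomp_refl[of "v @- sconst False" f] by blast
    then show "cone v \<subseteq> ?C v" using leaf_unique[of v f u] that shift_in_cone by blast
  qed
  have key: "w \<in> ?U" if w: "w \<in> brk h'" "v \<in> ?I" "prefix v w" for w v
  proof -
    have "h' (w @- s) = \<Phi> (?C v) (w @- s)" for s
      using h'_comp[OF I(1)[OF w(2)]] I(2)[OF w(2)] cone_mono[OF w(3)] shift_in_cone by blast
    then have "w \<in> brk (\<Phi> (?C v))" using w(1) by (auto simp: brk_def lin_def)
    then show ?thesis using w I(2)[OF w(2)] by blast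
  qed
  have finU: "finite ?U" and cardU: "card ?U \<le> card (leaf f) * card (leaf g)"
  proof -
    show "finite ?U" using lf \<Phi> I(1) by (intro finite_UN_I) auto
    have "card ?U \<le> (\<Sum>v\<in>?I. card (?B (\<Phi> (?C v)) (?C v)))" using lf by (intro card_UN_le) auto
    also have "\<dots> \<le> (\<Sum>v\<in>?I. card (leaf g))" using \<Phi> I(1) by (intro sum_mono) auto
    also have "\<dots> \<le> card (leaf f) * card (leaf g)" using lf by (auto intro!: mult_right_mono card_mono)
    finally show "card ?U \<le> card (leaf f) * card (leaf g)" .
  qed
  have "brk h' \<subseteq> brk f \<union> brk h \<union> ?U"
  proof
    fix w assume w: "w \<in> brk h'"
    show "w \<in> brk f \<union> brk h \<union> ?U"
    proof (cases "w \<in> brk f")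
      case False
      then obtain v where v: "v \<in> leaf f" "prefix v w" using leaf_prefix_exists[OF finf] by blast
      show ?thesis
      proof (cases "lin f v v")
        case True
        then show ?thesis using key[OF w _ v(2)] v(1) by blast
      next
        case nl: False
        have "h' x = h x" if "x \<in> cone w" for x
          using that cone_mono[OF v(2)] idreg_leaf_iff[OF finf v(1)] nl by (auto simp: h'_def)
        then have "w \<in> brk h" using w by (auto simp: brk_def lin_def)
        then show ?thesis by blast
      qed
    qed simp
  qed
  then have fin: "finite (brk h')" using finf dyadic_finite[OF h] finU by (meson finite_UnI finite_subset)
  have "dyadic h'"
  proof (rule dyadic_paste[OF h idcomp_refl idcomp_eq idcomp_convex _ img fin])
    fix x y assume xy: "y \<in> idcomp f x" "x < y"
    then have x: "x \<in> idreg f" by (auto simp: idcomp_def split: if_splits)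
    then show "h' x < h' y"
      using \<Phi>[OF x] xy idcomp_refl[of x f] by (auto simp: h'_comp[OF x] strict_mono_on_def)
  qed
  moreover have "h' (f x) = g (h' x)" for x
  proof (cases "x \<in> idreg f")
    case True
    have "h' x \<in> idcomp g (h x)" using img[of x] idcomp_refl[of x f] idcomp_intertwines[OF c, of x] by blast
    then have "h' x \<in> idreg g" using idcomp_subset[of "h x" g] True idreg_intertwines[OF c] by blast
    then show ?thesis using idreg_fixed True by metis
  next
    case False
    have "intertwines f f f" using f by (simp add: intertwines_def)
    then have "f x \<notin> idreg f" using idreg_intertwines False by blast
    then show ?thesis using False hfg by (simp add: h'_def)
  qed
  moreover have "card {w \<in> brk h'. lin f w w} \<le> card ?U"
  proof (rule card_mono[OF finU], rule subsetI)
    fix w assume "w \<in> {w \<in> brk h'. lin f w w}"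
    then have w: "w \<in> brk h'" "lin f w w" by auto
    obtain v where v: "v \<in> leaf f" "prefix v w"
      using leaf_prefix_exists[OF finf not_brkI[OF w(2)]] by blast
    have "w @- sconst False \<in> idreg f" using w(2) shift_in_cone unfolding idreg_def by blast
    then have "lin f v v" using idreg_leaf_iff[OF finf v(1)] cone_mono[OF v(2)] shift_in_cone by blast
    then show "w \<in> ?U" using key[OF w(1) _ v(2)] v(1) by blast
  qed
  ultimately show ?thesis
    using f g cardU by (intro exI[of _ h']) (auto simp: intertwines_def h'_def)
qed

section \<open>Counting breaks along orbits\<close>

text \<open>After \<open>K\<close> steps the image under \<open>h\<close> lies in the contracting
  cone of \<open>v'\<close>. If \<open>b\<close> were a break of \<open>h\<close>, so would be all
  its forward images: if \<open>h\<close> were linear at the \<open>i\<close>-th one, its image word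
  would extend that of the \<open>i\<close>-th image of \<open>cone v'\<close>, and the
  \<open>i\<close>-th power of \<open>g\<close>, linear on \<open>cone v'\<close>, could be undone.
  But these are infinitely many words.\<close>

lemma attr_phase:
  assumes c: "intertwines f g h" and v: "attr f v" "attr g v'"
    and entry: "\<forall>x\<in>cone v. zpow g (int K) (h x) \<in> cone v'"
    and a: "prefix v a" "lin (f ^^ K) a b"
  shows "b \<notin> brk h"
proof
  assume b: "b \<in> brk h"
  have f: "dyadic f" and g: "dyadic g" and h: "dyadic h" and hfg: "\<And>x. h (f x) = g (h x)"
    using c by (auto simp: intertwines_def)
  obtain z where z: "a = v @ z" using a(1) by (auto simp: prefix_def)
  obtain u where u: "u \<noteq> []" "lin f v (v @ u)" using v(1) by (auto simp: attr_def)
  obtain u' where u': "u' \<noteq> []" "lin g v' (v' @ u')" using v(2) by (auto simp: attr_def)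
  let ?b = "\<lambda>i. v @ concat (replicate (i + K) u) @ z"
  have b0: "b = ?b 0" using lin_unique[OF a(2)] lin_funpow[OF u(2), of K z] z by simp
  have hf: "h ((f ^^ i) x) = (g ^^ i) (h x)" for i x
    using hfg by (induction i) auto
  have step: "lin (f ^^ i) b (?b i)" for i
    using lin_funpow[OF u(2), of i "concat (replicate K u) @ z"] b0
    by (simp add: replicate_add)
  have hb: "h y \<in> cone v'" if y: "y \<in> cone b" for y
  proof -
    obtain s where s: "y = b @- s" using y by (rule in_coneE)
    have "h y = (g ^^ K) (h (a @- s))" using a(2) hf by (simp add: s lin_def flip: hf)
    moreover have "a @- s \<in> cone v" using z by simp
    ultimately show ?thesis using entry by simp
  qed
  have "?b i \<in> brk h" for i
  proof (rule ccontr)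
    assume "?b i \<notin> brk h"
    then obtain w where w: "lin h (?b i) w" by (rule not_brkE)
    let ?v = "v' @ concat (replicate i u')"
    have gl: "lin (g ^^ i) v' ?v" using lin_funpow[OF u'(2), of i "[]"] by simp
    have gw: "(g ^^ i) (h (b @- s)) = w @- s" for s
      using hf[of i "b @- s"] w step[of i] by (simp add: lin_def)
    have "y \<in> cone ?v" if y: "y \<in> cone w" for y
    proof -
      obtain s where s: "y = w @- s" using y by (rule in_coneE)
      have "y = (g ^^ i) (h (b @- s))" by (simp add: s gw)
      then show ?thesis using lin_in_cone[OF gl hb] by simp
    qed
    then have "prefix ?v w" using cone_subset_imp_prefix by blast
    then obtain t where t: "w = ?v @ t" by (auto simp: prefix_def)
    have "h (b @- s) = (v' @ t) @- s" for s
    proof -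
      have "(g ^^ i) (h (b @- s)) = (g ^^ i) ((v' @ t) @- s)"
        using lin_append[OF gl, of t] t by (simp add: gw lin_def)
      then show ?thesis using dyadic_inj[OF dyadic_funpow[OF g, of i]] by (simp add: inj_eq)
    qed
    then have "lin h b (v' @ t)" by (simp add: lin_def)
    then show False using b by (auto simp: brk_def)
  qed
  then have "range ?b \<subseteq> brk h" by blast
  moreover have "inj ?b"
  proof (rule injI)
    fix i j assume "?b i = ?b j"
    then have "length (?b i) = length (?b j)" by (rule arg_cong)
    then show "i = j" using u(1) by (simp add: length_concat sum_list_replicate)
  qed
  ultimately show False using dyadic_finite[OF h] finite_imageD[of ?b UNIV] finite_subset by auto
qed

text \<open>Away from the first and last \<open>K\<close> indices, two members of the chain cannot
  share a leaf of \<open>f\<close>: that leaf would be contracting or expanding, and by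
  \<open>attr_phase\<close> the member \<open>K\<close> steps later or earlier would not be a break
  of \<open>h\<close>. This leaves \<open>card (leaf f) + 1\<close> indices for
  \<open>card (leaf f)\<close> leaves.\<close>

lemma chain_stops:
  assumes c: "intertwines f g h"
    and entry: "\<And>v. attr f v \<Longrightarrow> \<exists>v'. attr g v' \<and> (\<forall>x\<in>cone v. zpow g (int K) (h x) \<in> cone v')"
    and entry': "\<And>v. attr (finv f) v \<Longrightarrow>
      \<exists>v'. attr (finv g) v' \<and> (\<forall>x\<in>cone v. zpow (finv g) (int K) (h x) \<in> cone v')"
    and a: "\<not> lin f a a"
    and chain: "\<And>k. k \<le> 2 * K + card (leaf f) \<Longrightarrow> \<exists>b. lin (f ^^ k) a b \<and> b \<in> brk h \<and> b \<notin> brk f"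
  shows False
proof -
  have f: "dyadic f" using c by (auto simp: intertwines_def)
  note bf = dyadic_bij[OF f]
  let ?L = "2 * K + card (leaf f)"
  obtain A where A: "\<And>k. k \<le> ?L \<Longrightarrow> lin (f ^^ k) a (A k) \<and> A k \<in> brk h \<and> A k \<notin> brk f"
    using chain by metis
  have "\<exists>v. v \<in> leaf f \<and> prefix v (A k)" if "k \<le> ?L" for k
    using leaf_prefix_exists[OF dyadic_finite[OF f]] A[OF that] by blast
  then obtain V where V: "\<And>k. k \<le> ?L \<Longrightarrow> V k \<in> leaf f \<and> prefix (V k) (A k)" by metis
  obtain s where s: "f (a @- s) \<noteq> a @- s" using a by (auto simp: lin_def)
  define x where "x k = zpow f (int k) (a @- s)" for k
  have xA: "x k = A k @- s" if "k \<le> ?L" for k using A[OF that] by (simp add: x_def lin_def)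
  have xV: "x k \<in> cone (V k)" if "k \<le> ?L" for k
    using xA[OF that] cone_mono[of "V k" "A k"] V[OF that] by auto
  have steps: "lin (f ^^ j) (A i) (A (i + j))" if "i + j \<le> ?L" for i j
  proof -
    have "(f ^^ j) (A i @- t) = A (i + j) @- t" for t
    proof -
      have "(f ^^ (j + i)) (a @- t) = A (i + j) @- t"
        using A[OF that] by (simp add: lin_def add.commute)
      moreover have "(f ^^ i) (a @- t) = A i @- t" using A[of i] that by (simp add: lin_def)
      ultimately show ?thesis by (simp add: funpow_add)
    qed
    then show ?thesis by (simp add: lin_def)
  qed
  have "inj_on V {K..?L - K}"
  proof -
    have False if ij: "K \<le> i" "i < j" "j \<le> ?L - K" "V i = V j" for i j
    proof -
      have iL: "i \<le> ?L" "j \<le> ?L" "i + K \<le> ?L" using ij by linarith+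
      have "zpow f (int i + 1) (a @- s) \<in> cone (V i)"
        by (rule zpow_orbit_convex[OF f, of "int i" _ _ "int j"])
           (use xV[OF iL(1)] xV[OF iL(2)] ij in \<open>simp_all add: x_def\<close>)
      then have fx: "f (x i) \<in> cone (V i)" by (simp add: x_def zpow_Suc[OF bf] del: zpow_nat)
      have nf: "f (x i) \<noteq> x i" unfolding x_def zpow_fix_iff[OF bf] by (rule s)
      have Vi: "V i \<in> leaf f" "prefix (V i) (A i)" using V[OF iL(1)] by auto
      show False
        using f Vi(1) xV[OF iL(1)] fx nf
      proof (cases rule: leaf_cases)
        case 1
        then obtain v' where "attr g v'" "\<forall>x\<in>cone (V i). zpow g (int K) (h x) \<in> cone v'"
          using entry by blast
        from attr_phase[OF c 1 this Vi(2) steps[OF iL(3)]] show False using A[OF iL(3)] by blast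
      next
        case (2 w)
        then obtain v' where v': "attr (finv g) v'" "\<forall>x\<in>cone w. zpow (finv g) (int K) (h x) \<in> cone v'"
          using entry' by blast
        have "prefix w (A i)"
          using 2(3) cone_mono[OF Vi(2)] cone_subset_imp_prefix by blast
        moreover have "lin (finv f ^^ K) (A i) (A (i - K))"
        proof -
          have "lin (f ^^ K) (A (i - K)) (A i)" using steps[of "i - K" K] ij iL by simp
          then have "lin (finv (f ^^ K)) (A i) (A (i - K))"
            using lin_inv dyadic_bij[OF dyadic_funpow[OF f]] by blast
          moreover have "finv (f ^^ K) = finv f ^^ K" using bf by (rule inv_fn)
          ultimately show ?thesis by simp
        qed
        ultimately have "A (i - K) \<notin> brk h" by (rule attr_phase[OF intertwines_finv[OF c] 2(1) v'])
        then show False using A[of "i - K"] iL by auto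
      qed
    qed
    then show ?thesis by (auto simp: inj_on_def) (metis linorder_neqE_nat)
  qed
  moreover have "V ` {K..?L - K} \<subseteq> leaf f" using V by auto
  ultimately have "card {K..?L - K} \<le> card (leaf f)"
    using card_leaf(1)[OF dyadic_finite[OF f]] by (intro card_inj_on_le)
  then show False by simp
qed

text \<open>Follow the break \<open>a\<close> under \<open>f\<close> to the first index
  \<open>k\<close> at which the chain ends. Then the \<open>k\<close>-th image is a break of
  \<open>f\<close>, or \<open>h\<close> carries it linearly to a break of \<open>finv g\<close>. The
  index together with this last word determines \<open>a\<close>, whence the product.\<close>

lemma card_moving_breaks:
  assumes c: "intertwines f g h"
    and entry: "\<And>v. attr f v \<Longrightarrow> \<exists>v'. attr g v' \<and> (\<forall>x\<in>cone v. zpow g (int K) (h x) \<in> cone v')"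
    and entry': "\<And>v. attr (finv f) v \<Longrightarrow>
      \<exists>v'. attr (finv g) v' \<and> (\<forall>x\<in>cone v. zpow (finv g) (int K) (h x) \<in> cone v')"
  shows "card {a \<in> brk h. \<not> lin f a a} \<le>
    (2 * K + card (leaf f) + 1) * (card (brk f) + card (brk (finv g)))"
proof -
  have f: "dyadic f" and g: "dyadic g" and h: "dyadic h" and hfg: "\<And>x. h (f x) = g (h x)"
    using c by (auto simp: intertwines_def)
  note bf = dyadic_bij[OF f] and bg = dyadic_bij[OF g]
  let ?L = "2 * K + card (leaf f)"
  let ?P = "\<lambda>k. {a. \<exists>b\<in>brk f. lin (f ^^ k) a b}"
  let ?Q = "\<lambda>k. {a. \<exists>b\<in>brk (finv g). lin (h \<circ> (f ^^ k)) a b}"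
  have sub: "{a \<in> brk h. \<not> lin f a a} \<subseteq> (\<Union>k\<le>?L. ?P k \<union> ?Q k)"
  proof
    fix a assume "a \<in> {a \<in> brk h. \<not> lin f a a}"
    then have a: "a \<in> brk h" "\<not> lin f a a" by auto
    let ?good = "\<lambda>k. \<exists>b. lin (f ^^ k) a b \<and> b \<in> brk h \<and> b \<notin> brk f"
    have "\<exists>k\<le>?L. \<not> ?good k" using chain_stops[OF c entry entry' a(2)] by blast
    then obtain k0 where k0: "k0 \<le> ?L" "\<not> ?good k0" by blast
    define k where "k = (LEAST k. \<not> ?good k)"
    have "k \<le> k0" unfolding k_def by (rule Least_le) (rule k0(2))
    then have k1: "k \<le> ?L" using k0(1) by linarith
    have k2: "\<not> ?good k" unfolding k_def by (rule LeastI) (rule k0(2))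
    note k = k1 k2
    have below: "?good j" if "j < k" for j
      using not_less_Least[of j "\<lambda>k. \<not> ?good k"] that unfolding k_def by blast
    show "a \<in> (\<Union>k\<le>?L. ?P k \<union> ?Q k)"
    proof (cases k)
      case 0
      then have "a \<in> ?P 0" using k(2) a(1) by (auto simp: lin_def)
      then show ?thesis by blast
    next
      case (Suc j)
      then obtain b where b: "lin (f ^^ j) a b" "b \<in> brk h" "b \<notin> brk f" using below[of j] by auto
      obtain w where w: "lin f b w" using b(3) by (rule not_brkE)
      have l: "lin (f ^^ k) a w" using lin_comp[OF b(1) w] by (simp add: Suc comp_def)
      show ?thesis
      proof (cases "w \<in> brk h")
        case True
        then have "a \<in> ?P k" using k(2) l by blast
        then show ?thesis using k(1) by blast
      next
        case False
        then obtain z where z: "lin h w z" by (rule not_brkE)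
        \<comment> \<open>On the cone of \<open>b\<close>, the map \<open>h\<close> is the
          composition of \<open>f\<close>, \<open>h\<close> and \<open>finv g\<close>, of which the
          first two are linear on the way from \<open>b\<close> to \<open>z\<close>.\<close>
        have "z \<in> brk (finv g)"
        proof (rule ccontr)
          assume "z \<notin> brk (finv g)"
          then obtain y where y: "lin (finv g) z y" by (rule not_brkE)
          have "h (b @- s) = y @- s" for s
          proof -
            have "g (h (b @- s)) = z @- s" using w z by (simp add: lin_def flip: hfg)
            then have "h (b @- s) = finv g (z @- s)" using bg by (metis bij_inv_eq_iff)
            then show ?thesis using y by (simp add: lin_def)
          qed
          then show False using b(2) by (auto simp: brk_def lin_def)
        qed
        then have "a \<in> ?Q k" using lin_comp[OF l z] by blast
        then show ?thesis using k(1) by blast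
      qed
    qed
  qed
  have P: "finite (?P k)" "card (?P k) \<le> card (brk f)" for k
    using card_lin_preimage[OF dyadic_inj[OF dyadic_funpow[OF f]] dyadic_finite[OF f]] by auto
  have Q: "finite (?Q k)" "card (?Q k) \<le> card (brk (finv g))" for k
    using card_lin_preimage[OF dyadic_inj[OF dyadic_comp[OF dyadic_funpow[OF f] h]] dyadic_finite[OF dyadic_inv[OF g]]]
    by auto
  have "card {a \<in> brk h. \<not> lin f a a} \<le> card (\<Union>k\<le>?L. ?P k \<union> ?Q k)"
    using sub P(1) Q(1) by (intro card_mono) auto
  also have "\<dots> \<le> (\<Sum>k\<le>?L. card (?P k \<union> ?Q k))" by (rule card_UN_le) simp
  also have "\<dots> \<le> (\<Sum>k\<le>?L. card (brk f) + card (brk (finv g)))"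
    using P(2) Q(2) by (intro sum_mono order_trans[OF card_Un_le] add_mono) auto
  also have "\<dots> = (?L + 1) * (card (brk f) + card (brk (finv g)))" by simp
  finally show ?thesis .
qed

theorem small_conjugator_exists:
  assumes c: "intertwines f g h"
    and N: "card (brk f) \<le> N" "card (brk g) \<le> N" "card (brk (finv g)) \<le> N"
  shows "\<exists>h'. intertwines f g h' \<and> card (brk h') \<le> 26 * (N + 1)\<^sup>2"
proof -
  have f: "dyadic f" and g: "dyadic g" using c by (auto simp: intertwines_def)
  note bf = dyadic_bij[OF f] and bg = dyadic_bij[OF g]
  have M: "card (leaf f) \<le> 2 * (N + 1)" "card (leaf g) \<le> 2 * (N + 1)"
    using card_leaf(2)[OF dyadic_finite[OF f]] card_leaf(2)[OF dyadic_finite[OF g]] N by auto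
  define K where "K = card (leaf f) + card (leaf g)"
  have "int (card (leaf f) + card (leaf g)) \<le> int K" by (simp add: K_def)
  from bounded_entry_times[OF c this] obtain h0 where h0: "intertwines f g h0"
    "\<And>v. attr f v \<Longrightarrow> \<exists>v'. attr g v' \<and> (\<forall>x\<in>cone v. zpow g (int K) (h0 x) \<in> cone v')"
    "\<And>v. attr (finv f) v \<Longrightarrow>
      \<exists>v'. attr (finv g) v' \<and> (\<forall>x\<in>cone v. zpow (finv g) (int K) (h0 x) \<in> cone v')"
    by blast
  obtain h' where h': "intertwines f g h'" "\<And>x. x \<notin> idreg f \<Longrightarrow> h' x = h0 x"
    "card {w \<in> brk h'. lin f w w} \<le> card (leaf f) * card (leaf g)"
    using few_breaks_on_idreg[OF h0(1)] by blast
  \<comment> \<open>Cones of attracting leaves are disjoint from \<open>idreg\<close>, so the entry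
    times obtained for \<open>h0\<close> remain valid for \<open>h'\<close>, which differs from
    \<open>h0\<close> only on that region.\<close>
  have moving: "x \<notin> idreg F" if F: "dyadic F" "attr F v" "x \<in> cone v" for F x v
  proof -
    obtain u where u: "u \<noteq> []" "lin F v (v @ u)" using F(2) by (auto simp: attr_def)
    then have "\<not> lin F v v" using lin_unique by fastforce
    then show ?thesis using idreg_leaf_iff[OF dyadic_finite[OF F(1)] attr_leaf[OF F(2)] F(3)] by simp
  qed
  have e1: "\<exists>v'. attr g v' \<and> (\<forall>x\<in>cone v. zpow g (int K) (h' x) \<in> cone v')" if "attr f v" for v
    using h0(2)[OF that] moving[OF f that] h'(2) by metis
  have e2: "\<exists>v'. attr (finv g) v' \<and> (\<forall>x\<in>cone v. zpow (finv g) (int K) (h' x) \<in> cone v')"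
    if "attr (finv f) v" for v
    using h0(3)[OF that] moving[OF dyadic_inv[OF f] that] h'(2) unfolding idreg_finv[OF bf] by metis
  have "brk h' = {w \<in> brk h'. lin f w w} \<union> {w \<in> brk h'. \<not> lin f w w}" by blast
  then have "card (brk h') = card ({w \<in> brk h'. lin f w w} \<union> {w \<in> brk h'. \<not> lin f w w})"
    by (rule arg_cong)
  also have "\<dots> \<le> card {w \<in> brk h'. lin f w w} + card {w \<in> brk h'. \<not> lin f w w}"
    by (rule card_Un_le)
  also have "\<dots> \<le> card (leaf f) * card (leaf g) +
      (2 * K + card (leaf f) + 1) * (card (brk f) + card (brk (finv g)))"
    using h'(3) card_moving_breaks[OF h'(1) e1 e2] by (rule add_mono)
  \<comment> \<open>Both leaf counts are at most \<open>2 * (N + 1)\<close>, so \<open>K\<close> is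
    at most \<open>4 * (N + 1)\<close> and the first factor of the second product at most
    \<open>(8 + 2 + 1) * (N + 1)\<close>. Altogether \<open>4 + 22 = 26\<close>.\<close>
  also have "\<dots> \<le> (2 * (N + 1)) * (2 * (N + 1)) + (11 * (N + 1)) * (2 * (N + 1))"
    using M N by (intro add_mono mult_mono) (auto simp: K_def)
  also have "\<dots> = 26 * (N + 1)\<^sup>2" by (simp add: power2_eq_square algebra_simps)
  finally show ?thesis using h'(1) by blast
qed

section \<open>The action of the generators\<close>

fun x_map :: "nat \<Rightarrow> bool stream \<Rightarrow> bool stream" where
  "x_map 0 x = (if shd x then True ## x
     else if shd (stl x) then True ## False ## stl (stl x) else stl x)"
| "x_map (Suc n) x = (if shd x then True ## x_map n (stl x) else x)"

fun x_inv :: "nat \<Rightarrow> bool stream \<Rightarrow> bool stream" where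
  "x_inv 0 x = (if shd x then if shd (stl x) then stl x else False ## True ## stl (stl x)
     else False ## x)"
| "x_inv (Suc n) x = (if shd x then True ## x_inv n (stl x) else x)"

lemma x_map_SCons [simp]:
  "x_map 0 (False ## False ## s) = False ## s"
  "x_map 0 (False ## True ## s) = True ## False ## s"
  "x_map 0 (True ## s) = True ## True ## s"
  "x_map (Suc n) (False ## s) = False ## s"
  "x_map (Suc n) (True ## s) = True ## x_map n s"
  by simp_all

lemma x_inv_SCons [simp]:
  "x_inv 0 (False ## s) = False ## False ## s"
  "x_inv 0 (True ## False ## s) = False ## True ## s"
  "x_inv 0 (True ## True ## s) = True ## s"
  "x_inv (Suc n) (False ## s) = False ## s"
  "x_inv (Suc n) (True ## s) = True ## x_inv n s"
  by simp_all

declare x_map.simps [simp del] x_inv.simps [simp del]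

lemma bool_stream_cases:
  obtains s where "x = False ## s" | s where "x = True ## s"
  by (cases x) (metis (full_types))

lemma bool_stream_cases2:
  obtains s where "x = False ## False ## s" | s where "x = False ## True ## s"
    | s where "x = True ## False ## s" | s where "x = True ## True ## s"
  by (metis bool_stream_cases)

lemma x_inv_x_map [simp]: "x_inv n (x_map n x) = x"
proof (induction n arbitrary: x)
  case 0
  show ?case by (cases x rule: bool_stream_cases2) simp_all
next
  case (Suc n)
  then show ?case by (cases x rule: bool_stream_cases) simp_all
qed

lemma x_map_x_inv [simp]: "x_map n (x_inv n x) = x"
proof (induction n arbitrary: x)
  case 0
  show ?case by (cases x rule: bool_stream_cases2) simp_all
next
  case (Suc n)
  then show ?case by (cases x rule: bool_stream_cases) simp_all
qed

lemma bij_x_map: "bij (x_map n)"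
  by (rule bij_betw_byWitness[of _ "x_inv n"]) auto

lemma finv_x_map: "finv (x_map n) = x_inv n"
  by (rule inv_equality) auto

text \<open>Stripping a leading \<open>True\<close> lowers both indices, which reduces the relation
  to \<open>k = 0\<close>. There \<open>x_map 0\<close> carries the cone of 1 to the cone of 11, and
  the action on it moves one level down.\<close>

lemma x_map_relation: "k < n \<Longrightarrow> x_map k (x_map n x) = x_map (Suc n) (x_map k x)"
proof (induction k arbitrary: n x)
  case 0
  then obtain m where "n = Suc m" by (cases n) auto
  then show ?case by (cases x rule: bool_stream_cases2) simp_all
next
  case (Suc k)
  then obtain m where "n = Suc m" "k < m" by (cases n) auto
  then show ?case using Suc.IH by (cases x rule: bool_stream_cases) simp_all
qed

lemma strict_mono_x_map: "strict_mono (x_map n)"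
proof -
  have "x_map n x < x_map n y" if "x < y" for x y
    using that
  proof (induction n arbitrary: x y)
    case 0
    then show ?case
      by (cases x rule: bool_stream_cases2; cases y rule: bool_stream_cases2) auto
  next
    case (Suc n)
    then show ?case
      by (cases x rule: bool_stream_cases; cases y rule: bool_stream_cases) auto
  qed
  then show ?thesis by (simp add: strict_mono_def)
qed

lemma lin_x_map_0:
  "lin (x_map 0) (False # False # w) (False # w)"
  "lin (x_map 0) (False # True # w) (True # False # w)"
  "lin (x_map 0) (True # w) (True # True # w)"
  by (simp_all add: lin_def)

lemma lin_x_map_Suc:
  "lin (x_map (Suc n)) (False # w) (False # w)"
  "lin (x_map n) w w' \<Longrightarrow> lin (x_map (Suc n)) (True # w) (True # w')"
  by (simp_all add: lin_def)

lemma x_map_not_brk: "n + 2 \<le> length w \<Longrightarrow> w \<notin> brk (x_map n)"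
proof (induction n arbitrary: w)
  case 0
  then obtain a b v where w: "w = a # b # v"
    by (metis Suc_le_length_iff add_0 numeral_2_eq_2)
  show ?case by (cases a; cases b) (simp_all add: w lin_x_map_0[THEN not_brkI])
next
  case (Suc n)
  then obtain a v where w: "w = a # v" "n + 2 \<le> length v" by (cases w) auto
  show ?case
    using Suc.IH[OF w(2)]
    by (cases a) (auto simp: w(1) lin_x_map_Suc(1)[THEN not_brkI] elim!: not_brkE
        dest: lin_x_map_Suc(2)[THEN not_brkI])
qed

lemma dyadic_x_map: "dyadic (x_map n)"
proof -
  have "brk (x_map n) \<subseteq> {w. set w \<subseteq> UNIV \<and> length w \<le> n + 2}"
    using x_map_not_brk[of n] by (auto simp: not_le) (metis leI less_imp_le)
  then have "finite (brk (x_map n))"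
    using finite_lists_length_le[of "UNIV :: bool set" "n + 2"] finite_subset by auto
  then show ?thesis
    using strict_mono_x_map bij_x_map by (simp add: dyadic_def bij_is_surj)
qed

lemma dyadic_x_inv: "dyadic (x_inv n)"
  using dyadic_inv[OF dyadic_x_map, of n] by (simp add: finv_x_map)

definition letter_map :: "nat \<times> bool \<Rightarrow> bool stream \<Rightarrow> bool stream" where
  "letter_map l = (if snd l then x_map (fst l) else x_inv (fst l))"

text \<open>Words act from the right: the first letter is applied first.\<close>

fun act :: "nat word \<Rightarrow> bool stream \<Rightarrow> bool stream" where
  "act [] = id"
| "act (l # u) = act u \<circ> letter_map l"

lemma act_append: "act (u @ v) = act v \<circ> act u"
  by (induction u) (auto simp: comp_assoc)

lemma dyadic_act: "dyadic (act u)"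
proof (induction u)
  case (Cons l u)
  have "dyadic (letter_map l)" using dyadic_x_map dyadic_x_inv by (simp add: letter_map_def)
  from dyadic_comp[OF this Cons.IH] show ?case by (simp only: act.simps)
qed (simp only: act.simps dyadic_id)

lemma act_pres_eq: "pres_eq thompson_relations u v \<Longrightarrow> act u = act v"
proof (induction rule: pres_eq.induct)
  case (cancel u x b v)
  have "letter_map (x, \<not> b) \<circ> letter_map (x, b) = id"
    by (cases b) (auto simp: letter_map_def)
  then show ?case by (simp add: act_append comp_assoc)
next
  case (rel l r u v)
  then obtain n k where "l = [(n, True), (k, True)]" "r = [(k, True), (Suc n, True)]" "k < n"
    by (auto simp: thompson_relations_def)
  then have "act l = act r"
    by (simp add: letter_map_def fun_eq_iff x_map_relation)
  then show ?case by (simp add: act_append)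
qed auto

section \<open>Binary trees\<close>

datatype tree = Lf | Nd tree tree

fun leaves :: "tree \<Rightarrow> bool list list" where
  "leaves Lf = [[]]"
| "leaves (Nd a b) = map ((#) False) (leaves a) @ map ((#) True) (leaves b)"

fun nodes :: "tree \<Rightarrow> nat" where
  "nodes Lf = 0"
| "nodes (Nd a b) = Suc (nodes a + nodes b)"

section \<open>Rotations along the right spine\<close>

fun vine :: "nat \<Rightarrow> tree" where
  "vine 0 = Lf"
| "vine (Suc n) = Nd Lf (vine n)"

fun rotatable :: "nat \<Rightarrow> tree \<Rightarrow> bool" where
  "rotatable 0 (Nd (Nd a b) c) = True"
| "rotatable (Suc i) (Nd a t) = rotatable i t"
| "rotatable _ _ = False"

fun rot :: "nat \<Rightarrow> tree \<Rightarrow> tree" where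
  "rot 0 (Nd (Nd a b) c) = Nd a (Nd b c)"
| "rot (Suc i) (Nd a t) = Nd a (rot i t)"
| "rot _ t = t"

text \<open>At the \<open>i\<close>-th vertex of the right spine, \<open>(a b) c\<close> becomes
  \<open>a (b c)\<close>: the prefixes 00, 01, 1 below this vertex are replaced by 0, 10, 11,
  exactly as by \<open>x_map i\<close>, and the leaves further left stay.\<close>

lemma rot_leaves: "rotatable i t \<Longrightarrow> list_all2 (lin (x_map i)) (leaves t) (leaves (rot i t))"
proof (induction i t rule: rotatable.induct)
  case (1 a b c)
  show ?case
    by (auto simp: list_all2_map1 list_all2_map2 lin_x_map_0 comp_def
        intro!: list_all2_appendI list_all2_refl)
next
  case (2 i a t)
  have "list_all2 (lin (x_map (Suc i))) (map ((#) False) (leaves a)) (map ((#) False) (leaves a))"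
    by (simp add: list_all2_map1 list_all2_map2 list_all2_same lin_x_map_Suc(1))
  moreover have "list_all2 (lin (x_map (Suc i))) (map ((#) True) (leaves t)) (map ((#) True) (leaves (rot i t)))"
    using 2 by (auto simp: list_all2_map1 list_all2_map2 lin_x_map_Suc(2) elim!: list_all2_mono)
  ultimately show ?case by (simp add: list_all2_appendI)
qed auto

lemma leaves_inject: "leaves t = leaves t' \<Longrightarrow> t = t'"
proof (induction t arbitrary: t')
  case Lf
  then have "[] \<in> set (leaves t')" by (metis leaves.simps(1) list.set_intros(1))
  then show ?case by (cases t') auto
next
  case (Nd a b)
  have "[] \<notin> set (leaves t')" unfolding Nd.prems[symmetric] by auto
  then obtain c d where t': "t' = Nd c d" by (cases t') auto
  have F: "filter (\<lambda>w. \<not> hd w) (leaves (Nd a b)) = map ((#) False) (leaves a)"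
    "filter hd (leaves (Nd a b)) = map ((#) True) (leaves b)" for a b
    by (auto simp: filter_map comp_def)
  have "map ((#) False) (leaves a) = map ((#) False) (leaves c)"
    "map ((#) True) (leaves b) = map ((#) True) (leaves d)"
    using Nd.prems F by (metis t')+
  then show ?case using Nd.IH t' by (simp add: inj_map_eq_map)
qed

text \<open>The word \<open>pw t\<close> lists the rotations which turn \<open>t\<close> into a vine.\<close>

fun nonvine :: "tree \<Rightarrow> nat" where
  "nonvine Lf = 0"
| "nonvine (Nd a b) = nodes a + nonvine b"

function pw :: "tree \<Rightarrow> nat list" where
  "pw Lf = []"
| "pw (Nd Lf t) = map Suc (pw t)"
| "pw (Nd (Nd a b) c) = 0 # pw (Nd a (Nd b c))"
  by pat_completeness auto
text \<open>\<open>nonvine\<close> counts the inner nodes off the right spine. A rotation at the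
  root moves one of them onto the spine and keeps \<open>nodes\<close>; passing to the right subtree
  lowers \<open>nodes\<close>.\<close>

termination by (relation "measure (\<lambda>t. nodes t + nonvine t)") auto

text \<open>Sortedness makes \<open>pos (pw t)\<close> a positive normal form. Together with the two
  bounds by \<open>nodes t\<close>, it yields a word of linear length in two generators, see
  \<open>len_pos_aux\<close>.\<close>

lemma pw_bounds: "length (pw t) \<le> nodes t" "i \<in> set (pw t) \<Longrightarrow> i < nodes t" "sorted (pw t)"
proof -
  have "length (pw t) = nonvine t" by (induction t rule: pw.induct) auto
  moreover have "nonvine t \<le> nodes t" by (induction t) auto
  ultimately show "length (pw t) \<le> nodes t" by simp
  show "i \<in> set (pw t) \<Longrightarrow> i < nodes t"
    by (induction t arbitrary: i rule: pw.induct) force+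
  show "sorted (pw t)"
    by (induction t rule: pw.induct) (auto simp: sorted_map intro: sorted_wrt_mono_rel)
qed

definition pos :: "nat list \<Rightarrow> nat word" where
  "pos = map (\<lambda>i. (i, True))"

lemma pos_simps [simp]: "pos [] = []" "pos (i # w) = (i, True) # pos w"
  by (simp_all add: pos_def)

abbreviation teq :: "nat word \<Rightarrow> nat word \<Rightarrow> bool" where
  "teq \<equiv> pres_eq thompson_relations"

definition shift_word :: "nat word \<Rightarrow> nat word" where
  "shift_word = map (apfst Suc)"

lemma shift_word_pos: "shift_word (pos w) = pos (map Suc w)"
  by (simp add: shift_word_def pos_def)

lemma teq_shift_word: "teq u v \<Longrightarrow> teq (shift_word u) (shift_word v)"
proof (induction rule: pres_eq.induct)
  case (cancel u x b v)
  then show ?case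
    using pres_eq.cancel[of thompson_relations "shift_word u" "Suc x" b "shift_word v"]
    by (simp add: shift_word_def)
next
  case (rel l r u v)
  then have "(shift_word l, shift_word r) \<in> thompson_relations"
    by (auto simp: thompson_relations_def shift_word_def)
  from pres_eq.rel[OF this, of "shift_word u" "shift_word v"] show ?case
    by (simp add: shift_word_def)
qed (auto intro: pres_eq.intros)

lemma teq_append_left: "teq u v \<Longrightarrow> teq (w @ u) (w @ v)"
  by (rule pres_eq_append[OF pres_eq.refl])

lemma teq_Cons: "teq u v \<Longrightarrow> teq (l # u) (l # v)"
  using teq_append_left[of u v "[l]"] by simp

text \<open>The defining relations express that rotations at different places commute; hence the class of
  \<open>pos (pw t)\<close> does not depend on the order of the rotations.\<close>

lemma pw_rot: "rotatable i t \<Longrightarrow> teq (pos (pw t)) ((i, True) # pos (pw (rot i t)))"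
proof (induction t arbitrary: i rule: pw.induct)
  case (2 t)
  then obtain j where j: "i = Suc j" "rotatable j t" by (cases i) auto
  show ?case
    using teq_shift_word[OF 2(1)[OF j(2)]] j(1) by (simp add: shift_word_def pos_def comp_def)
next
  case (3 a b c)
  show ?case
  proof (cases i)
    case 0
    then show ?thesis by (simp add: pres_eq.refl)
  next
    case (Suc j)
    then have j: "rotatable j c" using 3 by simp
    let ?P = "pos (pw (Nd a (Nd b (rot j c))))"
    have "teq (pos (pw (Nd a (Nd b c)))) ((Suc (Suc j), True) # ?P)"
      using 3(1)[of "Suc (Suc j)"] j by simp
    then have "teq (pos (pw (Nd (Nd a b) c))) ((0, True) # (Suc (Suc j), True) # ?P)"
      using teq_Cons by simp
    moreover have "teq ((Suc j, True) # (0, True) # ?P) ((0, True) # (Suc (Suc j), True) # ?P)"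
      using pres_eq.rel[of "[(Suc j, True), (0, True)]" "[(0, True), (Suc (Suc j), True)]"
          thompson_relations "[]" ?P]
      by (simp add: thompson_relations_def)
    ultimately show ?thesis using Suc by (auto intro: pres_eq.trans pres_eq.sym)
  qed
qed simp

fun step :: "nat \<times> bool \<Rightarrow> tree \<Rightarrow> tree \<Rightarrow> bool" where
  "step (i, True) t s \<longleftrightarrow> rotatable i t \<and> s = rot i t"
| "step (i, False) t s \<longleftrightarrow> rotatable i s \<and> t = rot i s"

fun acts :: "nat word \<Rightarrow> tree \<Rightarrow> tree \<Rightarrow> bool" where
  "acts [] t t' \<longleftrightarrow> t = t'"
| "acts (l # u) t t' \<longleftrightarrow> (\<exists>s. step l t s \<and> acts u s t')"

text \<open>A rotation changes the class of \<open>pos (pw t)\<close> by the letter it realizes.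
  Hence a word leading from a tree back to itself is trivial in the presented group, which is the
  source of faithfulness.\<close>

lemma acts_pw: "acts u t t' \<Longrightarrow> teq (pos (pw t)) (u @ pos (pw t'))"
proof (induction u arbitrary: t)
  case (Cons l u)
  then obtain s where s: "step l t s" "teq (pos (pw s)) (u @ pos (pw t'))" by auto
  obtain i b where l: "l = (i, b)" by force
  show ?case
  proof (cases b)
    case True
    then have "teq (pos (pw t)) (l # pos (pw s))" using pw_rot s(1) l by auto
    then show ?thesis using teq_Cons[OF s(2), of l] by (auto intro: pres_eq.trans)
  next
    case False
    then have "teq (pos (pw s)) ((i, True) # pos (pw t))" using pw_rot s(1) l by auto
    then have "teq (l # pos (pw s)) (l # (i, True) # pos (pw t))" by (rule teq_Cons)
    moreover have "teq (l # (i, True) # pos (pw t)) (pos (pw t))"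
      using pres_eq.cancel[of thompson_relations "[]" i False] l False by simp
    ultimately have "teq (pos (pw t)) (l # pos (pw s))" by (auto intro: pres_eq.trans pres_eq.sym)
    then show ?thesis using teq_Cons[OF s(2), of l] by (auto intro: pres_eq.trans)
  qed
qed (simp add: pres_eq.refl)

lemma step_leaves: "step l t s \<Longrightarrow> list_all2 (lin (letter_map l)) (leaves t) (leaves s)"
proof (induction l t s rule: step.induct)
  case (2 i t s)
  have "lin (x_inv i) w v" if "lin (x_map i) v w" for v w
    using lin_inv[OF bij_x_map that] by (simp add: finv_x_map)
  moreover have "list_all2 (lin (x_map i)) (leaves s) (leaves t)" using rot_leaves 2 by auto
  ultimately show ?case
    by (auto simp: letter_map_def list_all2_conv_all_nth)
qed (simp add: letter_map_def rot_leaves)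

lemma acts_leaves: "acts u t t' \<Longrightarrow> list_all2 (lin (act u)) (leaves t) (leaves t')"
proof (induction u arbitrary: t)
  case Nil
  then show ?case by (auto intro: list_all2_refl simp: lin_def)
next
  case (Cons l u)
  then obtain s where s: "step l t s" "list_all2 (lin (act u)) (leaves s) (leaves t')" by auto
  show ?case
    by (rule list_all2_trans[OF _ step_leaves[OF s(1)] s(2)]) (simp add: lin_def)
qed

section \<open>Deep trees and faithfulness of the action\<close>

fun full :: "nat \<Rightarrow> tree \<Rightarrow> bool" where
  "full 0 t \<longleftrightarrow> True"
| "full (Suc d) Lf \<longleftrightarrow> False"
| "full (Suc d) (Nd a b) \<longleftrightarrow> full d a \<and> full d b"

lemma full_mono: "full d t \<Longrightarrow> d' \<le> d \<Longrightarrow> full d' t"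
proof (induction d t arbitrary: d' rule: full.induct)
  case (3 d a b)
  then show ?case by (cases d') auto
qed auto

lemma full_exists: "\<exists>t. full d t"
proof (induction d)
  case (Suc d)
  then obtain t where "full d t" by blast
  then have "full (Suc d) (Nd t t)" by simp
  then show ?case by blast
qed simp

lemma full_SucE: assumes "full (Suc d) t" obtains a b where "t = Nd a b" "full d a" "full d b"
  using assms by (cases t) auto

text \<open>A rotation in either direction lowers the depth of completeness by at most one. So a
  sufficiently deep tree admits all letters of a given word in succession.\<close>

lemma full_step: "full (Suc d) t \<Longrightarrow> fst l + 2 \<le> Suc d \<Longrightarrow> \<exists>s. step l t s \<and> full d s"
proof -
  have "full (Suc d) t \<Longrightarrow> i + 2 \<le> Suc d \<Longrightarrow> \<exists>s. step (i, b) t s \<and> full d s" for i b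
  proof (induction i arbitrary: d t)
    case 0
    then obtain e where d: "d = Suc e" by (cases d) auto
    obtain a c where t: "t = Nd a c" "full (Suc e) a" "full (Suc e) c"
      using 0 d by (auto elim: full_SucE)
    have m: "full e a" "full e c" using t full_mono[of "Suc e" _ e] by auto
    show ?case
    proof (cases b)
      case True
      obtain a1 a2 where a: "a = Nd a1 a2" "full e a1" "full e a2" using t(2) by (rule full_SucE)
      have "full (e - 1) a2" "full (e - 1) c" using a m full_mono[of e _ "e - 1"] by auto
      then have "full e (Nd a2 c)" by (cases e) auto
      then show ?thesis using True t a d by (intro exI[of _ "Nd a1 (Nd a2 c)"]) auto
    next
      case False
      obtain c1 c2 where c: "c = Nd c1 c2" "full e c1" "full e c2" using t(3) by (rule full_SucE)
      have "full (e - 1) a" "full (e - 1) c1" using c m full_mono[of e _ "e - 1"] by auto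
      then have "full e (Nd a c1)" by (cases e) auto
      then show ?thesis using False t c d by (intro exI[of _ "Nd (Nd a c1) c2"]) auto
    qed
  next
    case (Suc i)
    then obtain e where d: "d = Suc e" "i + 2 \<le> Suc e" by (cases d) auto
    obtain a c where t: "t = Nd a c" "full (Suc e) a" "full (Suc e) c"
      using Suc d by (auto elim: full_SucE)
    obtain s where "step (i, b) c s" "full e s" using Suc.IH[OF t(3) d(2)] by blast
    then show ?case
      using t d full_mono[OF t(2), of e] by (intro exI[of _ "Nd a s"]) (cases b; auto)
  qed
  then show "full (Suc d) t \<Longrightarrow> fst l + 2 \<le> Suc d \<Longrightarrow> \<exists>s. step l t s \<and> full d s"
    by (cases l) auto
qed

lemma acts_exists:
  "full d t \<Longrightarrow> (\<And>l. l \<in> set u \<Longrightarrow> fst l + 2 + length u \<le> d) \<Longrightarrow> \<exists>t'. acts u t t'"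
proof (induction u arbitrary: d t)
  case (Cons l u)
  have "fst l + 2 + Suc (length u) \<le> d" using Cons.prems(2)[of l] by simp
  then obtain e where d: "d = Suc e" "fst l + 2 \<le> Suc e" by (cases d) auto
  obtain s where s: "step l t s" "full e s" using full_step[of e t l] Cons.prems(1) d by auto
  have "\<exists>t'. acts u s t'"
    by (rule Cons.IH[OF s(2)]) (use Cons.prems(2) d(1) in fastforce)
  then show ?case using s(1) by auto
next
  case Nil
  show ?case by (rule exI[of _ t]) simp
qed

text \<open>Let \<open>u\<close> lead from a deep tree \<open>t\<close> to \<open>t'\<close>. It
  carries the leaves of \<open>t\<close> to those of \<open>t'\<close>, so a trivial action forces
  \<open>t = t'\<close>, and \<open>acts_pw\<close> provides a word in front of which
  \<open>u\<close> can be cancelled.\<close>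

lemma act_id_imp_cancel:
  assumes "act u = id" shows "\<exists>w. teq w (u @ w)"
proof -
  define d where "d = Max (insert 0 (fst ` set u)) + 2 + length u"
  obtain t where t: "full d t" using full_exists by blast
  have "fst l \<le> Max (insert 0 (fst ` set u))" if "l \<in> set u" for l
    using that by (intro Max_ge) auto
  then obtain t' where t': "acts u t t'"
    using acts_exists[OF t, of u] by (auto simp: d_def)
  have "list_all2 (=) (leaves t) (leaves t')"
    using acts_leaves[OF t'] unfolding assms by (rule list_all2_mono) simp
  then have "t = t'" using leaves_inject by (simp add: list_all2_eq)
  then show ?thesis using acts_pw[OF t'] by blast
qed

lemma acts_shift: "acts u t t' \<Longrightarrow> acts (shift_word u) (Nd a t) (Nd a t')"
proof (induction u arbitrary: t)
  case (Cons l u)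
  then obtain s where s: "step l t s" "acts u s t'" by auto
  obtain i b where l: "l = (i, b)" by force
  have "step (Suc i, b) (Nd a t) (Nd a s)" using s(1) l by (cases b) auto
  then show ?case using Cons.IH[OF s(2)] l by (auto simp: shift_word_def)
qed (simp add: shift_word_def)

lemma acts_vine: "acts (pos (pw t)) t (vine (nodes t))"
proof (induction t rule: pw.induct)
  case (2 t)
  then show ?case using acts_shift[OF 2, of Lf] by (simp add: shift_word_pos)
qed (auto simp: add.assoc)

section \<open>Tree pairs of dyadic maps\<close>

fun tree_of :: "nat \<Rightarrow> (bool list \<Rightarrow> bool) \<Rightarrow> tree" where
  "tree_of 0 P = Lf"
| "tree_of (Suc d) P = (if P [] then Nd (tree_of d (\<lambda>w. P (False # w))) (tree_of d (\<lambda>w. P (True # w))) else Lf)"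

lemma leaves_tree_of:
  assumes "\<And>v w. P (v @ w) \<Longrightarrow> P v" "\<And>w. P w \<Longrightarrow> length w < d"
  shows "set (leaves (tree_of d P)) = {w. \<not> P w \<and> (w = [] \<or> P (butlast w))}"
  using assms
proof (induction d arbitrary: P)
  case 0
  then show ?case by auto
next
  case (Suc d)
  show ?case
  proof (cases "P []")
    case False
    then have "\<not> P w" for w using Suc.prems(1)[of "[]" w] by auto
    then show ?thesis by auto
  next
    case True
    have IH: "set (leaves (tree_of d (\<lambda>w. P (b # w)))) =
        {w. \<not> P (b # w) \<and> (w = [] \<or> P (b # butlast w))}" for b
    proof (rule Suc.IH)
      show "P (b # v)" if "P (b # (v @ w))" for v w using Suc.prems(1)[of "b # v" w] that by simp
      show "length w < d" if "P (b # w)" for w using Suc.prems(2)[OF that] by simp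
    qed
    have "w \<in> set (leaves (tree_of (Suc d) P)) \<longleftrightarrow> \<not> P w \<and> (w = [] \<or> P (butlast w))" for w
    proof (cases w)
      case Nil
      then show ?thesis using True by auto
    next
      case (Cons b v)
      then show ?thesis using True IH[of b] by (cases b) (auto simp: image_iff)
    qed
    then show ?thesis by blast
  qed
qed

lemma nodes_tree_of:
  assumes "finite {w. P w}" shows "nodes (tree_of d P) \<le> card {w. P w}"
  using assms
proof (induction d arbitrary: P)
  case (Suc d)
  let ?Q = "\<lambda>b. {w. P (b # w)}"
  have fin: "finite (?Q b)" for b
    using finite_vimageI[OF Suc.prems, of "(#) b"] by (simp add: vimage_def)
  show ?case
  proof (cases "P []")
    case True
    have "{w. P w} = insert [] ((#) False ` ?Q False \<union> (#) True ` ?Q True)"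
    proof (rule Set.set_eqI)
      fix w
      show "w \<in> {w. P w} \<longleftrightarrow> w \<in> insert [] ((#) False ` ?Q False \<union> (#) True ` ?Q True)"
      proof (cases w)
        case (Cons b v)
        then show ?thesis by (cases b) (auto simp: image_iff)
      qed (simp add: True)
    qed
    then have "card {w. P w} = Suc (card ((#) False ` ?Q False \<union> (#) True ` ?Q True))"
      using fin by (simp add: card_insert_disjoint image_iff)
    also have "\<dots> = Suc (card (?Q False) + card (?Q True))"
      using fin by (subst card_Un_disjoint) (auto simp: card_image)
    finally show ?thesis using Suc.IH[OF fin, of False] Suc.IH[OF fin, of True] True by simp
  qed simp
qed simp

lemma sorted_leaves: "sorted_wrt (\<lambda>v w. v @- sconst False < w @- sconst False) (leaves t)"
  by (induction t) (auto simp: sorted_wrt_append sorted_wrt_map)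

lemma tree_of_dyadic:
  assumes "dyadic h"
  shows "\<exists>t. set (leaves t) = leaf h \<and> nodes t \<le> card (brk h)"
proof -
  have fin: "finite {w. w \<in> brk h}" using dyadic_finite[OF assms] by simp
  obtain d where d: "\<And>w. w \<in> brk h \<Longrightarrow> length w < d"
    using finite_nat_set_iff_bounded[of "length ` brk h"] dyadic_finite[OF assms] by auto
  have "set (leaves (tree_of d (\<lambda>w. w \<in> brk h))) = leaf h"
    unfolding leaf_def by (rule leaves_tree_of) (use d not_brk_append in blast)+
  then show ?thesis using nodes_tree_of[OF fin, of d] by auto
qed

lemma length_leaves: "length (leaves t) = Suc (nodes t)"
  by (induction t) auto

text \<open>The leaves of \<open>h\<close> correspond bijectively to those of its inverse. Both
  lists are sorted by the left ends of the cones and \<open>h\<close> is increasing, so the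
  correspondence matches equal positions.\<close>

lemma dyadic_tree_pair:
  assumes h: "dyadic h"
  shows "\<exists>t t'. list_all2 (lin h) (leaves t) (leaves t') \<and> set (leaves t) = leaf h \<and>
    nodes t \<le> card (brk h) \<and> nodes t' = nodes t"
proof -
  note b = dyadic_bij[OF h]
  obtain t where t: "set (leaves t) = leaf h" "nodes t \<le> card (brk h)" using tree_of_dyadic[OF h] by blast
  obtain t' where t': "set (leaves t') = leaf (finv h)" using tree_of_dyadic[OF dyadic_inv[OF h]] by blast
  define F where "F v = (THE w. lin h v w)" for v
  have F: "lin h v (F v)" if v: "v \<in> leaf h" for v
  proof -
    obtain w where w: "lin h v w" using v by (rule leaf_lin)
    then show ?thesis unfolding F_def by (rule theI2) (use w lin_unique in blast)+
  qed
  let ?k = "\<lambda>v. v @- sconst False"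
  have img: "F ` leaf h = leaf (finv h)"
  proof
    show "F ` leaf h \<subseteq> leaf (finv h)" using leaf_finv[OF b _ F] by blast
    show "leaf (finv h) \<subseteq> F ` leaf h"
    proof
      fix w assume w: "w \<in> leaf (finv h)"
      obtain v where v: "lin (finv h) w v" using w by (rule leaf_lin)
      have "v \<in> leaf h" using leaf_finv[OF bij_imp_bij_inv[OF b] w v] b by (simp add: inv_inv_eq)
      moreover have "lin h v w" using v b by (simp add: lin_inv_iff)
      ultimately show "w \<in> F ` leaf h" using F lin_unique by blast
    qed
  qed
  have kF: "?k (F v) = h (?k v)" if "v \<in> leaf h" for v using F[OF that] by (simp add: lin_def)
  have s1: "sorted_wrt (<) (map ?k (map F (leaves t)))"
  proof -
    have "sorted_wrt (\<lambda>v w. ?k (F v) < ?k (F w)) (leaves t)"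
      by (rule sorted_wrt_mono_rel[OF _ sorted_leaves]) (simp add: kF t dyadic_less_iff[OF h])
    then show ?thesis by (simp add: sorted_wrt_map)
  qed
  have s2: "sorted_wrt (<) (map ?k (leaves t'))" using sorted_leaves by (simp add: sorted_wrt_map)
  have "map ?k (map F (leaves t)) = map ?k (leaves t')"
    by (rule strict_sorted_equal[OF s2 s1]) (simp only: set_map t(1) t' img)
  moreover have "inj_on ?k (leaf (finv h))"
    by (rule inj_onI) (metis leaf_unique shift_in_cone)
  ultimately have eq: "map F (leaves t) = leaves t'"
    using img t t' by (intro map_inj_on[of ?k]) auto
  have "list_all2 (lin h) (leaves t) (map F (leaves t))"
    using F t(1) by (simp add: list_all2_map2 list_all2_same)
  moreover have "nodes t' = nodes t"
    using arg_cong[OF eq, of length] by (simp add: length_leaves)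
  ultimately show ?thesis using t eq by auto
qed

text \<open>Two trees with equally many nodes are rotated into the same vine. On each leaf, rotating
  \<open>t\<close> therefore agrees with \<open>h\<close> followed by rotating
  \<open>t'\<close>.\<close>

lemma dyadic_word:
  assumes h: "dyadic h"
  shows "\<exists>t t'. nodes t \<le> card (brk h) \<and> nodes t' \<le> card (brk h) \<and>
    (\<forall>x. act (pos (pw t')) (h x) = act (pos (pw t)) x)"
proof -
  obtain t t' where t: "list_all2 (lin h) (leaves t) (leaves t')" "set (leaves t) = leaf h"
    "nodes t \<le> card (brk h)" "nodes t' = nodes t" using dyadic_tree_pair[OF h] by blast
  have v: "list_all2 (lin (act (pos (pw t)))) (leaves t) (leaves (vine (nodes t)))"
    "list_all2 (lin (act (pos (pw t')))) (leaves t') (leaves (vine (nodes t)))"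
    using acts_leaves[OF acts_vine[of t]] acts_leaves[OF acts_vine[of t']] t(4) by simp_all
  have "act (pos (pw t')) (h x) = act (pos (pw t)) x" for x
  proof -
    obtain w where w: "w \<in> leaf h" "x \<in> cone w" using leaf_exists[OF dyadic_finite[OF h]] by blast
    obtain i where i: "i < length (leaves t)" "w = leaves t ! i"
      using w(1) t(2) by (metis in_set_conv_nth)
    obtain s where s: "x = w @- s" using w(2) by (rule in_coneE)
    have "lin h w (leaves t' ! i)" "lin (act (pos (pw t))) w (leaves (vine (nodes t)) ! i)"
      using list_all2_nthD[OF t(1) i(1)] list_all2_nthD[OF v(1) i(1)] i(2) by simp_all
    moreover have "lin (act (pos (pw t'))) (leaves t' ! i) (leaves (vine (nodes t)) ! i)"
      using list_all2_nthD[OF v(2), of i] i(1) list_all2_lengthD[OF t(1)] by simp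
    ultimately show ?thesis by (simp add: lin_def s)
  qed
  then show ?thesis using t(3,4) by (intro exI[of _ t] exI[of _ t']) simp
qed

section \<open>Word length in a finitely generated group\<close>

locale generated_group = group G for G (structure) +
  fixes S
  assumes S_subset: "S \<subseteq> carrier G" and S_generates: "generate G S = carrier G"
begin

abbreviation letters where "letters \<equiv> S \<union> m_inv G ` S"

abbreviation len where "len \<equiv> word_length G S"

abbreviation wprod where "wprod ws \<equiv> foldr (mult G) ws \<one>"

lemma letters_subset: "letters \<subseteq> carrier G"
  using S_subset by auto

lemma wprod_closed: "set ws \<subseteq> letters \<Longrightarrow> wprod ws \<in> carrier G"
  by (induction ws) (use letters_subset in auto)

lemma wprod_append:
  "set us \<subseteq> letters \<Longrightarrow> set vs \<subseteq> letters \<Longrightarrow> wprod (us @ vs) = wprod us \<otimes> wprod vs"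
proof (induction us)
  case (Cons a us)
  then have "a \<in> carrier G" "wprod us \<in> carrier G" "wprod vs \<in> carrier G"
    using letters_subset wprod_closed[of us] wprod_closed[of vs] by auto
  then show ?case using Cons by (simp add: m_assoc)
qed (simp add: wprod_closed)

lemma inv_letter: "a \<in> letters \<Longrightarrow> inv a \<in> letters"
  using S_subset by (auto simp: inv_inv subsetD)

lemma wprod_inv:
  "set ws \<subseteq> letters \<Longrightarrow> wprod (rev (map (m_inv G) ws)) = inv (wprod ws)"
proof (induction ws)
  case (Cons a ws)
  then have a: "a \<in> carrier G" "a \<in> letters" "wprod ws \<in> carrier G"
    using letters_subset wprod_closed[of ws] by auto
  have "set (rev (map (m_inv G) ws)) \<subseteq> letters" "set [inv a] \<subseteq> letters"
    using Cons.prems inv_letter a(2) by (simp_all only: set_rev set_map list.set) blast+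
  from wprod_append[OF this] show ?case
    using Cons a inv_letter letters_subset by (simp add: inv_mult_group)
qed simp

lemma wprod_surj: assumes "g \<in> carrier G" shows "\<exists>ws. set ws \<subseteq> letters \<and> wprod ws = g"
proof -
  have "g \<in> generate G S" using assms S_generates by simp
  then show ?thesis
  proof (induction rule: generate.induct)
    case one
    show ?case by (intro exI[of _ "[]"]) simp
  next
    case (incl h)
    then show ?case using S_subset by (intro exI[of _ "[h]"]) auto
  next
    case (inv h)
    then show ?case using S_subset by (intro exI[of _ "[inv h]"]) auto
  next
    case (eng h1 h2)
    then obtain us vs where "set us \<subseteq> letters" "wprod us = h1" "set vs \<subseteq> letters" "wprod vs = h2"
      by blast
    then show ?case using wprod_append[of us vs] by (intro exI[of _ "us @ vs"]) simp
  qed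
qed

lemma len_le: "set ws \<subseteq> letters \<Longrightarrow> len (wprod ws) \<le> length ws"
  unfolding word_length_def by (rule Least_le) blast

lemma len_attained:
  assumes "g \<in> carrier G" shows "\<exists>ws. set ws \<subseteq> letters \<and> wprod ws = g \<and> length ws = len g"
proof -
  obtain ws where "set ws \<subseteq> letters" "wprod ws = g" using wprod_surj[OF assms] by blast
  then have "\<exists>n ws. length ws = n \<and> set ws \<subseteq> letters \<and> wprod ws = g" by blast
  from LeastI_ex[OF this] show ?thesis unfolding word_length_def by blast
qed

lemma len_mult: assumes "g \<in> carrier G" "h \<in> carrier G" shows "len (g \<otimes> h) \<le> len g + len h"
proof -
  obtain us vs where "set us \<subseteq> letters" "wprod us = g" "length us = len g"
    "set vs \<subseteq> letters" "wprod vs = h" "length vs = len h"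
    using len_attained[OF assms(1)] len_attained[OF assms(2)] by blast
  then show ?thesis using len_le[of "us @ vs"] wprod_append[of us vs] by simp
qed

lemma len_inv_le: assumes "g \<in> carrier G" shows "len (inv g) \<le> len g"
proof -
  obtain us where us: "set us \<subseteq> letters" "wprod us = g" "length us = len g"
    using len_attained[OF assms] by blast
  have "set (rev (map (m_inv G) us)) \<subseteq> letters"
    using us(1) inv_letter by (simp only: set_rev set_map) blast
  from len_le[OF this] show ?thesis using wprod_inv[OF us(1)] us by simp
qed

lemma len_one: "len \<one> = 0"
  using len_le[of "[]"] by simp

lemma len_pow: "g \<in> carrier G \<Longrightarrow> len (g [^] (n :: nat)) \<le> n * len g"
proof (induction n)
  case (Suc n)
  then have "len (g [^] n \<otimes> g) \<le> n * len g + len g"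
    using len_mult[of "g [^] n" g] by simp
  then show ?case by simp
qed (simp add: len_one)

lemma subadditive_le_len:
  fixes \<phi> :: "'a \<Rightarrow> nat"
  assumes sub: "\<And>g h. g \<in> carrier G \<Longrightarrow> h \<in> carrier G \<Longrightarrow> \<phi> (g \<otimes> h) \<le> \<phi> g + \<phi> h"
    and one: "\<phi> \<one> = 0" and C: "\<And>a. a \<in> letters \<Longrightarrow> \<phi> a \<le> C" and g: "g \<in> carrier G"
  shows "\<phi> g \<le> C * len g"
proof -
  obtain ws where ws: "set ws \<subseteq> letters" "wprod ws = g" "length ws = len g"
    using len_attained[OF g] by blast
  have "\<phi> (wprod ws) \<le> C * length ws"
    using ws(1)
  proof (induction ws)
    case (Cons a ws)
    then have "\<phi> (a \<otimes> wprod ws) \<le> \<phi> a + \<phi> (wprod ws)"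
      using letters_subset wprod_closed[of ws] by (intro sub) auto
    moreover have "\<phi> a \<le> C" using C Cons.prems by simp
    ultimately show ?case using Cons by simp
  qed (simp add: one)
  then show ?thesis using ws by simp
qed

end

section \<open>Thompson's group as a group of homeomorphisms\<close>

abbreviation cls :: "nat word \<Rightarrow> nat word set" where
  "cls \<equiv> pres_class thompson_relations"

definition rep :: "nat word set \<Rightarrow> bool stream \<Rightarrow> bool stream" where
  "rep A = act (SOME u. A = cls u)"

lemma rep_cls [simp]: "rep (cls u) = act u"
proof -
  have "cls u = cls (SOME v. cls u = cls v)" by (rule someI[of "\<lambda>v. cls u = cls v"]) simp
  then show ?thesis
    unfolding rep_def using act_pres_eq pres_class_eq_iff by metis
qed

lemma group_thompson: "group thompson_F"
  unfolding thompson_F_def by (rule group_presented_group)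

interpretation group thompson_F by (rule group_thompson)

abbreviation tmult (infixl "\<cdot>" 70) where "g \<cdot> h \<equiv> g \<otimes>\<^bsub>thompson_F\<^esub> h"
abbreviation tpow (infixr "\<up>" 75) where "g \<up> n \<equiv> g [^]\<^bsub>thompson_F\<^esub> (n :: nat)"
abbreviation tinv where "tinv \<equiv> m_inv thompson_F"
abbreviation tone where "tone \<equiv> \<one>\<^bsub>thompson_F\<^esub>"

lemma carrier_thompson: "carrier thompson_F = range cls"
  by (simp add: thompson_F_def presented_group_simps)

lemma mult_cls: "cls u \<cdot> cls v = cls (u @ v)"
  by (simp add: thompson_F_def presented_group_simps)

lemma one_cls: "tone = cls []"
  by (simp add: thompson_F_def presented_group_simps)

lemma carrierE: assumes "A \<in> carrier thompson_F" obtains u where "A = cls u"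
  using assms by (auto simp: carrier_thompson)

lemma rep_mult:
  assumes "A \<in> carrier thompson_F" "B \<in> carrier thompson_F"
  shows "rep (A \<cdot> B) = rep B \<circ> rep A"
  using assms by (auto elim!: carrierE simp: mult_cls act_append)

lemma rep_one: "rep tone = id"
  by (simp only: one_cls rep_cls act.simps)

lemma dyadic_rep: "A \<in> carrier thompson_F \<Longrightarrow> dyadic (rep A)"
  by (auto elim!: carrierE simp: dyadic_act)

lemma rep_inv:
  assumes "A \<in> carrier thompson_F" shows "rep (tinv A) = finv (rep A)"
proof -
  have "rep (tinv A) \<circ> rep A = id" "rep A \<circ> rep (tinv A) = id"
    using rep_mult[of A "tinv A"] rep_mult[of "tinv A" A] assms
    by (simp_all only: r_inv l_inv inv_closed rep_one)
  then show ?thesis by (intro Hilbert_Choice.inv_equality[symmetric]) (simp_all add: fun_eq_iff)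
qed

lemma rep_eq_id:
  assumes "A \<in> carrier thompson_F" "rep A = id" shows "A = tone"
proof -
  obtain u where u: "A = cls u" using assms(1) by (rule carrierE)
  then obtain w where "pres_eq thompson_relations w (u @ w)"
    using act_id_imp_cancel[of u] assms(2) by auto
  then have "cls w = A \<cdot> cls w" by (simp add: u mult_cls pres_class_eq_iff)
  then show ?thesis using r_cancel_one'[of "cls w" A] assms(1) by (simp add: carrier_thompson)
qed

lemma rep_inject:
  assumes "A \<in> carrier thompson_F" "B \<in> carrier thompson_F" "rep A = rep B" shows "A = B"
proof -
  have "rep (A \<cdot> tinv B) = finv (rep B) \<circ> rep B"
    using assms by (simp only: rep_mult inv_closed rep_inv)
  also have "\<dots> = id" using dyadic_inj[OF dyadic_rep[OF assms(2)]] by simp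
  finally have "A \<cdot> tinv B = tone"
    using assms by (intro rep_eq_id) auto
  then show ?thesis using assms(1,2) inv_equality[of A "tinv B"] by simp
qed

text \<open>Words act from the right, so \<open>rep\<close> reverses products: the equation
  \<open>K \<cdot> B = A \<cdot> K\<close> says that applying \<open>rep A\<close> and then
  \<open>rep K\<close> is the same as applying \<open>rep K\<close> and then
  \<open>rep B\<close>.\<close>

lemma conjugate_iff_intertwines:
  assumes "A \<in> carrier thompson_F" "B \<in> carrier thompson_F" "K \<in> carrier thompson_F"
  shows "B = tinv K \<cdot> A \<cdot> K \<longleftrightarrow> intertwines (rep A) (rep B) (rep K)"
proof -
  have "B = tinv K \<cdot> A \<cdot> K \<longleftrightarrow>
      K \<cdot> B = A \<cdot> K"
    using assms inv_solve_left[of B K "A \<cdot> K"] by (auto simp: m_assoc)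
  also have "\<dots> \<longleftrightarrow> rep (K \<cdot> B) = rep (A \<cdot> K)"
    using assms rep_inject by auto
  also have "\<dots> \<longleftrightarrow> (\<forall>x. rep K (rep A x) = rep B (rep K x))"
    using assms by (auto simp: rep_mult fun_eq_iff)
  finally show ?thesis using assms dyadic_rep by (simp add: intertwines_def)
qed

abbreviation gen :: "nat \<Rightarrow> nat word set" where
  "gen i \<equiv> cls [(i, True)]"

lemma gen_relation:
  assumes "k < n"
  shows "gen n \<cdot> gen k = gen k \<cdot> gen (Suc n)"
proof -
  have "([(n, True), (k, True)], [(k, True), (Suc n, True)]) \<in> thompson_relations"
    using assms by (auto simp: thompson_relations_def)
  from pres_eq.rel[OF this, of "[]" "[]"] show ?thesis
    by (simp add: mult_cls pres_class_eq_iff)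
qed

lemma gen_closed [simp]: "cls u \<in> carrier thompson_F"
  by (simp add: carrier_thompson)

section \<open>Short words for sorted products of generators\<close>

lemma gen_conj_pow:
  "gen 0 \<up> m \<cdot> gen (Suc m) = gen 1 \<cdot> gen 0 \<up> m"
  for m :: nat
proof (induction m)
  case 0
  show ?case by simp
next
  case (Suc m)
  let ?p = "gen 0 \<up> m"
  have p: "?p \<in> carrier thompson_F" by simp
  have "?p \<cdot> gen 0 \<cdot> gen (Suc (Suc m)) =
      ?p \<cdot> (gen (Suc m) \<cdot> gen 0)"
    using p by (simp add: m_assoc gen_relation)
  also have "\<dots> = gen 1 \<cdot> (?p \<cdot> gen 0)"
    using p Suc by (simp flip: m_assoc)
  finally show ?case by simp
qed

locale thompson_generated = generated_group thompson_F S for S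
begin

text \<open>Each \<open>gen (Suc m)\<close> is \<open>gen 1\<close> conjugated by the
  \<open>m\<close>-th power of \<open>gen 0\<close>, and for sorted indices the powers between
  neighbours telescope. The exponent \<open>i\<close> is the one reached so far;
  \<open>M - i\<close> pays for the climb that remains and the last \<open>M\<close> for the final
  power.\<close>

lemma len_pos_aux:
  assumes c: "len (gen 0) \<le> c" "len (gen 1) \<le> c"
  shows "sorted ws \<Longrightarrow> (\<And>j. j \<in> set ws \<Longrightarrow> i \<le> j \<and> j \<le> M) \<Longrightarrow> i \<le> M \<Longrightarrow>
    len (gen 0 \<up> i \<cdot> cls (pos ws)) \<le> c * (3 * length ws + (M - i) + M)"
proof (induction ws arbitrary: i)
  case Nil
  have "len (gen 0 \<up> i) \<le> i * c"
    using len_pow[of "gen 0" i] c(1) by (meson gen_closed le_trans mult_le_mono2)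
  also have "\<dots> \<le> c * (3 * length ([] :: nat list) + (M - i) + M)"
    unfolding mult.commute[of i] by (rule mult_le_mono2) (use Nil.prems(3) in simp)
  finally show ?case by (simp add: one_cls[symmetric])
next
  case (Cons j ws)
  let ?P = "cls (pos ws)" and ?x = "gen 0"
  have split: "cls (pos (j # ws)) = gen j \<cdot> ?P" by (simp add: mult_cls)
  have j: "i \<le> j" "j \<le> M" using Cons.prems(2) by auto
  show ?case
  proof (cases j)
    case 0
    then have "i = 0" using j by simp
    have "len (?x \<up> 0 \<cdot> ?P) \<le> c * (3 * length ws + (M - 0) + M)"
      by (rule Cons.IH) (use Cons.prems in auto)
    moreover have "len (?x \<cdot> ?P) \<le> len ?x + len ?P" by (rule len_mult) auto
    ultimately show ?thesis using c(1) \<open>i = 0\<close> 0 split by (simp add: algebra_simps)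
  next
    case (Suc m)
    let ?Q = "?x \<up> m \<cdot> ?P"
    have IH: "len ?Q \<le> c * (3 * length ws + (M - m) + M)"
    proof (rule Cons.IH)
      show "sorted ws" using Cons.prems(1) by simp
      show "m \<le> M" using j Suc by simp
      show "m \<le> k \<and> k \<le> M" if k: "k \<in> set ws" for k
      proof
        have "j \<le> k" using Cons.prems(1) k by simp
        then show "m \<le> k" using Suc by simp
        show "k \<le> M" using Cons.prems(2)[of k] k by simp
      qed
    qed
    have gm: "gen j = tinv (?x \<up> m) \<cdot> (gen 1 \<cdot> ?x \<up> m)"
      using gen_conj_pow[of m] Suc by (intro inv_solve_left[THEN iffD2]) auto
    \<comment> \<open>\<open>y\<close> is the power of \<open>gen 0\<close> with exponent
      \<open>i - m\<close>, which is positive only for \<open>i = Suc m\<close>. The conditional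
      makes the bound \<open>m - i\<close> or \<open>1\<close>. In the latter case, the
      \<open>3\<close> per letter covers \<open>gen 1\<close>, this \<open>gen 0\<close>, and the
      step by which \<open>M - m\<close> exceeds \<open>M - i\<close>.\<close>
    obtain y where y: "y \<in> carrier thompson_F" "?x \<up> i \<cdot> tinv (?x \<up> m) = y"
      "len y \<le> c * (m + 2 - i - (if i \<le> m then 2 else 0))"
    proof (cases "i \<le> m")
      case True
      let ?z = "?x \<up> (m - i)"
      have "?x \<up> m = ?z \<cdot> ?x \<up> i"
        using True by (simp add: nat_pow_mult)
      then have "?x \<up> i \<cdot> tinv (?x \<up> m) = tinv ?z"
        by (simp add: inv_mult_group flip: m_assoc)
      moreover have "len (tinv ?z) \<le> c * (m - i)"
      proof -
        have "len (tinv ?z) \<le> len ?z" by (rule len_inv_le) simp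
        also have "\<dots> \<le> (m - i) * len ?x" by (rule len_pow) simp
        also have "\<dots> \<le> (m - i) * c" using c(1) by (rule mult_le_mono2)
        finally show ?thesis by (simp only: mult.commute)
      qed
      ultimately show thesis using that[of "tinv ?z"] True by simp
    next
      case False
      then have i: "i = Suc m" using j Suc by simp
      have "?x \<up> i = ?x \<cdot> ?x \<up> m"
        unfolding i by (rule nat_pow_Suc2) simp
      then have "?x \<up> i \<cdot> tinv (?x \<up> m) = ?x"
        by (simp add: m_assoc)
      then show thesis using that[of ?x] c(1) False i by simp
    qed
    have "?x \<up> i \<cdot> cls (pos (j # ws)) = y \<cdot> (gen 1 \<cdot> ?Q)"
      unfolding split gm y(2)[symmetric] by (simp add: m_assoc)
    also have "len \<dots> \<le> len y + (len (gen 1) + len ?Q)"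
      using len_mult[of y "gen 1 \<cdot> ?Q"] len_mult[of "gen 1" ?Q] y(1) by simp
    also have "\<dots> \<le> c * (m + 2 - i - (if i \<le> m then 2 else 0)) + (c + c * (3 * length ws + (M - m) + M))"
      using y(3) IH c(2) by linarith
    also have "\<dots> = c * ((m + 2 - i - (if i \<le> m then 2 else 0)) + 1 + (3 * length ws + (M - m) + M))"
      by (simp add: algebra_simps)
    also have "\<dots> \<le> c * (3 * length (j # ws) + (M - i) + M)"
      using j Suc by (intro mult_le_mono2) auto
    finally show ?thesis .
  qed
qed

lemma len_pw:
  assumes c: "len (gen 0) \<le> c" "len (gen 1) \<le> c"
  shows "len (cls (pos (pw t))) \<le> 5 * c * nodes t"
proof -
  have "len (gen 0 \<up> 0 \<cdot> cls (pos (pw t))) \<le>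
      c * (3 * length (pw t) + (nodes t - 0) + nodes t)"
    using pw_bounds(2)[of _ t] by (intro len_pos_aux[OF c] pw_bounds(3)) (auto intro: less_imp_le)
  also have "\<dots> \<le> c * (3 * nodes t + (nodes t - 0) + nodes t)"
    using pw_bounds(1)[of t] by (intro mult_le_mono2) simp
  finally show ?thesis by simp
qed

text \<open>The element is the positive word of the domain tree times the inverse of that of the
  range tree, each costing at most \<open>5 * c\<close> per node.\<close>

lemma rep_surj:
  assumes h: "dyadic h" and c: "len (gen 0) \<le> c" "len (gen 1) \<le> c"
  shows "\<exists>K\<in>carrier thompson_F. rep K = h \<and> len K \<le> 10 * c * card (brk h)"
proof -
  obtain t t' where t: "nodes t \<le> card (brk h)" "nodes t' \<le> card (brk h)"
    "\<And>x. act (pos (pw t')) (h x) = act (pos (pw t)) x"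
    using dyadic_word[OF h] by blast
  let ?a = "cls (pos (pw t))" and ?b = "cls (pos (pw t'))"
  let ?K = "?a \<cdot> tinv ?b"
  have "rep ?K x = h x" for x
  proof -
    have "rep ?K x = finv (act (pos (pw t'))) (act (pos (pw t)) x)"
      by (simp add: rep_mult rep_inv)
    also have "\<dots> = h x" using t(3)[of x] dyadic_inj[OF dyadic_act, of "pos (pw t')"] by (metis inv_f_f)
    finally show ?thesis .
  qed
  moreover have "len ?K \<le> 10 * c * card (brk h)"
  proof -
    have "len ?K \<le> len ?a + len ?b"
      using len_mult[of ?a "tinv ?b"] len_inv_le[of ?b] by simp
    also have "\<dots> \<le> 5 * c * card (brk h) + 5 * c * card (brk h)"
      using len_pw[OF c] t(1,2) by (intro add_mono) (meson le_trans mult_le_mono2)+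
    finally show ?thesis by simp
  qed
  ultimately show ?thesis by (intro bexI[of _ ?K]) auto
qed

lemma card_brk_le_len:
  assumes "finite S"
  shows "\<exists>C. \<forall>A\<in>carrier thompson_F. card (brk (rep A)) \<le> C * len A \<and> card (brk (finv (rep A))) \<le> C * len A"
proof -
  define C where "C = Max (insert 0 ((\<lambda>A. card (brk (rep A))) ` letters))"
  have fin: "finite letters" using assms by simp
  have 1: "card (brk (rep A)) \<le> C * len A" if A: "A \<in> carrier thompson_F" for A
  proof (rule subadditive_le_len[where \<phi> = "\<lambda>A. card (brk (rep A))", OF _ _ _ A])
    fix g h assume "g \<in> carrier thompson_F" "h \<in> carrier thompson_F"
    then show "card (brk (rep (g \<cdot> h))) \<le> card (brk (rep g)) + card (brk (rep h))"
      using card_brk_comp(2)[OF dyadic_inj dyadic_finite dyadic_finite, of "rep g" "rep h"] dyadic_rep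
      by (simp only: rep_mult)
  next
    show "card (brk (rep tone)) = 0" by (simp only: rep_one brk_id card.empty)
    show "card (brk (rep a)) \<le> C" if "a \<in> letters" for a
      unfolding C_def using fin that by (intro Max_ge) auto
  qed
  have "card (brk (finv (rep A))) \<le> C * len A" if A: "A \<in> carrier thompson_F" for A
  proof -
    have "card (brk (rep (tinv A))) \<le> C * len (tinv A)"
      by (rule 1) (rule inv_closed[OF A])
    also have "\<dots> \<le> C * len A" using len_inv_le[OF A] by (rule mult_le_mono2)
    finally show ?thesis unfolding rep_inv[OF A] .
  qed
  then show ?thesis using 1 by blast
qed

end

section \<open>Conjugate pairs with long conjugators\<close>

text \<open>The cones \<open>band j\<close> are permuted by \<open>x_map 0\<close> like the unit intervals of the line by translation.\<close>

definition band :: "int \<Rightarrow> bool list" where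
  "band j = (if 1 \<le> j then replicate (nat j) True @ [False] else replicate (nat (1 - j)) False @ [True])"

lemma band_pos: "band (1 + int j) = replicate (Suc j) True @ [False]"
  by (simp add: band_def nat_add_distrib)

lemma band_neg: "band (- int j) = replicate (Suc j) False @ [True]"
  by (simp add: band_def nat_add_distrib)

lemma lin_x_map_band: "lin (x_map 0) (band j) (band (j + 1))"
proof -
  consider n where "j = 1 + int n" | "j = 0" | n where "j = - int (Suc n)"
  proof (cases "1 \<le> j")
    case True
    then have "j = 1 + int (nat (j - 1))" by simp
    then show thesis by (rule that(1))
  next
    case False
    then have "j = 0 \<or> j = - int (Suc (nat (- j - 1)))" by auto
    then show thesis using that(2,3) by blast
  qed
  then show ?thesis
  proof cases
    case (1 n)
    have "j + 1 = 1 + int (Suc n)" using 1 by simp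
    then show ?thesis unfolding 1 using lin_x_map_0(3) by (simp only: band_pos replicate_Suc append_Cons)
  next
    case 2
    then show ?thesis using lin_x_map_0(2)[of "[]"] by (simp add: band_def)
  next
    case (3 n)
    have "j + 1 = - int n" using 3 by simp
    then show ?thesis unfolding 3 using lin_x_map_0(1) by (simp only: band_neg replicate_Suc append_Cons)
  qed
qed

lemma band_disjoint: assumes "x \<in> cone (band i)" "x \<in> cone (band j)" shows "i = j"
proof (rule ccontr)
  assume "i \<noteq> j"
  have *: False if ij: "i < j" and x: "x \<in> cone (band i)" "x \<in> cone (band j)" for i j
  proof -
    obtain s where s: "x = band i @- s" using x(1) by (rule in_coneE)
    obtain t where t: "x = band j @- t" using x(2) by (rule in_coneE)
    consider "1 \<le> i" | "i < 1" "1 \<le> j" | "j < 1" using ij by linarith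
    then show False
    proof cases
      case 1
      then have "\<not> x !! nat i" "x !! nat i"
        using ij by (simp add: s band_def shift_snth nth_append, simp add: t band_def shift_snth nth_append)
      then show False by simp
    next
      case 2
      then have "\<not> x !! 0" "x !! 0"
        using ij by (simp add: s band_def shift_snth nth_append, simp add: t band_def shift_snth nth_append)
      then show False by simp
    next
      case 3
      then have "x !! nat (1 - j)" "\<not> x !! nat (1 - j)"
        using ij by (simp add: t band_def shift_snth nth_append, simp add: s band_def shift_snth nth_append)
      then show False by simp
    qed
  qed
  show False using *[OF _ assms] *[OF _ assms(2,1)] \<open>i \<noteq> j\<close> by linarith
qed

text \<open>The element \<open>x_n\<^sup>2 x_{n+1}\<^sup>-\<^sup>1 x_n\<^sup>-\<^sup>1\<close> is a copy of \<open>x_0\<close> supported on the cone \<open>1\<dots>10\<close>.\<close>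

definition local_word :: "nat \<Rightarrow> nat word" where
  "local_word n = [(n, True), (n, True), (Suc n, False), (n, False)]"

lemma act_local_word:
  "act (local_word n) (replicate n True @- False ## s) = replicate n True @- False ## x_map 0 s"
  "x \<notin> cone (replicate n True @ [False]) \<Longrightarrow> act (local_word n) x = x"
proof -
  have zero: "act (local_word 0) (False ## s) = False ## x_map 0 s" for s
    by (cases s rule: bool_stream_cases2) (simp_all add: local_word_def letter_map_def)
  have zero': "act (local_word 0) (True ## s) = True ## s" for s
    by (simp add: local_word_def letter_map_def)
  have suc: "act (local_word (Suc n)) (True ## s) = True ## act (local_word n) s"
    "act (local_word (Suc n)) (False ## s) = False ## s" for n s
    by (simp_all add: local_word_def letter_map_def)
  show "act (local_word n) (replicate n True @- False ## s) = replicate n True @- False ## x_map 0 s"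
    by (induction n) (simp_all add: zero suc)
  show "x \<notin> cone (replicate n True @ [False]) \<Longrightarrow> act (local_word n) x = x"
  proof (induction n arbitrary: x)
    case 0
    have "x \<in> cone [False]" if "x = False ## s" for s
      using shift_in_cone[of "[False]" s] that by simp
    then show ?case using 0 by (cases x rule: bool_stream_cases) (auto simp: zero')
  next
    case (Suc n)
    show ?case
    proof (cases x rule: bool_stream_cases)
      case (2 s)
      have "s \<notin> cone (replicate n True @ [False])"
      proof
        assume "s \<in> cone (replicate n True @ [False])"
        then obtain t where "s = (replicate n True @ [False]) @- t" by (rule in_coneE)
        then have "x = (replicate (Suc n) True @ [False]) @- t" by (simp add: 2)
        then show False using Suc.prems shift_in_cone by metis
      qed
      then show ?thesis using Suc.IH by (simp add: 2 suc)
    qed (simp add: suc)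
  qed
qed

lemma act_local_word_band:
  "act (local_word (Suc n)) (band i @- s) = band i @- (if i = 1 + int n then x_map 0 s else s)"
proof (cases "i = 1 + int n")
  case True
  then show ?thesis using act_local_word(1)[of "Suc n" s] by (simp add: band_pos)
next
  case False
  then have "band i @- s \<notin> cone (replicate (Suc n) True @ [False])"
    using band_disjoint[of "band i @- s" i "1 + int n"] by (auto simp only: band_pos[symmetric] shift_in_cone)
  then show ?thesis using act_local_word(2) False by simp
qed

text \<open>The power turns \<open>n + 1\<close> letters \<open>False\<close> into one. If
  \<open>h\<close> were linear at \<open>v @ replicate m False\<close>, the image word would thus be
  shorter than \<open>w\<close> by \<open>n - m\<close>, although the image lies in
  \<open>cone w\<close>.\<close>

lemma funpow_x_map_breaks:
  assumes h: "\<And>s. h (v @- s) = w @- (x_map 0 ^^ n) s" and m: "m < n"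
  shows "v @ replicate m False \<in> brk h"
proof (rule ccontr)
  assume "v @ replicate m False \<notin> brk h"
  then obtain u where u: "lin h (v @ replicate m False) u" by (rule not_brkE)
  have l: "lin (x_map 0 ^^ n) (replicate (Suc n) False) [False]" for n
  proof (induction n)
    case (Suc n)
    have "lin (x_map 0) (replicate (Suc (Suc n)) False) (replicate (Suc n) False)"
      using lin_x_map_0(1) by simp
    from lin_comp[OF this Suc] show ?case by (simp add: funpow_swap1 comp_def lin_def)
  qed (simp add: lin_def)
  have "u @ replicate (Suc n - m) False = w @ [False]"
  proof (rule shift_eq_all_imp_eq)
    fix s
    have "replicate (Suc n) False = replicate m False @ replicate (Suc n - m) False"
      using m by (simp flip: replicate_add)
    then have "h (v @- replicate m False @- replicate (Suc n - m) False @- s) =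
        w @- (x_map 0 ^^ n) (replicate (Suc n) False @- s)"
      by (simp only: h shift_append)
    also have "\<dots> = w @- False ## s" using l[of n] by (simp add: lin_def)
    finally have "h (v @- replicate m False @- replicate (Suc n - m) False @- s) = w @- False ## s" .
    then show "(u @ replicate (Suc n - m) False) @- s = (w @ [False]) @- s"
      using u by (simp add: lin_def)
  qed
  then have "length (u @ replicate (Suc n - m) False) = length (w @ [False])" by (rule arg_cong)
  then have "length u < length w" using m by simp
  moreover have "cone u \<subseteq> cone w"
  proof
    fix x assume "x \<in> cone u"
    then obtain s where "x = u @- s" by (rule in_coneE)
    then have "x = h (v @- (replicate m False @- s))" using u by (simp add: lin_def)
    then show "x \<in> cone w" by (simp add: h)
  qed
  ultimately show False using prefix_length_le[OF cone_subset_imp_prefix] by (simp add: leD)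
qed

text \<open>Besides translating the bands by two, \<open>f\<close> applies \<open>x_0\<^sup>n\<close> on arrival at the bands \<open>1\<close> and \<open>2n + 2\<close>,
  and \<open>g\<close> on arrival at \<open>1\<close> and \<open>2\<close>.  A conjugator translates all bands by some \<open>k\<close>.  Whatever \<open>k\<close> is,
  for each \<open>l = 1, \<dots>, n\<close> it acts on one of the bands \<open>2l - 1\<close> and \<open>2l\<close> by \<open>x_0\<^sup>n\<close> or its inverse.\<close>

lemma many_breaks:
  assumes c: "intertwines f g h"
    and f: "\<And>j s. f (band j @- s) =
      band (j + 2) @- (x_map 0 ^^ (if j + 2 = 1 \<or> j + 2 = 2 * int n + 2 then n else 0)) s"
    and g: "\<And>j s. g (band j @- s) =
      band (j + 2) @- (x_map 0 ^^ (if j + 2 = 1 \<or> j + 2 = 2 then n else 0)) s"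
  shows "n * n \<le> card (brk h) + card (brk (finv h))"
proof -
  have h: "dyadic h" and hfg: "\<And>x. h (f x) = g (h x)" using c by (auto simp: intertwines_def)
  note b = dyadic_bij[OF h]
  \<comment> \<open>\<open>F j\<close> and \<open>G j\<close> are the powers of
    \<open>x_map 0\<close> accumulated by the time of arrival at band \<open>j\<close>. In
    coordinates changed by them, \<open>f\<close> and \<open>g\<close> become pure translations of
    the bands by two.\<close>
  define F where "F j = (if 1 \<le> j \<and> (odd j \<or> 2 * int n + 2 \<le> j) then n else 0)" for j
  define G where "G j = (if 1 \<le> j then n else 0)" for j :: int
  have Fstep: "F (j + 2) = (if j + 2 = 1 \<or> j + 2 = 2 * int n + 2 then n else 0) + F j" for j
  proof (cases "odd j")
    case True
    then have "j \<noteq> 0" "j + 2 \<noteq> 2 * int n + 2" by auto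
    then show ?thesis using True by (auto simp: F_def)
  next
    case False
    then have "j \<noteq> - 1" by auto
    then show ?thesis using False by (auto simp: F_def)
  qed
  have Gstep: "G (j + 2) = (if j + 2 = 1 \<or> j + 2 = 2 then n else 0) + G j" for j
    by (auto simp: G_def)
  \<comment> \<open>The least sequence is fixed by \<open>h\<close>, and \<open>h\<close> is linear
    near it. This determines the translation \<open>k\<close> on the bands far to the left, where
    \<open>F\<close> and \<open>G\<close> vanish; applying \<open>f\<close> and \<open>g\<close>
    spreads it to all bands.\<close>
  have zero: "h (sconst False) = sconst False"
  proof -
    obtain x where "h x = sconst False" using b by (metis bij_is_surj surjD)
    then have "h (sconst False) \<le> sconst False"
      using dyadic_le_iff[OF h, of "sconst False" x] sconst_False_le[of x] by simp
    then show ?thesis using sconst_False_le by (rule antisym)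
  qed
  obtain i0 where "stake i0 (sconst False) \<notin> brk h"
    using stake_not_brk[OF dyadic_finite[OF h], of 0 "sconst False"] by blast
  moreover have st: "stake i (sconst False) = replicate i False" for i
    by (intro nth_equalityI) (auto simp: id_funpow)
  ultimately obtain w where w: "lin h (replicate i0 False) w" by (auto elim: not_brkE)
  define i1 where "i1 = length w"
  have "w @- sconst False = h (replicate i0 False @- sconst False)" using w unfolding lin_def by metis
  then have "w @- sconst False = sconst False" by (simp only: shift_replicate_sconst zero)
  then have "sconst False \<in> cone w" by (metis shift_in_cone)
  then have w0: "w = replicate i1 False" by (simp only: in_cone_iff st i1_def)
  define k where "k = int i0 - int i1"
  have base: "h (band j @- (x_map 0 ^^ F j) s) = band (j + k) @- (x_map 0 ^^ G (j + k)) s"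
    if j: "j \<le> - int i0" for j s
  proof -
    define m where "m = nat (- j - int i0)"
    have m: "j = - int (i0 + m)" "j + k = - int (i1 + m)" using j by (auto simp: m_def k_def)
    have "F j = 0" "G (j + k) = 0" using m by (auto simp: F_def G_def)
    moreover have "h (band j @- s) = band (j + k) @- s"
    proof -
      have e: "band (- int (i + m)) = replicate i False @ replicate (Suc m) False @ [True]" for i
        unfolding band_neg add_Suc_right[symmetric] replicate_add by simp
      show ?thesis using w unfolding m(2) unfolding m(1) e by (simp add: lin_def w0)
    qed
    ultimately show ?thesis by simp
  qed
  have key: "h (band j @- (x_map 0 ^^ F j) s) = band (j + k) @- (x_map 0 ^^ G (j + k)) s"
    if "j \<le> - int i0 + 2 * int t" for t j s
    using that
  proof (induction t arbitrary: j)
    case 0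
    then show ?case using base by simp
  next
    case (Suc t)
    define i where "i = j - 2"
    have j: "j = i + 2" by (simp add: i_def)
    have IH: "h (band i @- (x_map 0 ^^ F i) s) = band (i + k) @- (x_map 0 ^^ G (i + k)) s"
      using Suc by (intro Suc.IH) (simp add: i_def)
    have "band j @- (x_map 0 ^^ F j) s = f (band i @- (x_map 0 ^^ F i) s)"
      unfolding f j Fstep by (simp only: funpow_add o_apply)
    then have "h (band j @- (x_map 0 ^^ F j) s) = g (band (i + k) @- (x_map 0 ^^ G (i + k)) s)"
      by (simp only: hfg IH)
    also have "\<dots> = band (i + k + 2) @- (x_map 0 ^^ G (i + k + 2)) s"
      unfolding g Gstep by (simp only: funpow_add o_apply)
    also have "i + k + 2 = j + k" by (simp add: j)
    finally show ?case .
  qed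
  have key: "h (band j @- (x_map 0 ^^ F j) s) = band (j + k) @- (x_map 0 ^^ G (j + k)) s" for j s
    by (rule key[of _ "nat (j + int i0)"]) auto
  \<comment> \<open>In the first case \<open>F\<close> is \<open>0\<close> on band
    \<open>2 * l + 2\<close> and \<open>G\<close> is \<open>n\<close> on its image; in the second
    \<open>F\<close> is \<open>n\<close> on band \<open>2 * l + 1\<close> and \<open>G\<close> is
    \<open>0\<close> on its image. Either way one band supplies \<open>n\<close> breaks, of
    \<open>h\<close> or of its inverse, and the disjoint sum keeps the two kinds apart.\<close>
  define \<iota> where "\<iota> = (\<lambda>(l, m). if 1 \<le> 2 * int l + 2 + k then Inl (band (2 * int l + 2) @ replicate m False)
    else Inr (band (2 * int l + 1 + k) @ replicate m False))"
  have "\<iota> ` ({..<n} \<times> {..<n}) \<subseteq> brk h <+> brk (finv h)"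
  proof
    fix y assume "y \<in> \<iota> ` ({..<n} \<times> {..<n})"
    then obtain l m where lm: "l < n" "m < n" "y = \<iota> (l, m)" by auto
    show "y \<in> brk h <+> brk (finv h)"
    proof (cases "1 \<le> 2 * int l + 2 + k")
      case True
      have "F (2 * int l + 2) = 0" "G (2 * int l + 2 + k) = n" using lm True by (auto simp: F_def G_def)
      then have "h (band (2 * int l + 2) @- s) = band (2 * int l + 2 + k) @- (x_map 0 ^^ n) s" for s
        using key[of "2 * int l + 2" s] by simp
      from funpow_x_map_breaks[OF this lm(2)] show ?thesis using True lm(3) by (simp add: \<iota>_def Plus_def)
    next
      case False
      have "F (2 * int l + 1) = n" "G (2 * int l + 1 + k) = 0" using lm False by (auto simp: F_def G_def)
      then have "h (band (2 * int l + 1) @- (x_map 0 ^^ n) s) = band (2 * int l + 1 + k) @- s" for s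
        using key[of "2 * int l + 1" s] by simp
      then have "finv h (band (2 * int l + 1 + k) @- s) = band (2 * int l + 1) @- (x_map 0 ^^ n) s" for s
        using b by (metis bij_inv_eq_iff)
      from funpow_x_map_breaks[OF this lm(2)] show ?thesis using False lm(3) by (simp add: \<iota>_def Plus_def)
    qed
  qed
  moreover have "inj_on \<iota> ({..<n} \<times> {..<n})"
  proof -
    have eq: "i = j \<and> m = m'" if "band i @ replicate m False = band j @ replicate m' False" for i j m m'
    proof -
      have "band i @- replicate m False @- sconst False = band j @- replicate m' False @- sconst False"
        using that by (metis shift_append)
      then have "i = j" using band_disjoint[of _ i j] shift_in_cone by metis
      then show ?thesis using that by simp
    qed
    show ?thesis by (rule inj_onI) (auto simp: \<iota>_def split: if_splits dest!: eq)
  qed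
  moreover have fin: "finite (brk h)" "finite (brk (finv h))"
    using dyadic_finite[OF h] dyadic_finite[OF dyadic_inv[OF h]] by auto
  ultimately have "card ({..<n} \<times> {..<n}) \<le> card (brk h <+> brk (finv h))"
    by (intro card_inj_on_le) auto
  then show ?thesis using fin by (simp add: card_Plus)
qed

section \<open>The two conjugate elements and their lengths\<close>

abbreviation dshift :: "nat word set" where "dshift \<equiv> cls [(0, True), (0, True)]"

abbreviation early :: "nat \<Rightarrow> nat word set" where
  "early n \<equiv> cls (local_word 1) \<up> n"

text \<open>This is the \<open>n\<close>-th power of a copy of \<open>x_0\<close> on the band
  \<open>2 * t + 2\<close>. Conjugating the whole power keeps its length linear in
  \<open>n + t\<close>, whereas bounding each factor separately would give a product.\<close>

fun late :: "nat \<Rightarrow> nat \<Rightarrow> nat word set" where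
  "late n 0 = cls (local_word 2) \<up> n"
| "late n (Suc t) = tinv dshift \<cdot> late n t \<cdot> dshift"

definition witness :: "nat \<Rightarrow> nat \<Rightarrow> nat word set" where
  "witness n t = dshift \<cdot> early n \<cdot> late n t"

lemma early_closed: "early n \<in> carrier thompson_F"
  by simp

lemma late_closed: "late n t \<in> carrier thompson_F"
  by (induction t) simp_all

lemma witness_closed: "witness n t \<in> carrier thompson_F"
  unfolding witness_def by (intro m_closed early_closed late_closed gen_closed)

lemma rep_pow:
  fixes n :: nat
  assumes "A \<in> carrier thompson_F"
  shows "rep (A \<up> n) = rep A ^^ n"
proof -
  show ?thesis
  proof (induction n)
    case 0
    show ?case by (simp only: nat_pow_0 rep_one funpow.simps)
  next
    case (Suc n)
    show ?case using assms by (simp only: nat_pow_Suc rep_mult nat_pow_closed Suc funpow.simps)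
  qed
qed

lemma rep_dshift_band: "rep dshift (band j @- s) = band (j + 2) @- s"
  using lin_x_map_band[of j] lin_x_map_band[of "j + 1"] by (simp add: letter_map_def lin_def add.commute)

lemma rep_local_pow_band:
  "rep (cls (local_word (Suc i)) \<up> n) (band j @- s) =
    band j @- (x_map 0 ^^ (if j = 1 + int i then n else 0)) s" for n :: nat
  unfolding rep_pow[OF gen_closed]
  by (induction n) (simp_all add: act_local_word_band)

lemma rep_late_band:
  "rep (late n t) (band j @- s) = band j @- (x_map 0 ^^ (if j = 2 * int t + 2 then n else 0)) s"
proof (induction t arbitrary: j s)
  case 0
  show ?case using rep_local_pow_band[of 1 n j s] by (simp add: numeral_2_eq_2)
next
  case (Suc t)
  have "rep (late n (Suc t)) = rep dshift \<circ> (rep (late n t) \<circ> finv (rep dshift))"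
    by (simp only: late.simps rep_mult rep_inv m_closed inv_closed gen_closed late_closed)
  moreover have "finv (rep dshift) (band j @- s) = band (j - 2) @- s"
    using rep_dshift_band[of "j - 2" s] dyadic_bij[OF dyadic_rep[OF gen_closed]]
    by (simp only: diff_add_cancel) (metis bij_inv_eq_iff)
  ultimately have "rep (late n (Suc t)) (band j @- s) =
      rep dshift (band (j - 2) @- (x_map 0 ^^ (if j - 2 = 2 * int t + 2 then n else 0)) s)"
    by (simp only: o_apply Suc.IH)
  also have "\<dots> = band j @- (x_map 0 ^^ (if j = 2 * int (Suc t) + 2 then n else 0)) s"
    unfolding rep_dshift_band by simp
  finally show ?case .
qed

lemma rep_witness_band:
  "rep (witness n t) (band j @- s) =
    band (j + 2) @- (x_map 0 ^^ (if j + 2 = 1 \<or> j + 2 = 2 * int t + 2 then n else 0)) s"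
proof -
  have "rep (witness n t) = rep (late n t) \<circ> (rep (early n) \<circ> rep dshift)"
    unfolding witness_def by (simp only: rep_mult m_closed gen_closed late_closed early_closed)
  then have "rep (witness n t) (band j @- s) = rep (late n t) (rep (early n) (band (j + 2) @- s))"
    by (simp only: o_apply rep_dshift_band)
  also have "rep (early n) (band (j + 2) @- s) =
      band (j + 2) @- (x_map 0 ^^ (if j + 2 = 1 then n else 0)) s"
    using rep_local_pow_band[of 0 n "j + 2" s] by simp
  finally show ?thesis unfolding rep_late_band by auto
qed

text \<open>\<open>early n\<close> moves only points of band 1 and \<open>late n t\<close> fixes all
  of these, so the supports are disjoint.\<close>

lemma early_late_commute: "early n \<cdot> late n t = late n t \<cdot> early n"
proof (rule rep_inject)
  show "early n \<cdot> late n t \<in> carrier thompson_F"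
    "late n t \<cdot> early n \<in> carrier thompson_F"
    by (intro m_closed early_closed late_closed)+
  let ?e = "rep (early n)" and ?l = "rep (late n t)"
  have l1: "?l x = x" if x: "x \<in> cone (band 1)" for x
  proof -
    obtain s where s: "x = band 1 @- s" using x by (rule in_coneE)
    show ?thesis unfolding s rep_late_band by simp
  qed
  have e1: "?e x = x" if "x \<notin> cone (band 1)" for x
  proof -
    have "act (local_word 1) x = x"
      using act_local_word(2)[of x 1] that by (simp add: band_def)
    then have "(act (local_word 1) ^^ m) x = x" for m by (induction m) simp_all
    then show ?thesis by (simp add: rep_pow)
  qed
  have e2: "?e x \<in> cone (band 1)" if x: "x \<in> cone (band 1)" for x
  proof -
    obtain s where s: "x = band 1 @- s" using x by (rule in_coneE)
    show ?thesis unfolding s One_nat_def rep_local_pow_band by simp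
  qed
  have l2: "?l x \<notin> cone (band 1)" if "x \<notin> cone (band 1)" for x
    using l1[of "?l x"] that dyadic_inj[OF dyadic_rep[OF late_closed]] by (metis injD)
  have "?l (?e x) = ?e (?l x)" for x
    using l1 e1 e2 l2 by (cases "x \<in> cone (band 1)") simp_all
  then show "rep (early n \<cdot> late n t) = rep (late n t \<cdot> early n)"
    by (simp only: rep_mult early_closed late_closed) (simp only: fun_eq_iff o_apply simp_thms)
qed

text \<open>Moving \<open>late n (Suc t)\<close> past \<open>dshift\<close> turns it into
  \<open>late n t\<close>, and conjugation by \<open>late n t\<close> then brings this factor from
  the front to the end. Each such conjugation reduces the lag by one.\<close>

lemma witness_conjugate: "conjugate thompson_F (witness n t) (witness n 0)"
proof (induction t)
  case 0
  show ?case unfolding conjugate_def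
    by (rule bexI[of _ "tone"]) (simp_all add: witness_closed)
next
  case (Suc t)
  note cl = gen_closed early_closed[of n] late_closed[of n] witness_closed[of n] m_closed inv_closed
  let ?m = "mult thompson_F"
  obtain k where k: "k \<in> carrier thompson_F"
    "witness n 0 = ?m (?m (tinv k) (witness n t)) k"
    using Suc by (auto simp: conjugate_def)
  have "?m dshift (late n (Suc t)) = ?m (late n t) dshift"
    using cl by (simp add: m_assoc[symmetric] del: rep_cls)
  then have "witness n (Suc t) = ?m (late n t) (?m dshift (early n))"
    unfolding witness_def using cl early_late_commute[of n "Suc t"]
    by (metis m_assoc)
  then have "witness n t = ?m (?m (tinv (late n t)) (witness n (Suc t))) (late n t)"
    using cl by (simp add: witness_def m_assoc[symmetric])
  then have "witness n 0 = ?m (?m (tinv (?m (late n t) k)) (witness n (Suc t))) (?m (late n t) k)"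
    using k cl by (simp add: inv_mult_group m_assoc)
  then show ?case unfolding conjugate_def using k(1) cl by (intro bexI[of _ "?m (late n t) k"]) auto
qed

context thompson_generated
begin

lemma len_witness:
  "len (witness n t) \<le> len dshift + n * len (cls (local_word 1)) + (2 * t * len dshift + n * len (cls (local_word 2)))"
proof -
  have late: "len (late n t) \<le> 2 * t * len dshift + n * len (cls (local_word 2))"
  proof (induction t)
    case 0
    show ?case using len_pow[OF gen_closed] by simp
  next
    case (Suc t)
    have "len (late n (Suc t)) \<le> len (tinv dshift) + len (late n t) + len dshift"
      unfolding late.simps
      by (rule order_trans[OF len_mult]) (intro m_closed inv_closed late_closed gen_closed add_mono len_mult order_refl)+
    also have "\<dots> \<le> len dshift + (2 * t * len dshift + n * len (cls (local_word 2))) + len dshift"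
      by (intro add_mono len_inv_le gen_closed Suc order_refl)
    finally show ?case by simp
  qed
  have "len (witness n t) \<le> len dshift + len (early n) + len (late n t)"
    unfolding witness_def
    by (rule order_trans[OF len_mult]) (intro m_closed early_closed late_closed gen_closed add_mono len_mult order_refl)+
  also have "\<dots> \<le> len dshift + n * len (cls (local_word 1)) + (2 * t * len dshift + n * len (cls (local_word 2)))"
    by (intro add_mono late len_pow gen_closed order_refl)
  finally show ?thesis .
qed

section \<open>Quadratic bounds for the conjugator distance\<close>

lemma conjugator_distance_attained:
  assumes "conjugate thompson_F g h"
  shows "\<exists>k\<in>carrier thompson_F. h = tinv k \<cdot> g \<cdot> k \<and>
    conjugator_distance thompson_F S g h = len k"
proof -
  have "\<exists>m. \<exists>k\<in>carrier thompson_F. h = tinv k \<cdot> g \<cdot> k \<and> m = len k"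
    using assms by (auto simp: conjugate_def)
  from LeastI_ex[OF this] show ?thesis unfolding conjugator_distance_def by blast
qed

lemma conjugator_distance_le:
  assumes "k \<in> carrier thompson_F" "h = tinv k \<cdot> g \<cdot> k"
  shows "conjugator_distance thompson_F S g h \<le> len k"
  unfolding conjugator_distance_def by (rule Least_le) (use assms in blast)

lemma conjugator_distance_upper:
  assumes "finite S"
  shows "\<exists>B. \<forall>n. \<forall>g\<in>carrier thompson_F. \<forall>h\<in>carrier thompson_F.
    conjugate thompson_F g h \<longrightarrow> len g + len h \<le> n \<longrightarrow> conjugator_distance thompson_F S g h \<le> B * (n + 1)\<^sup>2"
proof -
  obtain C where C: "\<And>A. A \<in> carrier thompson_F \<Longrightarrow>
      card (brk (rep A)) \<le> C * len A \<and> card (brk (finv (rep A))) \<le> C * len A"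
    using card_brk_le_len[OF assms] by blast
  define c where "c = len (gen 0) + len (gen 1)"
  \<comment> \<open>\<open>260\<close> is \<open>26\<close> from
    \<open>small_conjugator_exists\<close> times \<open>10\<close> from \<open>rep_surj\<close>; the
    square comes from \<open>C * n + 1 \<le> (C + 1) * (n + 1)\<close>.\<close>
  define B where "B = 260 * c * (C + 1)\<^sup>2"
  have "conjugator_distance thompson_F S g h \<le> B * (n + 1)\<^sup>2"
    if gh: "g \<in> carrier thompson_F" "h \<in> carrier thompson_F" "conjugate thompson_F g h" "len g + len h \<le> n"
    for n g h
  proof -
    obtain k where k: "k \<in> carrier thompson_F" "h = tinv k \<cdot> g \<cdot> k"
      using gh(3) by (auto simp: conjugate_def)
    then have c0: "intertwines (rep g) (rep h) (rep k)" using conjugate_iff_intertwines gh by blast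
    have "len g \<le> n" "len h \<le> n" using gh(4) by linarith+
    note le = this[THEN mult_le_mono2, of C]
    have "card (brk (rep g)) \<le> C * n" "card (brk (rep h)) \<le> C * n" "card (brk (finv (rep h))) \<le> C * n"
      by (rule order_trans[OF conjunct1[OF C[OF gh(1)]] le(1)],
          rule order_trans[OF conjunct1[OF C[OF gh(2)]] le(2)],
          rule order_trans[OF conjunct2[OF C[OF gh(2)]] le(2)])
    from small_conjugator_exists[OF c0 this] obtain h' where
      h': "intertwines (rep g) (rep h) h'" "card (brk h') \<le> 26 * (C * n + 1)\<^sup>2" by blast
    have "dyadic h'" using h'(1) by (simp add: intertwines_def)
    from rep_surj[OF this, of c] obtain K where K: "K \<in> carrier thompson_F" "rep K = h'"
      "len K \<le> 10 * c * card (brk h')" by (auto simp: c_def)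
    have "h = tinv K \<cdot> g \<cdot> K" using conjugate_iff_intertwines[OF gh(1,2) K(1)] h'(1) K(2) by simp
    then have "conjugator_distance thompson_F S g h \<le> len K" by (rule conjugator_distance_le[OF K(1)])
    also have "\<dots> \<le> 10 * c * (26 * (C * n + 1)\<^sup>2)"
      by (rule order_trans[OF K(3) mult_le_mono2[OF h'(2)]])
    also have "\<dots> \<le> 10 * c * (26 * ((C + 1) * (n + 1))\<^sup>2)"
      by (intro mult_le_mono2 power_mono) (auto simp: algebra_simps)
    also have "\<dots> = B * (n + 1)\<^sup>2" unfolding power_mult_distrib B_def by (simp only: mult.assoc)
    finally show ?thesis .
  qed
  then show ?thesis by blast
qed

lemma conjugator_distance_lower:
  assumes "finite S"
  shows "\<exists>C D. \<forall>n. \<exists>g\<in>carrier thompson_F. \<exists>h\<in>carrier thompson_F. conjugate thompson_F g h \<and>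
    len g + len h \<le> D * (n + 1) \<and> n\<^sup>2 \<le> C * conjugator_distance thompson_F S g h"
proof -
  obtain C where C: "\<And>A. A \<in> carrier thompson_F \<Longrightarrow>
      card (brk (rep A)) \<le> C * len A \<and> card (brk (finv (rep A))) \<le> C * len A"
    using card_brk_le_len[OF assms] by blast
  define D where "D = 2 * len dshift + 2 * len (cls (local_word 1)) + 2 * len (cls (local_word 2))"
  have "conjugate thompson_F (witness n n) (witness n 0) \<and>
    len (witness n n) + len (witness n 0) \<le> D * (n + 1) \<and>
    n\<^sup>2 \<le> (2 * C) * conjugator_distance thompson_F S (witness n n) (witness n 0)" for n
  proof (intro conjI)
    show cj: "conjugate thompson_F (witness n n) (witness n 0)" by (rule witness_conjugate)
    show "len (witness n n) + len (witness n 0) \<le> D * (n + 1)"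
      using len_witness[of n n] len_witness[of n 0] by (simp add: D_def algebra_simps)
    obtain k where k: "k \<in> carrier thompson_F" "witness n 0 = tinv k \<cdot> witness n n \<cdot> k"
      "conjugator_distance thompson_F S (witness n n) (witness n 0) = len k"
      using conjugator_distance_attained[OF cj] by blast
    have "intertwines (rep (witness n n)) (rep (witness n 0)) (rep k)"
      using conjugate_iff_intertwines[OF witness_closed witness_closed k(1)] k(2) by blast
    from many_breaks[OF this rep_witness_band] have "n * n \<le> card (brk (rep k)) + card (brk (finv (rep k)))"
      using rep_witness_band[of n 0] by simp
    also have "\<dots> \<le> C * len k + C * len k" using C[OF k(1)] by (intro add_mono) auto
    finally show "n\<^sup>2 \<le> (2 * C) * conjugator_distance thompson_F S (witness n n) (witness n 0)"
      by (simp add: k(3) power2_eq_square)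
  qed
  then show ?thesis using witness_closed by blast
qed

end

theorem mainTheorem1:
  fixes S :: "nat word set set"
  assumes "finite S"
    and "S \<subseteq> carrier thompson_F"
    and "generate thompson_F S = carrier thompson_F"
  shows "\<exists>a b :: real. 0 < a \<and> a < b \<and>
           (\<forall>\<^sub>F n in sequentially.
              a * (real n)\<^sup>2 \<le> real (conjugator_length_function thompson_F S n) \<and>
              real (conjugator_length_function thompson_F S n) \<le> b * (real n)\<^sup>2)"
proof -
  interpret thompson_generated S by unfold_locales (use assms in auto)
  let ?cd = "conjugator_distance thompson_F S" and ?clf = "conjugator_length_function thompson_F S"
  obtain B where B: "\<And>n g h. g \<in> carrier thompson_F \<Longrightarrow> h \<in> carrier thompson_F \<Longrightarrow>
      conjugate thompson_F g h \<Longrightarrow> len g + len h \<le> n \<Longrightarrow> ?cd g h \<le> B * (n + 1)\<^sup>2"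
    using conjugator_distance_upper[OF assms(1)] by blast
  obtain C0 D0 where CD: "\<And>n. \<exists>g\<in>carrier thompson_F. \<exists>h\<in>carrier thompson_F. conjugate thompson_F g h \<and>
      len g + len h \<le> D0 * (n + 1) \<and> n\<^sup>2 \<le> C0 * ?cd g h"
    using conjugator_distance_lower[OF assms(1)] by blast
  define C D where "C = Suc C0" and "D = Suc D0"
  let ?M = "\<lambda>n. {?cd g h | g h. g \<in> carrier thompson_F \<and> h \<in> carrier thompson_F \<and>
      conjugate thompson_F g h \<and> len g + len h \<le> n}"
  \<comment> \<open>The upper bound also makes the set under \<open>Max\<close> finite; the pair of
    neutral elements makes it nonempty for every \<open>n\<close>, including
    \<open>0\<close>.\<close>
  have sub: "?M n \<subseteq> {..B * (n + 1)\<^sup>2}" for n using B by auto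
  then have fin: "finite (?M n)" for n by (meson finite_atMost finite_subset)
  have ne: "?M n \<noteq> {}" for n
  proof -
    have "conjugate thompson_F tone tone"
      unfolding conjugate_def by (rule bexI[of _ "tone"]) simp_all
    moreover have "len tone + len tone \<le> n" by (simp add: len_one)
    ultimately show ?thesis by blast
  qed
  have upper: "?clf n \<le> B * (n + 1)\<^sup>2" for n
    unfolding conjugator_length_function_def using Max_in[OF fin ne, of n] sub[of n] by blast
  have lower: "m\<^sup>2 \<le> C * ?clf n" if m: "D * (m + 1) \<le> n" for m n
  proof -
    obtain g h where gh: "g \<in> carrier thompson_F" "h \<in> carrier thompson_F" "conjugate thompson_F g h"
      "len g + len h \<le> D0 * (m + 1)" "m\<^sup>2 \<le> C0 * ?cd g h" using CD by blast
    have "D0 * (m + 1) \<le> D * (m + 1)" unfolding D_def by (rule mult_le_mono1) simp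
    then have "len g + len h \<le> n" using gh(4) m by linarith
    then have "?cd g h \<in> ?M n" using gh by blast
    then have "?cd g h \<le> ?clf n"
      unfolding conjugator_length_function_def by (rule Max_ge[OF fin])
    then have "C0 * ?cd g h \<le> C * ?clf n" unfolding C_def by (intro mult_le_mono) auto
    then show ?thesis using gh(5) by linarith
  qed
  have D: "real D > 0" and C: "real C > 0" by (simp_all add: C_def D_def)
  \<comment> \<open>With \<open>m = n div D - 1\<close> and \<open>n div D\<close> at least
    \<open>3\<close>, one has \<open>n \<le> 2 * D * m\<close>; squaring and inserting
    \<open>m\<^sup>2 \<le> C * ?clf n\<close> gives this constant.\<close>
  define a where "a = 1 / (4 * real C * (real D)\<^sup>2)"
  \<comment> \<open>\<open>4 * B\<close> comes from \<open>n + 1 \<le> 2 * n\<close>; the remaining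
    summands ensure \<open>a < b\<close>.\<close>
  define b where "b = 4 * real B + a + 1"
  have a: "0 < a" using C D by (simp add: a_def)
  moreover have "a < b" by (simp add: b_def)
  moreover have "a * (real n)\<^sup>2 \<le> real (?clf n) \<and> real (?clf n) \<le> b * (real n)\<^sup>2" if n: "4 * D \<le> n" for n
  proof
    define m where "m = n div D - 1"
    have q: "n div D \<ge> 4" using n by (simp add: D_def less_eq_div_iff_mult_less_eq)
    have "D * (m + 1) \<le> n" using q by (simp add: m_def)
    from lower[OF this] have "real (m\<^sup>2) \<le> real (C * ?clf n)" by (simp only: of_nat_le_iff)
    then have l: "(real m)\<^sup>2 \<le> real C * real (?clf n)" by simp
    have "real n = real D * real (n div D) + real (n mod D)"
      by (metis mult_div_mod_eq of_nat_add of_nat_mult)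
    moreover have "n mod D \<le> D" by (rule mod_le_divisor) (simp add: D_def)
    then have "real (n mod D) \<le> real D" by (simp only: of_nat_le_iff)
    ultimately have "real n \<le> real D * (real (n div D) + 1)" by (simp add: algebra_simps)
    also have "\<dots> \<le> real D * (2 * real m)"
      using q by (intro mult_left_mono) (auto simp: m_def of_nat_diff)
    finally have "(real n)\<^sup>2 \<le> (real D * (2 * real m))\<^sup>2" by (intro power_mono) auto
    also have "\<dots> = 4 * (real D)\<^sup>2 * (real m)\<^sup>2" by (simp add: power_mult_distrib)
    also have "\<dots> \<le> 4 * (real D)\<^sup>2 * (real C * real (?clf n))" using l by (intro mult_left_mono) auto
    finally show "a * (real n)\<^sup>2 \<le> real (?clf n)"
      using C D by (simp add: a_def field_simps)
    have "1 \<le> n" using n by (simp add: D_def)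
    have "real (?clf n) \<le> real (B * (n + 1)\<^sup>2)" using upper[of n] by (simp only: of_nat_le_iff)
    also have "\<dots> = real B * (real n + 1)\<^sup>2" by simp
    also have "\<dots> \<le> real B * (2 * real n)\<^sup>2" using \<open>1 \<le> n\<close> by (intro mult_left_mono power_mono) auto
    also have "\<dots> = (4 * real B) * (real n)\<^sup>2" by (simp add: power_mult_distrib)
    also have "\<dots> \<le> b * (real n)\<^sup>2" using a by (intro mult_right_mono) (auto simp: b_def)
    finally show "real (?clf n) \<le> b * (real n)\<^sup>2" .
  qed
  ultimately show ?thesis by (intro exI[of _ a] exI[of _ b]) (auto simp: eventually_sequentially)
qed

end
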